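(* Let $k$ be an algebraically closed field of characteristic $0$ and let $A$ be a finitely generated $k$-algebra that is a domain whose Gelfand-Kirillov dimension is in $[2,3)$. If $A$ has a nonzero locally nilpotent derivation, then $A$ has quadratic growth.
   Context: Algebras are associative and unital, not necessarily commutative. A derivation of a $k$-algebra $A$ is a $k$-linear map $\delta:A\to A$ with $\delta(ab)=a\delta(b)+\delta(a)b$ for all $a,b\in A$; it is locally nilpotent if for each $a\in A$ there is a natural number $n$ with $\delta^n(a)=0$. For a finitely generated $k$-algebra $A$, the Gelfand-Kirillov dimension (GK dimension) is $\mathrm{GKdim}(A)=\limsup_{n\to\infty}\frac{\log \dim_k(V^n)}{\log n}$, where $V$ is any finite-dimensional $k$-vector subspace of $A$ that contains $1$ and generates $A$ as a $k$-algebra (the value does not depend on $V$). $A$ has quadratic growth if $A$ has a finite-dimensional subspace $V$ that contains $1$ and generates $A$ as an algebra, such that there exist positive constants $C_1$ and $C_2$ with $C_1n^2<\dim_k(V^n)<C_2n^2$ for all natural numbers $n\ge 1$. *)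

theory Defs
  imports "HOL-Analysis.Analysis" "HOL-Computational_Algebra.Polynomial"
begin

locale k_algebra = vector_space scale
  for scale :: "'k::field \<Rightarrow> 'a::ring_1 \<Rightarrow> 'a" +
  assumes scale_mult_left: "scale c (a * b) = scale c a * b"
    and scale_mult_right: "scale c (a * b) = a * scale c b"
begin

definition subalgebra :: "'a set \<Rightarrow> bool" where
  "subalgebra S \<longleftrightarrow> subspace S \<and> 1 \<in> S \<and> (\<forall>a\<in>S. \<forall>b\<in>S. a * b \<in> S)"

definition generates :: "'a set \<Rightarrow> bool" where
  "generates S \<longleftrightarrow> subalgebra hull S = UNIV"

definition finitely_generated :: bool where
  "finitely_generated \<longleftrightarrow> (\<exists>S. finite S \<and> generates S)"

definition finite_dim :: "'a set \<Rightarrow> bool" where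
  "finite_dim V \<longleftrightarrow> (\<exists>B. finite B \<and> span B = V)"

definition generating_subspace :: "'a set \<Rightarrow> bool" where
  "generating_subspace V \<longleftrightarrow> subspace V \<and> finite_dim V \<and> 1 \<in> V \<and> generates V"

text \<open>\<open>subspace_power V n\<close> is $V^n$, the linear span of all products of \<open>n\<close> elements of \<open>V\<close>.\<close>

primrec subspace_power :: "'a set \<Rightarrow> nat \<Rightarrow> 'a set" where
  "subspace_power V 0 = span {1}"
| "subspace_power V (Suc n) = span {a * b | a b. a \<in> V \<and> b \<in> subspace_power V n}"

definition growth_exponent :: "'a set \<Rightarrow> ereal" where
  "growth_exponent V =
     limsup (\<lambda>n. ereal (ln (real (dim (subspace_power V n))) / ln (real n)))"

text \<open>The choice of the subspace is immaterial: see \<open>GKdim_eq\<close> below. The value is only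
  meaningful for finitely generated algebras.\<close>

definition GKdim :: ereal where
  "GKdim = growth_exponent (SOME V. generating_subspace V)"

definition quadratic_growth :: bool where
  "quadratic_growth \<longleftrightarrow>
     (\<exists>V. generating_subspace V \<and>
       (\<exists>C1 C2 :: real. C1 > 0 \<and> C2 > 0 \<and>
         (\<forall>n::nat. n \<ge> 1 \<longrightarrow>
            C1 * real n ^ 2 < real (dim (subspace_power V n)) \<and>
            real (dim (subspace_power V n)) < C2 * real n ^ 2)))"

definition derivation :: "('a \<Rightarrow> 'a) \<Rightarrow> bool" where
  "derivation \<delta> \<longleftrightarrow> Vector_Spaces.linear scale scale \<delta> \<and> (\<forall>a b. \<delta> (a * b) = a * \<delta> b + \<delta> a * b)"

definition locally_nilpotent :: "('a \<Rightarrow> 'a) \<Rightarrow> bool" where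
  "locally_nilpotent \<delta> \<longleftrightarrow> (\<forall>a. \<exists>n::nat. (\<delta> ^^ n) a = 0)"

lemma subspace_subspace_power: "subspace (subspace_power V n)"
  by (cases n) auto

lemma subspace_power_mult:
  assumes "a \<in> subspace_power V m" "b \<in> subspace_power V n"
  shows "a * b \<in> subspace_power V (m + n)"
  using assms(1)
proof (induction m arbitrary: a)
  case 0
  then obtain c where "a = scale c 1" by (auto simp: span_singleton)
  then have "a * b = scale c b" by (metis scale_mult_left mult_1)
  then show ?case using assms(2) subspace_subspace_power subspace_scale by auto
next
  case (Suc m)
  have "a \<in> span {a * b | a b. a \<in> V \<and> b \<in> subspace_power V m}" using Suc.prems by simp
  then show ?case
  proof (induction rule: span_induct_alt)
    case base
    show ?case using subspace_subspace_power subspace_0 by auto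
  next
    case (step c x y)
    then obtain u v where uv: "x = u * v" "u \<in> V" "v \<in> subspace_power V m" by auto
    have "x * b \<in> subspace_power V (Suc m + n)"
      using uv Suc.IH[of v] by (auto simp: mult.assoc intro!: span_base)
    then have "scale c (x * b) + y * b \<in> subspace_power V (Suc m + n)"
      using step subspace_subspace_power subspace_scale subspace_add by blast
    then show ?case by (simp add: distrib_right scale_mult_left)
  qed
qed

lemma subspace_power_1: "subspace V \<Longrightarrow> subspace_power V 1 = V"
proof -
  assume V: "subspace V"
  have "{a * b | a b. a \<in> V \<and> b \<in> span {1}} = V"
  proof (intro equalityI subsetI)
    fix x assume "x \<in> {a * b | a b. a \<in> V \<and> b \<in> span {1}}"
    then obtain a c where "a \<in> V" "x = a * scale c 1" by (auto simp: span_singleton)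
    then show "x \<in> V" using V by (metis scale_mult_right mult_1_right subspace_scale)
  next
    fix x assume "x \<in> V"
    then have "x = x * 1 \<and> x \<in> V \<and> 1 \<in> span {1}" by (simp add: span_base)
    then show "x \<in> {a * b | a b. a \<in> V \<and> b \<in> span {1}}" by blast
  qed
  then show ?thesis using V by (simp add: span_eq_iff)
qed

lemma one_in_subspace_power: "1 \<in> V \<Longrightarrow> 1 \<in> subspace_power V n"
proof (induction n)
  case (Suc n)
  then have "1 * 1 \<in> {a * b | a b. a \<in> V \<and> b \<in> subspace_power V n}" by blast
  then show ?case by (simp add: span_base)
qed (simp add: span_base)

lemma subspace_power_mono:
  assumes "1 \<in> V" "m \<le> n" shows "subspace_power V m \<subseteq> subspace_power V n"
proof
  fix x assume "x \<in> subspace_power V m"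
  then show "x \<in> subspace_power V n"
    using subspace_power_mult[of x V m 1 "n - m"] one_in_subspace_power[OF assms(1)] assms(2)
    by simp
qed

lemma subspace_power_exhausts:
  assumes V: "generating_subspace V"
  shows "\<exists>n. x \<in> subspace_power V n"
proof -
  have one: "1 \<in> V" and sV: "subspace V" and gen: "subalgebra hull V = UNIV"
    using V by (auto simp: generating_subspace_def generates_def)
  let ?U = "\<Union>n. subspace_power V n"
  have "subalgebra ?U"
    unfolding subalgebra_def
  proof (intro conjI ballI)
    show "subspace ?U"
    proof (rule subspaceI)
      show "0 \<in> ?U" using subspace_subspace_power subspace_0 by blast
    next
      fix x y assume "x \<in> ?U" "y \<in> ?U"
      then obtain m n where "x \<in> subspace_power V m" "y \<in> subspace_power V n" by blast
      then have "x \<in> subspace_power V (max m n)" "y \<in> subspace_power V (max m n)"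
        using subspace_power_mono[OF one] by (meson max.cobounded1 max.cobounded2 subsetD)+
      then show "x + y \<in> ?U" using subspace_subspace_power subspace_add by blast
    next
      fix c x assume "x \<in> ?U"
      then show "scale c x \<in> ?U" using subspace_subspace_power subspace_scale by blast
    qed
    show "1 \<in> ?U" using one_in_subspace_power[OF one] by blast
    fix a b assume "a \<in> ?U" "b \<in> ?U"
    then show "a * b \<in> ?U" using subspace_power_mult by blast
  qed
  moreover have "V \<subseteq> ?U" using subspace_power_1[OF sV] by blast
  ultimately have "subalgebra hull V \<subseteq> ?U" by (intro hull_minimal)
  then show ?thesis using gen by blast
qed

lemma finite_dim_subspace_power:
  assumes "finite_dim V" shows "finite_dim (subspace_power V n)"
proof (induction n)
  case 0
  show ?case unfolding finite_dim_def by (intro exI[of _ "{1}"]) simp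
next
  case (Suc n)
  obtain B where B: "finite B" "span B = V" using assms by (auto simp: finite_dim_def)
  obtain C where C: "finite C" "span C = subspace_power V n" using Suc by (auto simp: finite_dim_def)
  let ?P = "(\<lambda>(a, b). a * b) ` (B \<times> C)"
  have step1: "b * y \<in> span ?P" if "b \<in> B" "y \<in> span C" for b y
    using that(2)
  proof (induction rule: span_induct_alt)
    case base
    then show ?case by (simp add: span_zero)
  next
    case (step c x y)
    have "b * x \<in> span ?P" using step that(1) by (intro span_base) force
    then show ?case using step
      by (simp add: distrib_left scale_mult_right[symmetric] span_add span_scale)
  qed
  have step2: "x * y \<in> span ?P" if "x \<in> span B" "y \<in> span C" for x y
    using that(1)
  proof (induction rule: span_induct_alt)
    case base
    then show ?case by (simp add: span_zero)
  next
    case (step c u v)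
    have "u * y \<in> span ?P" using step that(2) step1 by blast
    then show ?case using step
      by (simp add: distrib_right scale_mult_left[symmetric] span_add span_scale)
  qed
  have "span ?P = subspace_power V (Suc n)"
  proof
    have "?P \<subseteq> {a * b | a b. a \<in> V \<and> b \<in> subspace_power V n}"
      using B(2) C(2) span_superset by auto blast
    then show "span ?P \<subseteq> subspace_power V (Suc n)" by (simp add: span_mono)
    have "{a * b | a b. a \<in> V \<and> b \<in> subspace_power V n} \<subseteq> span ?P"
      using step2 B(2) C(2) by auto
    then show "subspace_power V (Suc n) \<subseteq> span ?P" by (simp add: span_minimal)
  qed
  moreover have "finite ?P" using B(1) C(1) by blast
  ultimately show ?case unfolding finite_dim_def by blast
qed

lemma dim_mono_finite_dim:
  assumes "S \<subseteq> T" "finite_dim T" shows "dim S \<le> dim T"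
proof -
  obtain C where C: "finite C" "span C = T" using assms(2) by (auto simp: finite_dim_def)
  obtain B where B: "B \<subseteq> T" "independent B" "T \<subseteq> span B" "card B = dim T"
    using basis_exists by blast
  have "finite B" using independent_span_bound[OF C(1) B(2)] B(1) C(2) by auto
  then have "dim S \<le> card B" using assms(1) B(3) by (intro dim_le_card) auto
  then show ?thesis using B(4) by simp
qed

lemma dim_pos:
  assumes "subspace S" "finite_dim S" "(1::'a) \<in> S" shows "dim S \<ge> 1"
proof -
  have "independent {1::'a}" by simp
  then have "dim {1::'a} = 1" using dim_eq_card_independent by fastforce
  then show ?thesis using dim_mono_finite_dim[of "{1}" S] assms by simp
qed

lemma growth_exponent_le:
  assumes V: "generating_subspace V" and W: "generating_subspace W"
  shows "growth_exponent W \<le> growth_exponent V"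
proof -
  have V1: "1 \<in> V" and Vf: "finite_dim V" using V by (auto simp: generating_subspace_def)
  have W1: "1 \<in> W" and Wf: "finite_dim W" using W by (auto simp: generating_subspace_def)
  obtain B where B: "finite B" "span B = W" using Wf by (auto simp: finite_dim_def)
  obtain f where f: "\<And>x. x \<in> subspace_power V (f x)"
    using subspace_power_exhausts[OF V] by metis
  define m where "m = Suc (Max (insert 0 (f ` B)))"
  have "B \<subseteq> subspace_power V m"
  proof
    fix x assume "x \<in> B"
    then have "f x \<le> m" using B(1) unfolding m_def by (simp add: le_SucI)
    then show "x \<in> subspace_power V m" using f[of x] subspace_power_mono[OF V1] by blast
  qed
  then have WV: "W \<subseteq> subspace_power V m"
    using B(2) subspace_subspace_power span_minimal by blast
  have m: "m \<ge> 1" by (simp add: m_def)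
  have sub: "subspace_power W n \<subseteq> subspace_power V (m * n)" for n
  proof (induction n)
    case (Suc n)
    have "{a * b | a b. a \<in> W \<and> b \<in> subspace_power W n} \<subseteq> subspace_power V (m * Suc n)"
      using subspace_power_mult[of _ V m _ "m * n"] WV Suc by (auto simp: subset_iff)
    then show ?case using subspace_subspace_power span_minimal by simp
  qed simp
  have dle: "dim (subspace_power W n) \<le> dim (subspace_power V (m * n))" for n
    by (intro dim_mono_finite_dim sub finite_dim_subspace_power Vf)
  have dW: "dim (subspace_power W n) \<ge> 1" for n
    by (intro dim_pos subspace_subspace_power finite_dim_subspace_power Wf
        one_in_subspace_power W1)
  have dV: "dim (subspace_power V n) \<ge> 1" for n
    by (intro dim_pos subspace_subspace_power finite_dim_subspace_power Vf
        one_in_subspace_power V1)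
  define v where "v n = ln (real (dim (subspace_power V n))) / ln (real n)" for n
  define w where "w n = ln (real (dim (subspace_power W n))) / ln (real n)" for n
  have lim: "(\<lambda>n. r * (ln (real (m * n)) / ln (real n))) \<longlonglongrightarrow> r" for r
  proof -
    have "(\<lambda>n. ln (real m) / ln (real n)) \<longlonglongrightarrow> 0"
      by (intro real_tendsto_divide_at_top[OF tendsto_const]
          filterlim_compose[OF ln_at_top filterlim_real_sequentially])
    then have "(\<lambda>n. r * (ln (real m) / ln (real n) + 1)) \<longlonglongrightarrow> r * (0 + 1)"
      by (intro tendsto_intros)
    moreover have "eventually (\<lambda>n. r * (ln (real m) / ln (real n) + 1)
        = r * (ln (real (m * n)) / ln (real n))) sequentially"
      using eventually_ge_at_top[of 2]
    proof eventually_elim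
      case (elim n)
      then have "ln (real n) > 0" by simp
      then show ?case using elim m by (simp add: ln_mult field_simps)
    qed
    ultimately show ?thesis by (simp add: Lim_transform_eventually)
  qed
  have "limsup (\<lambda>n. ereal (w n)) \<le> y" if y: "limsup (\<lambda>n. ereal (v n)) < y" for y
  proof (cases y)
    case (real r)
    have ev: "eventually (\<lambda>n. ereal (v n) < y) sequentially" using Limsup_lessD[OF y] .
    then have "eventually (\<lambda>n. v n < r) sequentially" using real by simp
    then obtain N where N: "\<And>n. n \<ge> N \<Longrightarrow> v n < r" unfolding eventually_sequentially by blast
    have "eventually (\<lambda>n. w n \<le> r * (ln (real (m * n)) / ln (real n))) sequentially"
      using eventually_ge_at_top[of "max 2 N"]
    proof eventually_elim
      case (elim n)
      have n: "n \<ge> 2" "n \<ge> N" using elim by auto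
      have mn: "m * n \<ge> n" using m by simp
      have "real (m * n) > 1" using n mn by linarith
      then have lpos: "ln (real n) > 0" "ln (real (m * n)) > 0"
        using n by (auto intro: ln_gt_zero simp del: of_nat_mult)
      have "ln (real (dim (subspace_power W n))) \<le> ln (real (dim (subspace_power V (m * n))))"
        using dle[of n] dW[of n] dV[of "m * n"] by simp
      also have "\<dots> \<le> r * ln (real (m * n))"
        using N[of "m * n"] n mn lpos unfolding v_def
        by (simp add: pos_divide_less_eq less_imp_le del: of_nat_mult)
      finally show ?case unfolding w_def using lpos
        by (simp add: divide_right_mono del: of_nat_mult)
    qed
    then have "limsup (\<lambda>n. ereal (w n))
        \<le> limsup (\<lambda>n. ereal (r * (ln (real (m * n)) / ln (real n))))"
      by (intro Limsup_mono) simp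
    also have "\<dots> = ereal r"
      by (intro lim_imp_Limsup tendsto_ereal lim) simp
    finally show ?thesis using real by simp
  qed (use y in auto)
  then have "limsup (\<lambda>n. ereal (w n)) \<le> limsup (\<lambda>n. ereal (v n))" by (rule dense_ge)
  then show ?thesis by (simp add: growth_exponent_def v_def w_def)
qed

lemma finitely_generated_iff: "finitely_generated \<longleftrightarrow> (\<exists>V. generating_subspace V)"
proof
  assume finitely_generated
  then obtain S where S: "finite S" "subalgebra hull S = UNIV"
    by (auto simp: finitely_generated_def generates_def)
  have "S \<subseteq> span (insert 1 S)" by (meson span_superset subset_insertI subset_trans)
  then have "subalgebra hull span (insert 1 S) = UNIV" using hull_mono S(2) by blast
  then have "generating_subspace (span (insert 1 S))"
    using S(1) by (auto simp: generating_subspace_def finite_dim_def generates_def span_base)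
  then show "\<exists>V. generating_subspace V" by blast
next
  assume "\<exists>V. generating_subspace V"
  then obtain V B where V: "finite B" "span B = V" "subalgebra hull V = UNIV"
    by (auto simp: generating_subspace_def finite_dim_def generates_def)
  have "T = UNIV" if "subalgebra T" "B \<subseteq> T" for T
  proof -
    have "V \<subseteq> T" using that V(2) by (auto simp: subalgebra_def dest: span_minimal)
    then show ?thesis using V(3) that(1) hull_minimal by blast
  qed
  then have "subalgebra hull B = UNIV" by (auto simp: hull_def)
  then show finitely_generated using V(1) by (auto simp: finitely_generated_def generates_def)
qed

lemma GKdim_eq:
  assumes "generating_subspace V" shows "GKdim = growth_exponent V"
  unfolding GKdim_def
  using growth_exponent_le assms someI[of generating_subspace, OF assms] by (intro antisym)

end

end

theory Submission
  imports Defs "HOL-Real_Asymp.Real_Asymp"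
begin

text \<open>Let $B = \ker \delta$ and choose $x$ with $b = \delta(x) \neq 0 = \delta(b)$. The sum of the $B x^j$ is
  direct, so GK dimension below 3 leaves $B$ with subquadratic growth inside $A$, while an element
  $y \in B$ outside $k$ (which exists since otherwise $A$ would have linear growth) gives the
  quadratic lower bound through the monomials $y^i x^j$.

  For the upper bound work in the division ring of fractions of $A$, with $x' = b^{-1} x$ and
  $D = [x', \cdot]$. Let $H_n$ be the division subring generated by $B \cap V^n$. Subquadratic growth
  allows only sublinearly many $k(y)$-independent elements in $B \cap V^n$; this forces
  $H_n = H_{n+h}$ for some large $n$, hence $H = H_n$ is stable under $D$, and it makes $H$ finite
  dimensional over $k(y)$. Artin's shortest-relation argument then yields a central element $w$ of
  $H$ outside $k$, and $H$ is finite dimensional over $k(w)$ too. Now $D(w)$ is central in $H$, so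
  $D$ increases pole orders and degrees of coefficients in $k(w)$ by a bounded amount, and in
  $A \subseteq H[x'; D]$ an element of $V^n$ is described by $O(n)$ coefficients, each of degree and pole
  order $O(n)$ in $w$. No commutativity of $B$ (that is, no appeal to Tsen's theorem) is needed.\<close>

subsection \<open>Rings of left fractions\<close>

text \<open>The detour through \<open>x' = b^{-1} x\<close> is forced: \<open>b\<close> need not
  commute with B, so the commutator of \<open>x\<close> with an element of B can leave B, whereas
  \<open>x * c * b - b * c * x\<close> is always killed by \<delta> and equals b times the
  commutator of x' with \<open>c * b\<close>. This expression has a longer filtration degree than
  \<open>c\<close>, so \<open>D\<close> is only known to map level n into the division ring of level
  n + h; stabilisation of these rings closes that gap. A central element is wanted because
  \<open>D(f(y)) = f'(y) D(y)\<close> can fail when y and D(y) do not commute. Over a noncommutative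
  H, repeated application of D to fractions in y would then be out of control, while for central w
  only f'(w) and the one element D(w) appear. Algebraic closure makes every element outside k
  transcendental; characteristic 0 keeps \<delta>^n(x^n) = n! b^n nonzero. Each growth hypothesis is
  used to reach a contradiction at one suitable n, so a bound on the limsup suffices.\<close>

definition partial_left_linear :: "('a::ring_1_no_zero_divisors \<Rightarrow> 'a option) \<Rightarrow> bool" where
  "partial_left_linear f \<longleftrightarrow>
     (\<forall>a b u v. f a = Some u \<longrightarrow> f b = Some v \<longrightarrow> f (a + b) = Some (u + v)) \<and>
     (\<forall>r a u. f a = Some u \<longrightarrow> f (r * a) = Some (r * u)) \<and>
     (\<forall>a. \<exists>r u. r \<noteq> 0 \<and> f (r * a) = Some u)"

text \<open>Relating only maps with dense domain makes this a partial equivalence. Agreement is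
  required on the common domain, which is again dense, so maps that differ only in how far they are
  defined name the same fraction.\<close>

definition germ_eq :: "('a::ring_1_no_zero_divisors \<Rightarrow> 'a option) \<Rightarrow> ('a \<Rightarrow> 'a option) \<Rightarrow> bool" where
  "germ_eq f g \<longleftrightarrow> partial_left_linear f \<and> partial_left_linear g \<and>
     (\<forall>a u v. f a = Some u \<longrightarrow> g a = Some v \<longrightarrow> u = v)"

lemma pll_add: "partial_left_linear f \<Longrightarrow> f a = Some u \<Longrightarrow> f b = Some v \<Longrightarrow> f (a + b) = Some (u + v)"
  and pll_mult: "partial_left_linear f \<Longrightarrow> f a = Some u \<Longrightarrow> f (r * a) = Some (r * u)"
  unfolding partial_left_linear_def by blast+

lemma pll_dense:
  assumes "partial_left_linear f" obtains r u where "r \<noteq> 0" "f (r * a) = Some u"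
  using assms unfolding partial_left_linear_def by blast

lemma pll_dense2:
  assumes f: "partial_left_linear f" and g: "partial_left_linear g"
  obtains r u v where "r \<noteq> 0" "f (r * a) = Some u" "g (r * a) = Some v"
proof -
  obtain r u where r: "r \<noteq> 0" "f (r * a) = Some u" using pll_dense[OF f] .
  obtain s v where s: "s \<noteq> 0" "g (s * (r * a)) = Some v" using pll_dense[OF g] .
  have "f ((s * r) * a) = Some (s * u)" using pll_mult[OF f r(2), of s] by (simp add: mult.assoc)
  moreover have "g ((s * r) * a) = Some v" using s by (simp add: mult.assoc)
  moreover have "s * r \<noteq> 0" using r s by simp
  ultimately show ?thesis using that by blast
qed

text \<open>A point in the domains of \<open>f\<close> and \<open>h\<close> may lie outside that of
  \<open>g\<close>; a nonzero left multiple lies inside, and the factor cancels because there are no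
  zero divisors.\<close>

lemma germ_eq_trans:
  assumes "germ_eq f g" "germ_eq g h" shows "germ_eq f h"
proof -
  have p: "partial_left_linear f" "partial_left_linear g" "partial_left_linear h"
    using assms by (auto simp: germ_eq_def)
  have "u = v" if "f a = Some u" "h a = Some v" for a u v
  proof -
    obtain r w where r: "r \<noteq> 0" "g (r * a) = Some w" using pll_dense[OF p(2)] .
    have "r * u = w" "w = r * v"
      using assms r(2) pll_mult[OF p(1) that(1), of r] pll_mult[OF p(3) that(2), of r]
      unfolding germ_eq_def by blast+
    then show ?thesis using r(1) by simp
  qed
  then show ?thesis using p by (auto simp: germ_eq_def)
qed

lemma germ_eq_refl: "partial_left_linear f \<Longrightarrow> germ_eq f f"
  by (auto simp: germ_eq_def)

lemma pll_right_mult: "partial_left_linear (\<lambda>a. Some (a * c))"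
  unfolding partial_left_linear_def by (auto simp: distrib_right mult.assoc intro: exI[of _ 1])

text \<open>The maximal left ring of quotients of a domain: germs of left-linear maps on dense left
  ideals, with elements acting on the right. It exists without any Ore condition, which is what
  makes it a ring type; under the left Ore condition it is the division ring of fractions.\<close>

quotient_type (overloaded) 'a fractions = "'a::ring_1_no_zero_divisors \<Rightarrow> 'a option" / partial: germ_eq
proof (rule part_equivpI)
  show "\<exists>f::'a \<Rightarrow> 'a option. germ_eq f f" using germ_eq_refl[OF pll_right_mult] by blast
  show "symp germ_eq" by (auto simp: germ_eq_def symp_def)
  show "transp germ_eq" using germ_eq_trans by (auto simp: transp_def)
qed

definition pll_plus :: "('a::ring_1_no_zero_divisors \<Rightarrow> 'a option) \<Rightarrow> ('a \<Rightarrow> 'a option) \<Rightarrow> 'a \<Rightarrow> 'a option" where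
  "pll_plus f g a = Option.bind (f a) (\<lambda>u. Option.bind (g a) (\<lambda>v. Some (u + v)))"

text \<open>The left factor is applied first: elements act on the right, so right multiplications
  compose in the order in which ring elements are multiplied.\<close>

definition pll_comp :: "('a::ring_1_no_zero_divisors \<Rightarrow> 'a option) \<Rightarrow> ('a \<Rightarrow> 'a option) \<Rightarrow> 'a \<Rightarrow> 'a option" where
  "pll_comp f g a = Option.bind (f a) g"

definition pll_uminus :: "('a::ring_1_no_zero_divisors \<Rightarrow> 'a option) \<Rightarrow> 'a \<Rightarrow> 'a option" where
  "pll_uminus f a = map_option uminus (f a)"

lemma pll_plus:
  assumes "partial_left_linear f" "partial_left_linear g"
  shows "partial_left_linear (pll_plus f g)"
  unfolding partial_left_linear_def
proof (intro conjI allI impI)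
  fix a
  obtain r u v where "r \<noteq> 0" "f (r * a) = Some u" "g (r * a) = Some v"
    using pll_dense2[OF assms] .
  then show "\<exists>r u. r \<noteq> 0 \<and> pll_plus f g (r * a) = Some u"
    by (intro exI[of _ r] exI[of _ "u + v"]) (simp add: pll_plus_def)
next
  fix a b u v assume "pll_plus f g a = Some u" "pll_plus f g b = Some v"
  then obtain u1 u2 v1 v2 where "f a = Some u1" "g a = Some u2" "u = u1 + u2"
    "f b = Some v1" "g b = Some v2" "v = v1 + v2"
    by (auto simp: pll_plus_def bind_eq_Some_conv)
  then show "pll_plus f g (a + b) = Some (u + v)"
    using pll_add[OF assms(1)] pll_add[OF assms(2)] by (simp add: pll_plus_def algebra_simps)
next
  fix r a u assume "pll_plus f g a = Some u"
  then obtain u1 u2 where "f a = Some u1" "g a = Some u2" "u = u1 + u2"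
    by (auto simp: pll_plus_def bind_eq_Some_conv)
  then show "pll_plus f g (r * a) = Some (r * u)"
    using pll_mult[OF assms(1)] pll_mult[OF assms(2)] by (simp add: pll_plus_def distrib_left)
qed

lemma pll_comp:
  assumes f: "partial_left_linear f" and g: "partial_left_linear g"
  shows "partial_left_linear (pll_comp f g)"
  unfolding partial_left_linear_def
proof (intro conjI allI impI)
  fix a
  obtain r u where r: "r \<noteq> 0" "f (r * a) = Some u" using pll_dense[OF f] .
  obtain s v where s: "s \<noteq> 0" "g (s * u) = Some v" using pll_dense[OF g] .
  have "f ((s * r) * a) = Some (s * u)" using pll_mult[OF f r(2), of s] by (simp add: mult.assoc)
  then have "pll_comp f g ((s * r) * a) = Some v" using s by (simp add: pll_comp_def)
  moreover have "s * r \<noteq> 0" using r s by simp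
  ultimately show "\<exists>r u. r \<noteq> 0 \<and> pll_comp f g (r * a) = Some u" by blast
next
  fix a b u v assume "pll_comp f g a = Some u" "pll_comp f g b = Some v"
  then obtain u' v' where "f a = Some u'" "g u' = Some u" "f b = Some v'" "g v' = Some v"
    by (auto simp: pll_comp_def bind_eq_Some_conv)
  then show "pll_comp f g (a + b) = Some (u + v)"
    using pll_add[OF f] pll_add[OF g] by (simp add: pll_comp_def)
next
  fix r a u assume "pll_comp f g a = Some u"
  then obtain u' where "f a = Some u'" "g u' = Some u"
    by (auto simp: pll_comp_def bind_eq_Some_conv)
  then show "pll_comp f g (r * a) = Some (r * u)"
    using pll_mult[OF f] pll_mult[OF g] by (simp add: pll_comp_def)
qed

lemma pll_uminus:
  assumes "partial_left_linear f" shows "partial_left_linear (pll_uminus f)"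
  unfolding partial_left_linear_def
proof (intro conjI allI impI)
  fix a
  obtain r u where "r \<noteq> 0" "f (r * a) = Some u" using pll_dense[OF assms] .
  then show "\<exists>r u. r \<noteq> 0 \<and> pll_uminus f (r * a) = Some u"
    by (intro exI[of _ r] exI[of _ "- u"]) (simp add: pll_uminus_def)
next
  fix a b u v assume "pll_uminus f a = Some u" "pll_uminus f b = Some v"
  then obtain u' v' where "f a = Some u'" "f b = Some v'" "u = - u'" "v = - v'"
    by (auto simp: pll_uminus_def)
  then show "pll_uminus f (a + b) = Some (u + v)"
    using pll_add[OF assms] by (auto simp: pll_uminus_def)
next
  fix r a u assume "pll_uminus f a = Some u"
  then obtain u' where "f a = Some u'" "u = - u'"
    by (auto simp: pll_uminus_def)
  then show "pll_uminus f (r * a) = Some (r * u)"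
    using pll_mult[OF assms] by (auto simp: pll_uminus_def)
qed

lemma pll_zero: "partial_left_linear (\<lambda>_. Some 0)"
  using pll_right_mult[of 0] by simp

lemma pll_one: "partial_left_linear Some"
  using pll_right_mult[of 1] by simp

lemmas pll_intros = pll_plus pll_comp pll_uminus pll_zero pll_one pll_right_mult

lemma germ_eqI: "partial_left_linear f \<Longrightarrow> partial_left_linear g \<Longrightarrow>
   (\<And>a u v. f a = Some u \<Longrightarrow> g a = Some v \<Longrightarrow> u = v) \<Longrightarrow> germ_eq f g"
  by (simp add: germ_eq_def)

lemma germ_eqD: "germ_eq f f \<Longrightarrow> partial_left_linear f"
  by (simp add: germ_eq_def)

lemma germ_eq_cong_plus:
  assumes "germ_eq f f'" "germ_eq g g'" shows "germ_eq (pll_plus f g) (pll_plus f' g')"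
proof -
  have "u = v" if uv: "pll_plus f g a = Some u" "pll_plus f' g' a = Some v" for a u v
    using assms uv unfolding germ_eq_def pll_plus_def bind_eq_Some_conv option.inject by metis
  then show ?thesis using assms by (simp add: germ_eq_def pll_plus)
qed

lemma germ_eq_cong_uminus:
  assumes "germ_eq f f'" shows "germ_eq (pll_uminus f) (pll_uminus f')"
proof -
  have "u = v" if uv: "pll_uminus f a = Some u" "pll_uminus f' a = Some v" for a u v
    using assms uv unfolding germ_eq_def pll_uminus_def map_option_eq_Some by metis
  then show ?thesis using assms by (simp add: germ_eq_def pll_uminus)
qed

lemma germ_eq_cong_comp:
  assumes "germ_eq f f'" "germ_eq g g'" shows "germ_eq (pll_comp f g) (pll_comp f' g')"
proof -
  have "u = v" if uv: "pll_comp f g a = Some u" "pll_comp f' g' a = Some v" for a u v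
    using assms uv unfolding germ_eq_def pll_comp_def bind_eq_Some_conv by metis
  then show ?thesis using assms by (simp add: germ_eq_def pll_comp)
qed

section \<open>Ring structure on germs and the embedding of the ring\<close>

instantiation fractions :: (ring_1_no_zero_divisors) ring_1
begin

lift_definition zero_fractions :: "'a fractions" is "\<lambda>_. Some 0"
  by (rule germ_eq_refl[OF pll_zero])
lift_definition one_fractions :: "'a fractions" is Some
  by (rule germ_eq_refl[OF pll_one])
lift_definition plus_fractions :: "'a fractions \<Rightarrow> 'a fractions \<Rightarrow> 'a fractions" is pll_plus
  by (rule germ_eq_cong_plus)
lift_definition uminus_fractions :: "'a fractions \<Rightarrow> 'a fractions" is pll_uminus
  by (rule germ_eq_cong_uminus)
lift_definition times_fractions :: "'a fractions \<Rightarrow> 'a fractions \<Rightarrow> 'a fractions" is pll_comp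
  by (rule germ_eq_cong_comp)
definition minus_fractions :: "'a fractions \<Rightarrow> 'a fractions \<Rightarrow> 'a fractions" where
  "minus_fractions a b = a + - b"

instance
proof
  fix a b c :: "'a fractions"
  show "a + b + c = a + (b + c)"
    by transfer (rule germ_eqI; auto intro: pll_intros germ_eqD simp: pll_plus_def bind_eq_Some_conv add.assoc)
  show "a + b = b + a"
    by transfer (rule germ_eqI; auto intro: pll_intros germ_eqD simp: pll_plus_def bind_eq_Some_conv add.commute)
  show "0 + a = a"
    by transfer (rule germ_eqI; auto intro: pll_intros germ_eqD simp: pll_plus_def bind_eq_Some_conv)
  show "- a + a = 0"
    by transfer (rule germ_eqI; auto intro: pll_intros germ_eqD simp: pll_plus_def bind_eq_Some_conv pll_uminus_def)
  show "a - b = a + - b" by (rule minus_fractions_def)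
  show "a * b * c = a * (b * c)"
    by transfer (rule germ_eqI; auto intro: pll_intros germ_eqD simp: pll_comp_def bind_eq_Some_conv)
  show "1 * a = a"
    by transfer (rule germ_eqI; auto intro: pll_intros germ_eqD simp: pll_comp_def bind_eq_Some_conv)
  show "a * 1 = a"
    by transfer (rule germ_eqI; auto intro: pll_intros germ_eqD simp: pll_comp_def bind_eq_Some_conv)
  show "a * (b + c) = a * b + a * c"
    by transfer (rule germ_eqI; auto intro: pll_intros germ_eqD simp: pll_comp_def bind_eq_Some_conv pll_plus_def)
  show "(a + b) * c = a * c + b * c"
  proof transfer
    fix a b c :: "'a \<Rightarrow> 'a option"
    assume "germ_eq a a" "germ_eq b b" "germ_eq c c"
    then have p: "partial_left_linear a" "partial_left_linear b" "partial_left_linear c"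
      by (auto dest: germ_eqD)
    have "u = v" if uv: "pll_comp (pll_plus a b) c r = Some u"
      "pll_plus (pll_comp a c) (pll_comp b c) r = Some v" for r u v
    proof -
      obtain x y x' y' where "a r = Some x" "b r = Some y" "c (x + y) = Some u"
        "c x = Some x'" "c y = Some y'" "v = x' + y'"
        using uv by (auto simp: pll_comp_def pll_plus_def bind_eq_Some_conv)
      then show ?thesis using pll_add[OF p(3)] by (metis option.inject)
    qed
    then show "germ_eq (pll_comp (pll_plus a b) c) (pll_plus (pll_comp a c) (pll_comp b c))"
      using p by (intro germ_eqI pll_intros)
  qed
  show "(0::'a fractions) \<noteq> 1"
  proof transfer
    show "\<not> germ_eq (\<lambda>_. Some (0::'a)) Some" by (metis germ_eq_def option.inject zero_neq_one)
  qed
qed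

end

lift_definition frac_of :: "'a::ring_1_no_zero_divisors \<Rightarrow> 'a fractions" is "\<lambda>c a. Some (a * c)"
  by (rule germ_eq_refl[OF pll_right_mult])

lemma frac_of_0 [simp]: "frac_of 0 = 0"
  by transfer (simp add: germ_eq_refl pll_zero)

lemma frac_of_1 [simp]: "frac_of 1 = 1"
  by transfer (simp add: germ_eq_refl pll_one)

lemma frac_of_add: "frac_of (a + b) = frac_of a + frac_of b"
  by transfer (intro germ_eqI pll_intros; auto simp: pll_plus_def bind_eq_Some_conv distrib_left)

lemma frac_of_mult: "frac_of (a * b) = frac_of a * frac_of b"
  by transfer (intro germ_eqI pll_intros; auto simp: pll_comp_def bind_eq_Some_conv mult.assoc)

lemma frac_of_eq_iff: "frac_of a = frac_of b \<longleftrightarrow> a = b"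
proof
  show "frac_of a = frac_of b \<Longrightarrow> a = b"
    by transfer (auto simp: germ_eq_def dest: spec[of _ 1])
qed simp

lemma frac_of_diff: "frac_of (a - b) = frac_of a - frac_of b"
  by (metis add_diff_cancel diff_add_cancel frac_of_add)

lemma frac_of_sum: "frac_of (sum f I) = (\<Sum>i\<in>I. frac_of (f i))"
  by (induction I rule: infinite_finite_induct) (auto simp: frac_of_add)

lemma frac_of_power: "frac_of (a ^ n) = frac_of a ^ n"
  by (induction n) (auto simp: frac_of_mult)

text \<open>Right multiplication by a central \<open>c\<close> is also left multiplication by
  \<open>c\<close>, and left-linearity of a germ moves the latter to the outside.\<close>

lemma frac_of_central:
  assumes "\<And>a. a * c = c * a" shows "frac_of c * q = q * frac_of c"
proof (transfer fixing: c)
  fix q :: "'a \<Rightarrow> 'a option" assume "germ_eq q q"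
  then have q: "partial_left_linear q" by (rule germ_eqD)
  have "u = v" if "q (a * c) = Some u" "q a = Some w" "v = w * c" for a u v w
    using pll_mult[OF q that(2), of c] that assms[of a] assms[of w] by simp
  then show "germ_eq (pll_comp (\<lambda>a. Some (a * c)) q) (pll_comp q (\<lambda>a. Some (a * c)))"
    by (intro germ_eqI pll_intros q) (auto simp: pll_comp_def bind_eq_Some_conv)
qed

text \<open>The inverse of \<open>frac_of b\<close> sends \<open>r * b\<close> to \<open>r\<close>;
  its domain, the left ideal generated by \<open>b\<close>, is dense exactly by the Ore condition. A
  nonzero germ sends some \<open>a\<close> to some \<open>u\<close> other than 0, and is then the
  inverse of \<open>a\<close> times \<open>u\<close>.\<close>

lemma fractions_invertible:
  fixes q :: "'a::ring_1_no_zero_divisors fractions"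
  assumes ore: "\<And>a b::'a. b \<noteq> 0 \<Longrightarrow> \<exists>r s. r \<noteq> 0 \<and> r * a = s * b" and q: "q \<noteq> 0"
  shows "\<exists>p. q * p = 1 \<and> p * q = 1"
proof -
  have inv: "\<exists>p. frac_of b * p = 1 \<and> p * frac_of b = 1" if b: "b \<noteq> 0" for b :: 'a
  proof -
    define g where "g t = (if \<exists>r. t = r * b then Some (THE r. t = r * b) else None)" for t
    have g: "g t = Some r \<longleftrightarrow> t = r * b" for t r
    proof -
      have "(THE r. s * b = r * b) = s" for s using b by auto
      then show ?thesis unfolding g_def using b by (auto simp: mult_cancel_right)
    qed
    have pg: "partial_left_linear g"
      unfolding partial_left_linear_def g using ore[OF b] by (auto simp: distrib_right mult.assoc)
    then have gg: "germ_eq g g" by (rule germ_eq_refl)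
    define p where "p = abs_fractions g"
    have "frac_of b * p = 1"
      unfolding p_def frac_of.abs_eq times_fractions.abs_eq[OF germ_eq_refl[OF pll_right_mult] gg]
        one_fractions.abs_eq
      by (rule Quotient_rel_abs[OF Quotient_fractions], intro germ_eqI pll_intros pg) (use b in \<open>auto simp: pll_comp_def bind_eq_Some_conv g\<close>)
    moreover have "p * frac_of b = 1"
      unfolding p_def frac_of.abs_eq times_fractions.abs_eq[OF gg germ_eq_refl[OF pll_right_mult]]
        one_fractions.abs_eq
      by (rule Quotient_rel_abs[OF Quotient_fractions], intro germ_eqI pll_intros pg) (use b in \<open>auto simp: pll_comp_def bind_eq_Some_conv g\<close>)
    ultimately show ?thesis by blast
  qed
  have "\<exists>a u. a \<noteq> 0 \<and> u \<noteq> 0 \<and> frac_of a * q = frac_of u"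
    using q
  proof (transfer)
    fix q :: "'a \<Rightarrow> 'a option" assume "germ_eq q q" and n: "\<not> germ_eq q (\<lambda>_. Some 0)"
    then have q: "partial_left_linear q" by (simp add: germ_eqD)
    obtain a u where au: "q a = Some u" "u \<noteq> 0" using n using germ_eqI[OF q pll_zero] by metis
    have a: "a \<noteq> 0" using pll_mult[OF q au(1), of 0] au pll_add[OF q, of 0 u 0 u] by auto
    have "germ_eq (pll_comp (\<lambda>t. Some (t * a)) q) (\<lambda>t. Some (t * u))"
      using pll_mult[OF q au(1)]
      by (intro germ_eqI pll_intros q) (auto simp: pll_comp_def)
    then show "\<exists>a u. a \<noteq> 0 \<and> u \<noteq> 0 \<and> germ_eq (pll_comp (\<lambda>t. Some (t * a)) q) (\<lambda>t. Some (t * u))"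
      using a au by blast
  qed
  then obtain a u a' u' where
    a: "frac_of a * q = frac_of u" "frac_of a * a' = 1" "a' * frac_of a = 1"
      "frac_of u * u' = 1" "u' * frac_of u = 1" by (metis inv)
  have "q = a' * frac_of u" using a by (metis mult.assoc mult_1)
  then have "q * (u' * frac_of a) = 1" "(u' * frac_of a) * q = 1"
    using a by (metis mult.assoc mult_1)+
  then show ?thesis by blast
qed

subsection \<open>Polynomial evaluation and the Ore condition\<close>

text \<open>Gaussian elimination without division. It is applied to coefficients in k[T], so that
  dependence over k(w) is obtained without constructing this field.\<close>

lemma linear_system_nontrivial_solution:
  fixes g :: "'i \<Rightarrow> 'j \<Rightarrow> 'r::idom"
  assumes "finite I" "finite J" "card I < card J"
  shows "\<exists>f. (\<exists>j\<in>J. f j \<noteq> 0) \<and> (\<forall>i\<in>I. (\<Sum>j\<in>J. f j * g i j) = 0)"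
  using assms
proof (induction I arbitrary: J g rule: finite_induct)
  case empty
  then obtain j where "j \<in> J" by fastforce
  then show ?case by (auto intro!: exI[of _ "\<lambda>_. 1"])
next
  case (insert m I)
  show ?case
  proof (cases "\<forall>j\<in>J. g m j = 0")
    case True
    obtain f where "\<exists>j\<in>J. f j \<noteq> 0" "\<forall>i\<in>I. (\<Sum>j\<in>J. f j * g i j) = 0"
      using insert.IH[of J g] insert.prems insert.hyps by auto
    then show ?thesis using True by (intro exI[of _ f]) auto
  next
    case False
    then obtain j0 where j0: "j0 \<in> J" "g m j0 \<noteq> 0" by blast
    define a where "a = g m j0"
    define J' where "J' = J - {j0}"
    \<comment> \<open>The row is multiplied by the pivot \<open>a\<close> instead of dividing by it;
      column \<open>j0\<close> of the new system vanishes.\<close>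
    define g' where "g' i j = a * g i j - g i j0 * g m j" for i j
    have J': "finite J'" "card I < card J'" "J = insert j0 J'" "j0 \<notin> J'"
      using insert.prems insert.hyps j0(1) by (auto simp: J'_def)
    obtain f where f: "\<exists>j\<in>J'. f j \<noteq> 0" "\<And>i. i \<in> I \<Longrightarrow> (\<Sum>j\<in>J'. f j * g' i j) = 0"
      using insert.IH[OF J'(1) J'(2), of g'] by blast
    define h where "h j = (if j = j0 then - (\<Sum>j\<in>J'. f j * g m j) else a * f j)" for j
    have sum_h: "(\<Sum>j\<in>J. h j * g i j)
        = - (\<Sum>j\<in>J'. f j * g m j) * g i j0 + (\<Sum>j\<in>J'. a * f j * g i j)" for i
    proof -
      have "(\<Sum>j\<in>J'. h j * g i j) = (\<Sum>j\<in>J'. a * f j * g i j)"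
        using J'(4) by (intro sum.cong) (auto simp: h_def)
      then show ?thesis using J' by (simp add: h_def)
    qed
    have "(\<Sum>j\<in>J. h j * g m j) = 0"
      unfolding sum_h by (simp add: a_def sum_distrib_left sum_distrib_right algebra_simps)
    moreover have "(\<Sum>j\<in>J. h j * g i j) = 0" if "i \<in> I" for i
    proof -
      have "(\<Sum>j\<in>J. h j * g i j) = (\<Sum>j\<in>J'. f j * g' i j)"
        unfolding sum_h g'_def
        by (simp add: sum_distrib_left sum_distrib_right right_diff_distrib sum_subtractf algebra_simps)
      then show ?thesis using f(2)[OF that] by simp
    qed
    moreover have "\<exists>j\<in>J. h j \<noteq> 0"
    proof -
      obtain j where "j \<in> J'" "f j \<noteq> 0" using f(1) by blast
      then have "h j \<noteq> 0" "j \<in> J" using J' j0(2) by (auto simp: h_def a_def)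
      then show ?thesis by blast
    qed
    ultimately show ?thesis by blast
  qed
qed

context vector_space
begin

text \<open>An indexed relation also excludes repetitions, since equal members give one with
  coefficients 1 and -1. Cardinalities of families such as \<open>s * x ^ j\<close> can thus be read
  off from the index set.\<close>

lemma independent_family:
  assumes fin: "finite I"
    and ind: "\<And>g. (\<Sum>i\<in>I. scale (g i) (t i)) = 0 \<Longrightarrow> \<forall>i\<in>I. g i = 0"
  shows "inj_on t I" "independent (t ` I)"
proof -
  show inj: "inj_on t I"
  proof (rule inj_onI, rule ccontr)
    fix i j assume ij: "i \<in> I" "j \<in> I" "t i = t j" "i \<noteq> j"
    define g where "g l = (if l = i then 1 else if l = j then - 1 else 0 :: 'a)" for l
    have "(\<Sum>l\<in>I. scale (g l) (t l)) = (\<Sum>l\<in>{i, j}. scale (g l) (t l))"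
      using fin ij by (intro sum.mono_neutral_right) (auto simp: g_def)
    also have "\<dots> = 0" using ij by (simp add: g_def)
    finally have "g i = 0" using ind ij(1) by blast
    then show False by (simp add: g_def)
  qed
  show "independent (t ` I)"
  proof
    assume "dependent (t ` I)"
    then obtain u v where u: "v \<in> t ` I" "u v \<noteq> 0" "(\<Sum>v\<in>t ` I. scale (u v) v) = 0"
      using fin by (auto simp: dependent_finite)
    then have "(\<Sum>i\<in>I. scale (u (t i)) (t i)) = 0" by (simp add: sum.reindex[OF inj])
    then show False using ind[of "\<lambda>i. u (t i)"] u by auto
  qed
qed

lemma independent_sum_zeroD:
  assumes "independent S" "finite S" "(\<Sum>s\<in>S. scale (g s) s) = 0" "s \<in> S"
  shows "g s = 0"
  using assms dependent_finite by blast

end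

context k_algebra
begin

lemma scale_eq_mult: "scale c a = scale c 1 * a" "scale c a = a * scale c 1"
  by (metis scale_mult_left mult_1, metis scale_mult_right mult_1_right)

lemma sum_scale_mult: "(\<Sum>i\<in>I. scale (g i) (t i)) * a = (\<Sum>i\<in>I. scale (g i) (t i * a))"
  by (simp add: sum_distrib_right scale_mult_left)

text \<open>The unital homomorphism from k[T] that sends T to \<open>w\<close>, in Horner form so
  that \<open>pCons\<close> is the recursion step.\<close>

definition ev :: "'a \<Rightarrow> 'k poly \<Rightarrow> 'a" where
  "ev w f = fold_coeffs (\<lambda>a v. scale a 1 + w * v) f 0"

lemma ev_0 [simp]: "ev w 0 = 0" by (simp add: ev_def)

lemma ev_pCons [simp]: "ev w (pCons a f) = scale a 1 + w * ev w f"
  by (cases "f = 0 \<and> a = 0") (auto simp: ev_def)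

lemma ev_1 [simp]: "ev w 1 = 1"
  by (simp add: one_pCons)

lemma ev_add: "ev w (f + g) = ev w f + ev w g"
  by (induction f g rule: poly_induct2) (auto simp: scale_left_distrib algebra_simps)

lemma ev_smult: "ev w (smult a f) = scale a (ev w f)"
  by (induction f) (auto simp: scale_right_distrib scale_mult_right)

lemma ev_uminus: "ev w (- f) = - ev w f"
  by (induction f) auto

lemma ev_commute:
  assumes "w * c = c * w" shows "ev w f * c = c * ev w f"
proof (induction f)
  case (pCons a f)
  have "w * (ev w f * c) = c * (w * ev w f)" by (metis pCons.IH assms mult.assoc)
  then show ?case
    by (simp add: distrib_left distrib_right mult.assoc scale_eq_mult(1)[of a c, symmetric]
        scale_eq_mult(2)[of a c, symmetric])
qed simp

lemma ev_mult: "ev w (f * g) = ev w f * ev w g"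
proof (induction f)
  case (pCons a f)
  then show ?case
    by (simp add: mult_pCons_left ev_add ev_smult distrib_right mult.assoc scale_eq_mult(1)[of a "ev w g"])
qed simp

lemma ev_mult_commute: "ev w f * ev w g = ev w g * ev w f"
  by (metis ev_mult mult.commute)

lemma ev_sum: "ev w (sum f I) = (\<Sum>i\<in>I. ev w (f i))"
  by (induction I rule: infinite_finite_induct) (auto simp: ev_add)

lemma ev_monom: "ev w (monom a n) = scale a (w ^ n)"
  by (induction n) (auto simp: monom_Suc monom_0 scale_mult_right)

lemma ev_altdef:
  assumes "degree f \<le> n" shows "ev w f = (\<Sum>i\<le>n. scale (coeff f i) (w ^ i))"
  by (subst poly_as_sum_of_monoms'[OF assms, symmetric]) (simp add: ev_sum ev_monom del: poly_as_sum_of_monoms')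

lemma ev_mem: "subalgebra T \<Longrightarrow> w \<in> T \<Longrightarrow> ev w f \<in> T"
  by (induction f) (auto simp: subalgebra_def subspace_0 subspace_add subspace_scale)

text \<open>A root \<open>r\<close> of \<open>f\<close> splits off the factor \<open>w - r\<close>
  from \<open>f(w)\<close>; without zero divisors one of the two factors vanishes, and in the second
  case the degree has dropped.\<close>

lemma ev_eq_0_imp_scalar:
  assumes roots: "\<And>p::'k poly. degree p > 0 \<Longrightarrow> \<exists>x. poly p x = 0"
    and nzd: "\<And>a b::'a. a * b = 0 \<Longrightarrow> a = 0 \<or> b = 0"
    and "ev w f = 0" "f \<noteq> 0"
  shows "\<exists>c. w = scale c 1"
  using assms(3,4)
proof (induction "degree f" arbitrary: f rule: less_induct)
  case less
  show ?case
  proof (cases "degree f = 0")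
    case True
    then obtain a where "f = [:a:]" by (rule degree_eq_zeroE)
    then show ?thesis using less.prems by simp
  next
    case False
    then obtain r where "poly f r = 0" using roots[of f] by auto
    then have "[:- r, 1:] dvd f" by (simp add: poly_eq_0_iff_dvd)
    then obtain g where g: "f = [:- r, 1:] * g" by (rule dvdE)
    have gn: "g \<noteq> 0" using g less.prems by auto
    have "(scale (- r) 1 + w) * ev w g = ev w f" unfolding g ev_mult by simp
    also have "\<dots> = 0" by fact
    finally have "scale (- r) 1 + w = 0 \<or> ev w g = 0" by (rule nzd)
    then show ?thesis
    proof
      assume "scale (- r) 1 + w = 0"
      then show ?thesis by (intro exI[of _ r]) (simp add: add_eq_0_iff)
    next
      assume 2: "ev w g = 0"
      have "degree g < degree f" unfolding g using gn by (subst degree_mult_eq) auto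
      then show ?thesis using less.hyps 2 gn by blast
    qed
  qed
qed

text \<open>Splitting off the last letter turns a relation between words of length
  \<open>m + 1\<close> in \<open>c1\<close> and \<open>c2\<close> into two relations between words
  of length \<open>m\<close>, by directness of \<open>B c1 + B c2\<close>.\<close>

lemma independent_words:
  assumes B: "subalgebra B" and c: "c1 \<in> B" "c2 \<in> B"
    and cV: "c1 \<in> subspace_power V p" "c2 \<in> subspace_power V p"
    and disj: "\<And>a b. a \<in> B \<Longrightarrow> b \<in> B \<Longrightarrow> a * c1 + b * c2 = 0 \<Longrightarrow> a = 0 \<and> b = 0"
  shows "\<exists>S. finite S \<and> independent S \<and> S \<subseteq> B \<inter> subspace_power V (p * m) \<and> card S = 2 ^ m"
proof (induction m)
  case 0
  show ?case using B by (intro exI[of _ "{1}"]) (auto simp: subalgebra_def span_base)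
next
  case (Suc m)
  then obtain S where S: "finite S" "independent S" "S \<subseteq> B \<inter> subspace_power V (p * m)" "card S = 2 ^ m"
    by blast
  have sB: "subspace B" and mB: "\<And>a b. a \<in> B \<Longrightarrow> b \<in> B \<Longrightarrow> a * b \<in> B"
    using B by (auto simp: subalgebra_def)
  define t where "t = (\<lambda>(s, d). s * (if d then c1 else c2))"
  let ?I = "S \<times> (UNIV :: bool set)"
  have ind: "\<forall>i\<in>?I. g i = 0" if "(\<Sum>i\<in>?I. scale (g i) (t i)) = 0" for g
  proof -
    have "(\<Sum>i\<in>?I. scale (g i) (t i)) = (\<Sum>s\<in>S. \<Sum>d\<in>UNIV. scale (g (s, d)) (t (s, d)))"
      by (simp add: sum.cartesian_product)
    also have "\<dots> = (\<Sum>s\<in>S. scale (g (s, True)) s) * c1 + (\<Sum>s\<in>S. scale (g (s, False)) s) * c2"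
      by (simp add: t_def UNIV_bool sum.distrib sum_scale_mult add.commute)
    finally have "(\<Sum>i\<in>?I. scale (g i) (t i)) =
        (\<Sum>s\<in>S. scale (g (s, True)) s) * c1 + (\<Sum>s\<in>S. scale (g (s, False)) s) * c2" .
    then have "(\<Sum>s\<in>S. scale (g (s, True)) s) * c1 + (\<Sum>s\<in>S. scale (g (s, False)) s) * c2 = 0"
      using that by simp
    moreover have "(\<Sum>s\<in>S. scale (g (s, d)) s) \<in> B" for d
      using S sB by (intro subspace_sum subspace_scale) auto
    ultimately have "(\<Sum>s\<in>S. scale (g (s, True)) s) = 0 \<and> (\<Sum>s\<in>S. scale (g (s, False)) s) = 0"
      by (intro disj)
    then have "(\<Sum>s\<in>S. scale (g (s, d)) s) = 0" for d
      by (cases d) auto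
    then have "g (s, d) = 0" if "s \<in> S" for s d
      using independent_sum_zeroD[OF S(2,1) _ that, of "\<lambda>s. g (s, d)"] by blast
    then show ?thesis by auto
  qed
  have "t ` ?I \<subseteq> B \<inter> subspace_power V (p * Suc m)"
    using S(3) c cV mB subspace_power_mult[of _ V "p * m" _ p] by (auto simp: t_def add.commute)
  moreover have "inj_on t ?I" "independent (t ` ?I)"
    using independent_family[OF _ ind] S(1) by auto
  moreover from this have "card (t ` ?I) = 2 ^ Suc m"
    using S by (simp add: card_image card_cartesian_product)
  ultimately show ?case using S(1) by (intro exI[of _ "t ` ?I"]) auto
qed

lemma card_le_dim:
  assumes "finite_dim W" "independent S" "S \<subseteq> W" shows "card S \<le> dim W"
proof -
  obtain B where "finite B" "span B = W" using assms(1) by (auto simp: finite_dim_def)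
  then have "finite S" using independent_span_bound[of B S] assms by blast
  then show ?thesis
    using dim_mono_finite_dim[OF assms(3,1)] dim_eq_card_independent[OF assms(2)] by simp
qed

text \<open>A failure of the Ore condition makes the sum of \<open>B a\<close> and
  \<open>B b\<close> direct and so produces \<open>2 ^ m\<close> independent words in a power of
  \<open>V\<close> whose exponent is linear in \<open>m\<close>, against the assumed growth.\<close>

lemma ore_condition:
  assumes nzd: "\<And>a b::'a. a * b = 0 \<Longrightarrow> a = 0 \<or> b = 0"
    and V: "generating_subspace V"
    and growth: "\<And>p. \<exists>m. dim (subspace_power V (p * m)) < 2 ^ m"
    and B: "subalgebra B" "a \<in> B" "b \<in> B" "b \<noteq> 0"
  shows "\<exists>r\<in>B. \<exists>s\<in>B. r \<noteq> 0 \<and> r * a = s * b"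
proof (rule ccontr)
  assume con: "\<not> ?thesis"
  have sB: "subspace B" "1 \<in> B" using B by (auto simp: subalgebra_def)
  have fd: "finite_dim V" "1 \<in> V" using V by (auto simp: generating_subspace_def)
  have "u = 0 \<and> v = 0" if uv: "u \<in> B" "v \<in> B" "u * a + v * b = 0" for u v
  proof -
    have "u * a = (- v) * b" using uv(3) by (simp add: add_eq_0_iff2)
    moreover have "- v \<in> B" using subspace_neg[OF sB(1) uv(2)] .
    ultimately have "u = 0" using con uv(1) by metis
    then have "v * b = 0" using uv(3) by simp
    then show ?thesis using nzd[of v b] B(4) \<open>u = 0\<close> by simp
  qed
  moreover obtain i j where "a \<in> subspace_power V i" "b \<in> subspace_power V j"
    using subspace_power_exhausts[OF V] by blast
  then have "a \<in> subspace_power V (max i j)" "b \<in> subspace_power V (max i j)"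
    using subspace_power_mono[OF fd(2)] by (meson max.cobounded1 max.cobounded2 subsetD)+
  ultimately have words: "\<exists>S. finite S \<and> independent S \<and> S \<subseteq> B \<inter> subspace_power V (max i j * m) \<and> card S = 2 ^ m" for m
    by (intro independent_words[OF B(1-3)])
  obtain m where m: "dim (subspace_power V (max i j * m)) < 2 ^ m" using growth by blast
  obtain S where "independent S" "S \<subseteq> subspace_power V (max i j * m)" "card S = 2 ^ m"
    using words[of m] by blast
  then show False
    using card_le_dim[OF finite_dim_subspace_power[OF fd(1)], of S "max i j * m"] m by (metis leD)
qed

end

subsection \<open>Division algebras\<close>

locale division_algebra = k_algebra scale
  for scale :: "'k::alg_closed_field \<Rightarrow> 'a::ring_1 \<Rightarrow> 'a" +
  assumes invertible: "(q::'a) \<noteq> 0 \<Longrightarrow> \<exists>p. q * p = 1 \<and> p * q = 1"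
begin

text \<open>The value 0 at 0 lets closure under inverses be stated for all elements of a
  subalgebra.\<close>

definition iv :: "'a \<Rightarrow> 'a" where
  "iv q = (if q = 0 then 0 else SOME p. q * p = 1 \<and> p * q = 1)"

lemma
  fixes q :: 'a
  assumes "q \<noteq> 0" shows iv_right: "q * iv q = 1" and iv_left: "iv q * q = 1"
  using someI_ex[OF invertible[OF assms]] assms by (simp_all add: iv_def)

lemma iv_0 [simp]: "iv 0 = 0" by (simp add: iv_def)

lemma iv_cancel:
  fixes q a :: 'a
  shows "q \<noteq> 0 \<Longrightarrow> iv q * (q * a) = a" "q \<noteq> 0 \<Longrightarrow> q * (iv q * a) = a"
  by (simp_all add: mult.assoc[symmetric] iv_left iv_right)

lemma iv_cancel_right:
  fixes q a :: 'a
  shows "q \<noteq> 0 \<Longrightarrow> (a * q) * iv q = a" "q \<noteq> 0 \<Longrightarrow> (a * iv q) * q = a"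
  by (simp_all add: mult.assoc iv_left iv_right)

lemma nzd:
  fixes a b :: 'a
  assumes "a * b = 0" shows "a = 0 \<or> b = 0"
  using iv_cancel(1)[of a b] assms by auto

lemma power_iv:
  fixes q :: 'a
  assumes "q \<noteq> 0" shows "q ^ n * iv q ^ n = 1" "q ^ n \<noteq> 0" "iv q ^ n * q ^ n = 1"
proof -
  have "q ^ n * iv q ^ n = 1 \<and> iv q ^ n * q ^ n = 1"
  proof (induction n)
    case (Suc n)
    have "q ^ Suc n * iv q ^ Suc n = q * (q ^ n * iv q ^ n) * iv q"
      by (simp add: mult.assoc power_commutes)
    moreover have "iv q ^ Suc n * q ^ Suc n = iv q * (iv q ^ n * q ^ n) * q"
      by (simp add: mult.assoc power_commutes)
    ultimately show ?case using Suc assms by (simp add: iv_right iv_left)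
  qed simp
  then show "q ^ n * iv q ^ n = 1" "iv q ^ n * q ^ n = 1" by blast+
  then show "q ^ n \<noteq> 0" by auto
qed

text \<open>The name is justified by \<open>ev_nonzero\<close>: over an algebraically closed field,
  in a division ring, only scalars are algebraic.\<close>

definition transcendental :: "'a \<Rightarrow> bool" where
  "transcendental w \<longleftrightarrow> (\<forall>c. w \<noteq> scale c 1)"

lemma ev_nonzero:
  assumes "transcendental w" "f \<noteq> 0" shows "ev w f \<noteq> 0"
  using ev_eq_0_imp_scalar[of w f] alg_closed_imp_poly_has_root nzd assms
  unfolding transcendental_def by blast

section \<open>Spans over k[w] and k(w)\<close>

definition poly_span :: "'a \<Rightarrow> 'a set \<Rightarrow> 'a set" where
  "poly_span w S = {\<Sum>s\<in>S. ev w (f s) * s | f. True}"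

text \<open>The left $k(w)$-span of \<open>S\<close>, without mentioning the field $k(w)$.\<close>

definition frac_span :: "'a \<Rightarrow> 'a set \<Rightarrow> 'a set" where
  "frac_span w S = {q. \<exists>f. f \<noteq> 0 \<and> ev w f * q \<in> poly_span w S}"

lemma poly_spanI: "(\<Sum>s\<in>S. ev w (f s) * s) \<in> poly_span w S"
  unfolding poly_span_def by blast

lemma poly_spanE:
  assumes "q \<in> poly_span w S" obtains f where "q = (\<Sum>s\<in>S. ev w (f s) * s)"
  using assms unfolding poly_span_def by blast

lemma poly_span_add: "a \<in> poly_span w S \<Longrightarrow> b \<in> poly_span w S \<Longrightarrow> a + b \<in> poly_span w S"
proof -
  assume "a \<in> poly_span w S" "b \<in> poly_span w S"
  then obtain f g where "a = (\<Sum>s\<in>S. ev w (f s) * s)" "b = (\<Sum>s\<in>S. ev w (g s) * s)"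
    by (metis poly_spanE)
  then have "a + b = (\<Sum>s\<in>S. ev w (f s + g s) * s)"
    by (simp add: ev_add distrib_right sum.distrib)
  then show ?thesis using poly_spanI by metis
qed

lemma poly_span_ev: "a \<in> poly_span w S \<Longrightarrow> ev w g * a \<in> poly_span w S"
proof -
  assume "a \<in> poly_span w S"
  then obtain f where "a = (\<Sum>s\<in>S. ev w (f s) * s)"
    by (metis poly_spanE)
  then have "ev w g * a = (\<Sum>s\<in>S. ev w (g * f s) * s)"
    by (simp add: ev_mult sum_distrib_left mult.assoc)
  then show ?thesis using poly_spanI by metis
qed

lemma poly_span_base:
  assumes "finite S" "s \<in> S" shows "s \<in> poly_span w S"
proof -
  have "(\<Sum>t\<in>S. ev w (if t = s then 1 else 0) * t) = (\<Sum>t\<in>S. if t = s then t else 0)"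
    by (intro sum.cong) auto
  also have "\<dots> = s" using assms by simp
  finally show ?thesis using poly_spanI by metis
qed

lemma frac_spanI: "f \<noteq> 0 \<Longrightarrow> ev w f * q \<in> poly_span w S \<Longrightarrow> q \<in> frac_span w S"
  unfolding frac_span_def by blast

lemma frac_spanE:
  assumes "q \<in> frac_span w S" obtains f where "f \<noteq> 0" "ev w f * q \<in> poly_span w S"
  using assms unfolding frac_span_def by blast

lemma frac_span_polyE:
  assumes "q \<in> frac_span w S"
  obtains f g where "f \<noteq> 0" "ev w f * q = (\<Sum>s\<in>S. ev w (g s) * s)"
  using assms by (elim frac_spanE poly_spanE)

lemma poly_span_subset_frac_span: "poly_span w S \<subseteq> frac_span w S"
  by (auto intro: frac_spanI[of 1])

lemma frac_span_base: "finite S \<Longrightarrow> s \<in> S \<Longrightarrow> s \<in> frac_span w S"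
  using poly_span_base poly_span_subset_frac_span by blast

lemma frac_span_add:
  assumes "a \<in> frac_span w S" "b \<in> frac_span w S" shows "a + b \<in> frac_span w S"
proof -
  obtain f g where f: "f \<noteq> 0" "ev w f * a \<in> poly_span w S" and g: "g \<noteq> 0" "ev w g * b \<in> poly_span w S"
    using assms by (meson frac_spanE)
  have "ev w (f * g) * (a + b) = ev w g * (ev w f * a) + ev w f * (ev w g * b)"
    unfolding distrib_left ev_mult by (metis ev_mult_commute mult.assoc)
  then have "ev w (f * g) * (a + b) \<in> poly_span w S"
    using f g by (simp add: poly_span_add poly_span_ev)
  then show ?thesis using f g by (intro frac_spanI[of "f * g"]) auto
qed

lemma frac_span_div:
  assumes "f \<noteq> 0" "ev w f * q \<in> frac_span w S" shows "q \<in> frac_span w S"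
proof -
  obtain g where "g \<noteq> 0" "ev w g * (ev w f * q) \<in> poly_span w S" using assms(2) frac_spanE by blast
  then show ?thesis using assms(1) by (intro frac_spanI[of "g * f"]) (auto simp: ev_mult mult.assoc)
qed

lemma frac_span_ev:
  assumes "q \<in> frac_span w S" shows "ev w g * q \<in> frac_span w S"
proof -
  obtain f where f: "f \<noteq> 0" "ev w f * q \<in> poly_span w S" using assms frac_spanE by blast
  have "ev w f * (ev w g * q) = ev w g * (ev w f * q)"
    by (metis ev_mult_commute mult.assoc)
  then show ?thesis using f poly_span_ev frac_spanI by metis
qed

lemma frac_span_0: "0 \<in> frac_span w S"
  using poly_span_subset_frac_span poly_spanI[of w "\<lambda>_. 0" S] by auto

lemma frac_span_sum: "(\<And>i. i \<in> I \<Longrightarrow> f i \<in> frac_span w S) \<Longrightarrow> sum f I \<in> frac_span w S"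
  by (induction I rule: infinite_finite_induct) (auto simp: frac_span_0 frac_span_add)

lemma frac_span_scale: "q \<in> frac_span w S \<Longrightarrow> scale c q \<in> frac_span w S"
  using frac_span_ev[of q w S "[:c:]"] by (simp add: scale_eq_mult(1)[of c q])

lemma frac_span_poly_sum:
  "(\<And>s. s \<in> S \<Longrightarrow> u s \<in> frac_span w T) \<Longrightarrow> (\<Sum>s\<in>S. ev w (f s) * u s) \<in> frac_span w T"
  by (intro frac_span_sum frac_span_ev)

lemma frac_span_right_mult:
  assumes "q \<in> frac_span w S" "\<And>s. s \<in> S \<Longrightarrow> s * c \<in> frac_span w T"
  shows "q * c \<in> frac_span w T"
proof -
  obtain f g where f: "f \<noteq> 0" "ev w f * q = (\<Sum>s\<in>S. ev w (g s) * s)"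
    using assms(1) by (rule frac_span_polyE)
  have "ev w f * (q * c) = (\<Sum>s\<in>S. ev w (g s) * (s * c))"
    using f(2) by (metis (no_types, lifting) mult.assoc sum.cong sum_distrib_right)
  also have "\<dots> \<in> frac_span w T" using assms(2) by (rule frac_span_poly_sum)
  finally show ?thesis using frac_span_div f(1) by blast
qed

text \<open>After clearing denominators there are \<open>card S + 1\<close> vectors with
  \<open>card S\<close> coordinates in k[T], hence a relation; multiplying its coefficients by the
  denominators \<open>f j\<close> gives one between the \<open>u j\<close> themselves.\<close>

lemma frac_span_dependent:
  assumes "finite S" "\<And>j. j \<le> card S \<Longrightarrow> u j \<in> frac_span w S"
  shows "\<exists>h. (\<exists>j\<le>card S. h j \<noteq> 0) \<and> (\<Sum>j\<le>card S. ev w (h j) * u j) = 0"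
proof -
  have "\<forall>j. \<exists>f g. j \<le> card S \<longrightarrow> f \<noteq> 0 \<and> ev w f * u j = (\<Sum>s\<in>S. ev w (g s) * s)"
    using assms(2) frac_span_polyE by metis
  then obtain f g where fg: "\<And>j. j \<le> card S \<Longrightarrow> f j \<noteq> 0"
    "\<And>j. j \<le> card S \<Longrightarrow> ev w (f j) * u j = (\<Sum>s\<in>S. ev w (g j s) * s)" by metis
  obtain h where h: "\<exists>j\<le>card S. h j \<noteq> 0" "\<forall>s\<in>S. (\<Sum>j\<le>card S. h j * g j s) = 0"
    using linear_system_nontrivial_solution[OF assms(1), of "{..card S}" "\<lambda>s j. g j s"] by auto
  have "(\<Sum>j\<le>card S. ev w (h j * f j) * u j) = (\<Sum>j\<le>card S. \<Sum>s\<in>S. ev w (h j * g j s) * s)"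
    by (intro sum.cong) (auto simp: ev_mult mult.assoc fg(2) sum_distrib_left)
  also have "\<dots> = (\<Sum>s\<in>S. ev w (\<Sum>j\<le>card S. h j * g j s) * s)"
    by (subst sum.swap) (simp add: ev_sum sum_distrib_right)
  also have "\<dots> = 0" using h(2) by simp
  finally show ?thesis using h(1) fg(1) by (intro exI[of _ "\<lambda>j. h j * f j"]) auto
qed

text \<open>Isolating the largest index with nonzero coefficient gives the form in which a relation
  contradicts a choice of each \<open>s m\<close> outside the span of its predecessors.\<close>

lemma dependent_top:
  assumes "\<exists>i\<le>n::nat. f i \<noteq> 0" "(\<Sum>i\<le>n. ev w (f i) * s i) = 0"
  shows "\<exists>m\<le>n. \<exists>g. f m \<noteq> 0 \<and> ev w (f m) * s m = (\<Sum>i<m. ev w (g i) * s i)"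
proof -
  define M where "M = {i. i \<le> n \<and> f i \<noteq> 0}"
  define m where "m = Max M"
  have M: "finite M" "M \<noteq> {}" using assms(1) by (auto simp: M_def)
  have m: "m \<le> n" "f m \<noteq> 0" using Max_in[OF M] by (auto simp: m_def M_def)
  have z: "f i = 0" if "i \<le> n" "i > m" for i
  proof (rule ccontr)
    assume "f i \<noteq> 0"
    then have "i \<in> M" using that by (simp add: M_def)
    then show False using Max_ge[OF M(1)] that by (simp add: m_def leD)
  qed
  have "(\<Sum>i\<le>n. ev w (f i) * s i) = (\<Sum>i\<le>m. ev w (f i) * s i)"
    using m z by (intro sum.mono_neutral_right) auto
  also have "\<dots> = (\<Sum>i<m. ev w (f i) * s i) + ev w (f m) * s m"
    by (simp add: lessThan_Suc_atMost[symmetric])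
  finally have "ev w (f m) * s m = (\<Sum>i<m. ev w (- f i) * s i)"
    using assms(2) by (simp add: ev_uminus sum_negf eq_neg_iff_add_eq_0 add.commute)
  then show ?thesis using m by (intro exI[of _ m] conjI exI[of _ "\<lambda>i. - f i"]) auto
qed

section \<open>Division subalgebras and their hulls\<close>

definition division_subalgebra :: "'a set \<Rightarrow> bool" where
  "division_subalgebra T \<longleftrightarrow> subalgebra T \<and> (\<forall>a\<in>T. iv a \<in> T)"

abbreviation division_hull :: "'a set \<Rightarrow> 'a set" where
  "division_hull S \<equiv> division_subalgebra hull S"

lemma division_subalgebra_hull: "division_subalgebra (division_hull S)"
proof (rule hull_in)
  fix T assume T: "Ball T division_subalgebra"
  have "subspace (\<Inter>T)"
    using T by (intro subspace_Inter) (auto simp: division_subalgebra_def subalgebra_def)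
  then show "division_subalgebra (\<Inter>T)"
    using T by (auto simp: division_subalgebra_def subalgebra_def)
qed

lemma division_subalgebraD:
  assumes "division_subalgebra T"
  shows "subspace T" "1 \<in> T" "0 \<in> T" "subalgebra T" "a \<in> T \<Longrightarrow> b \<in> T \<Longrightarrow> a * b \<in> T" "a \<in> T \<Longrightarrow> b \<in> T \<Longrightarrow> a + b \<in> T"
    "a \<in> T \<Longrightarrow> b \<in> T \<Longrightarrow> a - b \<in> T" "a \<in> T \<Longrightarrow> iv a \<in> T" "a \<in> T \<Longrightarrow> - a \<in> T" "a \<in> T \<Longrightarrow> ev a f \<in> T"
    "a \<in> T \<Longrightarrow> scale c a \<in> T" "a \<in> T \<Longrightarrow> a ^ n \<in> T"
proof -
  show *: "subspace T" "1 \<in> T" "subalgebra T" "a \<in> T \<Longrightarrow> b \<in> T \<Longrightarrow> a * b \<in> T" "a \<in> T \<Longrightarrow> iv a \<in> T"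
    for a b
    using assms by (auto simp: division_subalgebra_def subalgebra_def)
  show "a \<in> T \<Longrightarrow> ev a f \<in> T" using ev_mem *(3) by blast
  show "a \<in> T \<Longrightarrow> a ^ n \<in> T" by (induction n) (auto simp: *)
qed (use assms in \<open>auto simp: division_subalgebra_def subalgebra_def subspace_0 subspace_add subspace_diff subspace_neg subspace_scale\<close>)

lemmas division_hullD = division_subalgebraD[OF division_subalgebra_hull]

end

subsection \<open>Filtrations of subquadratic growth\<close>

text \<open>In the application \<open>F n\<close> is the image of the part of the kernel that lies
  in \<open>V^n\<close>. \<open>F_growth\<close> asks for one good \<open>n\<close> per dilation
  \<open>C\<close>, to be compared with a family of \<open>(n + 1)^2\<close> products.\<close>

locale subquadratic_filtration = division_algebra scale
  for scale :: "'k::alg_closed_field \<Rightarrow> 'a::ring_1 \<Rightarrow> 'a" +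
  fixes F :: "nat \<Rightarrow> 'a set"
  assumes F_subspace: "subspace (F n)"
    and F_one: "1 \<in> F 0"
    and F_mono: "m \<le> n \<Longrightarrow> F m \<subseteq> F n"
    and F_mult: "a \<in> F m \<Longrightarrow> b \<in> F n \<Longrightarrow> a * b \<in> F (m + n)"
    and F_finite_dim: "finite_dim (F n)"
    and F_growth: "\<exists>n. \<forall>S. finite S \<longrightarrow> independent S \<longrightarrow> S \<subseteq> F (C * n) \<longrightarrow> card S < (n + 1)\<^sup>2"
begin

lemma F_power: "a \<in> F p \<Longrightarrow> a ^ n \<in> F (p * n)"
  by (induction n) (auto simp: F_one intro: F_mult)

text \<open>Since \<beta> and \<open>w\<close> commute, \<open>\<beta> ^ n\<close> clears the
  denominators of all powers of \<open>w\<close> up to \<open>n\<close> at once, leaving a product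
  of \<open>n\<close> factors \<beta> or \<open>c\<close>.\<close>

lemma fraction_power:
  fixes \<beta> w c :: 'a
  assumes "\<beta> * w = c" "w * \<beta> = c" "j \<le> n"
  shows "\<beta> ^ n * w ^ j = \<beta> ^ (n - j) * c ^ j"
proof -
  have "c * w = w * c" by (metis assms(1,2) mult.assoc)
  have "\<beta> ^ j * w ^ j = c ^ j"
  proof (induction j)
    case (Suc j)
    have "\<beta> ^ Suc j * w ^ Suc j = \<beta> ^ j * (\<beta> * w) * w ^ j"
      by (simp only: power_Suc2[of \<beta>] power_Suc[of w] mult.assoc)
    also have "\<dots> = \<beta> ^ j * w ^ j * c"
      using power_commuting_commutes[OF \<open>c * w = w * c\<close>[symmetric], of j] assms(1)
      by (simp add: mult.assoc)
    finally show ?case using Suc by (simp add: power_commutes)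
  qed simp
  then show ?thesis using assms(3)
    by (metis le_add_diff_inverse2 mult.assoc power_add)
qed

text \<open>Linear growth of the filtration along $w = \beta^{-1} c$ leaves room for only a sublinear
  number of $k(w)$-independent elements in \<open>F n\<close>.\<close>

lemma no_linear_independent_sequence:
  fixes \<beta> w c :: 'a and s :: "nat \<Rightarrow> 'a"
  assumes w: "\<beta> \<noteq> 0" "\<beta> * w = c" "w * \<beta> = c" "\<beta> \<in> F p" "c \<in> F p"
    and s: "\<And>i. s i \<in> F (h * (i + 1))"
  shows "\<exists>m f g. f \<noteq> 0 \<and> ev w f * s m = (\<Sum>i<m. ev w (g i) * s i)"
proof -
  \<comment> \<open>The summand \<open>p\<close> pays for \<open>n\<close> factors \<beta> or
    \<open>c\<close>, and \<open>2 * h\<close> for \<open>s i\<close>, because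
    \<open>i + 1 \<le> 2 * n\<close> once \<open>n\<close> is positive.\<close>
  obtain n where n: "\<And>S. finite S \<Longrightarrow> independent S \<Longrightarrow> S \<subseteq> F ((p + 2 * h) * n) \<Longrightarrow> card S < (n + 1)\<^sup>2"
    using F_growth by blast
  have "n > 0"
  proof (rule ccontr)
    assume "\<not> n > 0"
    then show False using n[of "{1}"] F_one by simp
  qed
  let ?I = "{..n} \<times> {..n}"
  \<comment> \<open>This is \<open>\<beta> ^ n * w ^ j * s i\<close> written inside the filtration.
    The index set has \<open>(n + 1)^2\<close> elements, too many for an independent family.\<close>
  define t where "t = (\<lambda>(i, j). \<beta> ^ (n - j) * c ^ j * s i)"
  have tF: "t ` ?I \<subseteq> F ((p + 2 * h) * n)"
  proof (clarsimp simp: t_def)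
    fix i j assume ij: "i \<le> n" "j \<le> n"
    have "\<beta> ^ (n - j) * c ^ j * s i \<in> F (p * (n - j) + p * j + h * (i + 1))"
      by (intro F_mult F_power w s)
    moreover have "p * (n - j) + p * j + h * (i + 1) \<le> (p + 2 * h) * n"
    proof -
      have "p * (n - j) + p * j = p * n" using ij by (simp add: distrib_left[symmetric])
      moreover have "h * (i + 1) \<le> h * (2 * n)" using ij \<open>n > 0\<close> by (intro mult_left_mono) auto
      ultimately show ?thesis by (simp add: algebra_simps)
    qed
    ultimately show "\<beta> ^ (n - j) * c ^ j * s i \<in> F ((p + 2 * h) * n)" using F_mono by blast
  qed
  have "\<not> (\<forall>g. (\<Sum>i\<in>?I. scale (g i) (t i)) = 0 \<longrightarrow> (\<forall>i\<in>?I. g i = 0))"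
  proof
    assume *: "\<forall>g. (\<Sum>i\<in>?I. scale (g i) (t i)) = 0 \<longrightarrow> (\<forall>i\<in>?I. g i = 0)"
    have "inj_on t ?I" "independent (t ` ?I)"
      by (rule independent_family, simp, use * in blast)+
    then show False
      using n[of "t ` ?I"] tF by (simp add: card_image card_cartesian_product power2_eq_square)
  qed
  then obtain g i0 j0 where g: "(\<Sum>i\<in>?I. scale (g i) (t i)) = 0" "g (i0, j0) \<noteq> 0" "i0 \<le> n" "j0 \<le> n"
    by auto
  define f where "f i = (\<Sum>j\<le>n. monom (g (i, j)) j)" for i
  have "\<beta> ^ n * (\<Sum>i\<le>n. ev w (f i) * s i) = (\<Sum>i\<le>n. \<Sum>j\<le>n. scale (g (i, j)) (\<beta> ^ n * w ^ j * s i))"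
    by (simp add: f_def ev_sum ev_monom sum_distrib_left sum_distrib_right scale_mult_left[symmetric]
        scale_mult_right[symmetric] mult.assoc)
  also have "\<dots> = (\<Sum>i\<le>n. \<Sum>j\<le>n. scale (g (i, j)) (t (i, j)))"
    by (intro sum.cong) (auto simp: t_def fraction_power[OF w(2,3)])
  also have "\<dots> = 0" using g(1) by (simp add: sum.cartesian_product)
  finally have "(\<Sum>i\<le>n. ev w (f i) * s i) = 0"
    using nzd power_iv(2)[OF w(1)] by blast
  moreover have "f i0 \<noteq> 0"
  proof
    assume "f i0 = 0"
    moreover have "coeff (f i0) j0 = g (i0, j0)" using g(4) by (simp add: f_def coeff_sum)
    ultimately show False using g(2) by simp
  qed
  ultimately show ?thesis using dependent_top[of n f w s] g(3) by blast
qed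

text \<open>If the words of length at most i + 1 in a basis of \<open>F n\<close> never fell into
  the k(w)-span of those of length at most i, they would yield an independent sequence of linear
  growth. Once they do, this span is stable under right multiplication by \<open>F n\<close> and,
  having finite rank, by inverses too.\<close>

lemma finite_rank:
  fixes \<beta> w c :: 'a
  assumes w: "\<beta> \<noteq> 0" "\<beta> * w = c" "w * \<beta> = c" "\<beta> \<in> F p" "c \<in> F p"
  shows "\<exists>S r. finite S \<and> 1 \<in> S \<and> S \<subseteq> F r \<and> S \<subseteq> division_hull (F n) \<and>
    division_hull (F n) \<subseteq> frac_span w S"
proof -
  obtain G where G: "finite G" "span G = F n" using F_finite_dim by (auto simp: finite_dim_def)
  define W where "W = rec_nat {1::'a} (\<lambda>_ X. X \<union> (\<lambda>(s, g). s * g) ` (X \<times> G))"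
  have W0: "W 0 = {1}" and WS: "W (Suc i) = W i \<union> (\<lambda>(s, g). s * g) ` (W i \<times> G)" for i
    by (simp_all add: W_def)
  have finW: "finite (W i)" for i by (induction i) (auto simp: W0 WS G)
  have GF: "G \<subseteq> F n" using G span_superset by blast
  have WF: "W i \<subseteq> F (n * i)" for i
  proof (induction i)
    case (Suc i)
    have "s * g \<in> F (n * Suc i)" if "s \<in> W i" "g \<in> G" for s g
      using F_mult[of s "n * i" g n] that Suc GF by (auto simp: add.commute)
    moreover have "W i \<subseteq> F (n * Suc i)" using Suc F_mono[of "n * i" "n * Suc i"] by auto
    ultimately show ?case by (auto simp: WS)
  qed (simp add: W0 F_one)
  have Wmono: "W i \<subseteq> W j" if "i \<le> j" for i j
    using that by (induction rule: dec_induct) (auto simp: WS)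
  have one: "1 \<in> W i" for i using Wmono[of 0 i] by (auto simp: W0)
  have WH: "W i \<subseteq> division_hull (F n)" for i
  proof (induction i)
    case (Suc i)
    have "s * g \<in> division_hull (F n)" if "s \<in> W i" "g \<in> G" for s g
      using that Suc GF hull_subset[of "F n" division_subalgebra] by (intro division_hullD) blast+
    then show ?case using Suc by (auto simp: WS)
  qed (simp add: W0 division_hullD)
  have "\<exists>i. W (Suc i) \<subseteq> frac_span w (W i)"
  proof (rule ccontr)
    assume "\<nexists>i. W (Suc i) \<subseteq> frac_span w (W i)"
    then have "\<forall>i. \<exists>s. s \<in> W (Suc i) \<and> s \<notin> frac_span w (W i)" by blast
    then obtain s where s: "\<And>i. s i \<in> W (Suc i)" "\<And>i. s i \<notin> frac_span w (W i)" by metis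
    have "s i \<in> F (n * (i + 1))" for i using s(1)[of i] WF[of "Suc i"] by auto
    then obtain m f g where m: "f \<noteq> 0" "ev w f * s m = (\<Sum>i<m. ev w (g i) * s i)"
      using no_linear_independent_sequence[OF w, of s n] by blast
    have "s i \<in> frac_span w (W m)" if "i < m" for i
      using s(1)[of i] Wmono[of "Suc i" m] that frac_span_base[OF finW] by auto
    then have "ev w f * s m \<in> frac_span w (W m)"
      unfolding m(2) by (intro frac_span_poly_sum) auto
    then show False using frac_span_div m(1) s(2) by blast
  qed
  then obtain i where i: "W (Suc i) \<subseteq> frac_span w (W i)" by blast
  define S where "S = W i"
  \<comment> \<open>The right stabiliser of the span. As \<open>1 \<in> S\<close>, it is contained
    in the span, so it suffices that it is a division subalgebra containing
    \<open>F n\<close>.\<close>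
  define N where "N = {q. \<forall>s\<in>S. s * q \<in> frac_span w S}"
  have finS: "finite S" using finW S_def by simp
  have ES: "s \<in> S \<Longrightarrow> s \<in> frac_span w S" for s using frac_span_base[OF finS] .
  have Nmult: "a * q \<in> frac_span w S" if "a \<in> frac_span w S" "q \<in> N" for a q
    using frac_span_right_mult[OF that(1), of q] that(2) by (auto simp: N_def)
  have Niv: "iv q \<in> N" if q: "q \<in> N" for q
  proof (cases "q = 0")
    case False
    have "s * iv q \<in> frac_span w S" if s: "s \<in> S" for s
    proof -
      define d where "d = card S"
      \<comment> \<open>The exponents run downwards so that the term isolated by
        \<open>dependent_top\<close> carries the lowest power of \<open>q\<close>.\<close>
      define u where "u j = s * q ^ (d - j)" for j
      have pow: "s * q ^ j \<in> frac_span w S" for j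
      proof (induction j)
        case (Suc j)
        then show ?case using Nmult[of "s * q ^ j" q] q by (simp add: mult.assoc power_commutes)
      qed (simp add: ES s)
      obtain h where "\<exists>j\<le>d. h j \<noteq> 0" "(\<Sum>j\<le>d. ev w (h j) * u j) = 0"
        using frac_span_dependent[OF finS, of u w] pow by (auto simp: u_def d_def)
      then obtain m g where m: "m \<le> d" "h m \<noteq> 0" "ev w (h m) * u m = (\<Sum>j<m. ev w (g j) * u j)"
        using dependent_top by meson
      \<comment> \<open>One factor \<open>iv q\<close> more than cancels \<open>q ^ (d - m)\<close>:
        the isolated term becomes \<open>s * iv q\<close>, the others keep nonnegative powers of
        \<open>q\<close>.\<close>
      define r where "r = iv q ^ (d - m + 1)"
      have qr: "q ^ (d - j) * r = q ^ (m - j - 1)" if "j < m" for j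
      proof -
        have "d - j = (m - j - 1) + (d - m + 1)" using that m(1) by simp
        then have "q ^ (d - j) * r = q ^ (m - j - 1) * (q ^ (d - m + 1) * r)"
          by (simp only: power_add mult.assoc)
        then show ?thesis unfolding r_def power_iv(1)[OF False] by simp
      qed
      have "q ^ (d - m) * r = iv q"
        using power_iv(1)[OF False, of "d - m"] by (simp add: r_def power_Suc2 mult.assoc[symmetric] del: power_Suc)
      then have "ev w (h m) * (s * iv q) = ev w (h m) * u m * r" by (simp add: u_def mult.assoc)
      also have "\<dots> = (\<Sum>j<m. ev w (g j) * (s * q ^ (m - j - 1)))"
        unfolding m(3) sum_distrib_right by (intro sum.cong) (auto simp: u_def mult.assoc qr)
      also have "\<dots> \<in> frac_span w S" by (intro frac_span_poly_sum pow)
      finally show ?thesis using frac_span_div m(2) by blast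
    qed
    then show ?thesis by (simp add: N_def)
  qed (use q in simp)
  have "division_subalgebra N"
    unfolding division_subalgebra_def subalgebra_def
  proof (intro conjI ballI)
    show "subspace N"
      by (rule subspaceI) (auto simp: N_def frac_span_0 distrib_left frac_span_add scale_mult_right[symmetric] frac_span_scale)
    show "1 \<in> N" using ES by (simp add: N_def)
    fix a b assume ab: "a \<in> N" "b \<in> N"
    then show "a * b \<in> N" using Nmult[OF _ ab(2)] by (auto simp: N_def mult.assoc[symmetric])
    show "iv a \<in> N" using Niv ab by blast
  qed
  moreover have "F n \<subseteq> N"
  proof -
    have "G \<subseteq> N" using i by (auto simp: N_def S_def WS)
    then show ?thesis using G(2) calculation span_minimal division_subalgebraD(1) by blast
  qed
  ultimately have H: "division_hull (F n) \<subseteq> N" by (intro hull_minimal)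
  have "q \<in> frac_span w S" if "q \<in> N" for q
    using that one[of i] by (force simp: N_def S_def)
  then show ?thesis using H finS one WH WF by (intro exI[of _ S] exI[of _ "n * i"]) (auto simp: S_def)
qed

text \<open>Otherwise every step of length \<open>h\<close> from \<open>n0\<close> contributes an
  element outside the current division ring. These elements grow linearly, so one of them depends
  over k(y) on its predecessors; but these and \<open>y\<close> lie in the very ring that it was
  chosen to avoid.\<close>

lemma division_hull_stabilizes:
  assumes y: "transcendental y" "y \<in> F p" and n0: "p \<le> n0"
  shows "\<exists>n\<ge>n0. F (n + h) \<subseteq> division_hull (F n)"
proof (rule ccontr)
  assume con: "\<not> ?thesis"
  have "\<forall>i. \<exists>s. s \<in> F (n0 + h * i + h) \<and> s \<notin> division_hull (F (n0 + h * i))"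
  proof
    fix i
    have "n0 + h * i \<ge> n0" by simp
    then show "\<exists>s. s \<in> F (n0 + h * i + h) \<and> s \<notin> division_hull (F (n0 + h * i))"
      using con by blast
  qed
  then obtain s where s: "\<And>i. s i \<in> F (n0 + h * i + h)" "\<And>i. s i \<notin> division_hull (F (n0 + h * i))"
    by metis
  have "s i \<in> F ((n0 + h) * (i + 1))" for i
    using s(1)[of i] F_mono[of "n0 + h * i + h" "(n0 + h) * (i + 1)"] by (auto simp: algebra_simps)
  moreover have "1 \<in> F p" using F_one F_mono[of 0 p] by auto
  ultimately obtain m f g where m: "f \<noteq> 0" "ev y f * s m = (\<Sum>i<m. ev y (g i) * s i)"
    using no_linear_independent_sequence[of 1 y y p s "n0 + h"] y(2) by auto
  let ?H = "division_hull (F (n0 + h * m))"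
  have FH: "F j \<subseteq> ?H" if "j \<le> n0 + h * m" for j
    using F_mono[OF that] hull_subset[of _ division_subalgebra] by blast
  have yH: "y \<in> ?H" using FH[of p] n0 y(2) by auto
  have "s i \<in> ?H" if "i < m" for i
  proof -
    have "h * Suc i \<le> h * m" using that by (intro mult_left_mono) auto
    then show ?thesis using s(1)[of i] FH[of "n0 + h * i + h"] by auto
  qed
  then have "ev y f * s m \<in> ?H"
    unfolding m(2) using yH by (intro subspace_sum division_hullD) auto
  then have "iv (ev y f) * (ev y f * s m) \<in> ?H"
    by (rule division_hullD(5)[OF division_hullD(8)[OF division_hullD(10)[OF yH]]])
  then show False using s(2)[of m] ev_nonzero[OF y(1) m(1)] by (simp add: iv_cancel)
qed

text \<open>Over $k(y)$ the operators $u \mapsto u y^j$ on a space of finite rank are linearly dependent.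
  A shortest dependency has coefficients commuting with everything, by Artin's argument.\<close>

lemma center_nontrivial:
  assumes y: "transcendental y" "y \<in> F p" and n: "p \<le> n"
  shows "\<exists>w\<in>division_hull (F n). transcendental w \<and> (\<forall>q\<in>division_hull (F n). w * q = q * w)"
proof -
  let ?H = "division_hull (F n)"
  have "1 \<in> F p" using F_one F_mono[of 0 p] by auto
  then obtain S where S: "finite S" "1 \<in> S" "S \<subseteq> ?H" "?H \<subseteq> frac_span y S"
    using finite_rank[of 1 y y p n] y(2) by auto
  have yH: "y \<in> ?H" using F_mono[OF n] y(2) hull_subset[of "F n" division_subalgebra] by blast
  \<comment> \<open>An operator on a space of rank \<open>card S\<close> has
    \<open>card (S \<times> S)\<close> matrix entries, so the \<open>N + 1\<close> operators with
    \<open>j \<le> N\<close> are dependent.\<close>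
  define N where "N = card (S \<times> S)"
  have "\<exists>f g. f \<noteq> 0 \<and> ev y f * (s * y ^ j) = (\<Sum>s'\<in>S. ev y (g s') * s')" if "s \<in> S" for s j
  proof -
    have "s * y ^ j \<in> frac_span y S" using that S(3,4) yH by (auto intro!: division_hullD)
    then show ?thesis by (metis frac_span_polyE)
  qed
  then obtain P g where P: "\<And>s j. s \<in> S \<Longrightarrow> P s j \<noteq> 0"
    "\<And>s j. s \<in> S \<Longrightarrow> ev y (P s j) * (s * y ^ j) = (\<Sum>s'\<in>S. ev y (g s j s') * s')"
    by metis
  \<comment> \<open>One denominator for each \<open>j\<close>, common to all \<open>s\<close>: the
    coefficient of the j-th operator must not depend on its argument.\<close>
  define Q where "Q j = (\<Prod>s\<in>S. P s j)" for j
  have Q0: "Q j \<noteq> 0" for j using S(1) P(1) by (simp add: Q_def)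
  define g' where "g' s j s' = (\<Prod>t\<in>S - {s}. P t j) * g s j s'" for s j s'
  have Q: "ev y (Q j) * (s * y ^ j) = (\<Sum>s'\<in>S. ev y (g' s j s') * s')" if "s \<in> S" for s j
  proof -
    have "Q j = (\<Prod>t\<in>S - {s}. P t j) * P s j"
      using that S(1) by (simp add: Q_def prod.remove[of S s] mult.commute)
    then show ?thesis using P(2)[OF that, of j]
      by (simp add: ev_mult mult.assoc g'_def sum_distrib_left)
  qed
  obtain h where h: "\<exists>j\<le>N. h j \<noteq> 0" "\<forall>i\<in>S\<times>S. (\<Sum>j\<le>N. h j * g' (fst i) j (snd i)) = 0"
    using linear_system_nontrivial_solution[of "S \<times> S" "{..N}" "\<lambda>i j. g' (fst i) j (snd i)"] S(1)
    by (auto simp: N_def)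
  define relation where "relation f \<longleftrightarrow> (\<forall>j. f j \<in> ?H) \<and> (\<exists>j\<le>N. f j \<noteq> 0) \<and>
     (\<forall>u\<in>?H. (\<Sum>j\<le>N. f j * u * y ^ j) = 0)" for f
  have "relation (\<lambda>j. ev y (h j * Q j))"
    unfolding relation_def
  proof (intro conjI allI ballI)
    show "ev y (h j * Q j) \<in> ?H" for j using yH by (intro division_hullD)
    show "\<exists>j\<le>N. ev y (h j * Q j) \<noteq> 0" using h(1) Q0 ev_nonzero[OF y(1)] by (metis mult_eq_0_iff)
    have zero: "(\<Sum>j\<le>N. ev y (h j * Q j) * (s * y ^ j)) = 0" if s: "s \<in> S" for s
    proof -
      have "(\<Sum>j\<le>N. ev y (h j * Q j) * (s * y ^ j)) = (\<Sum>j\<le>N. \<Sum>s'\<in>S. ev y (h j * g' s j s') * s')"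
        by (intro sum.cong) (auto simp: ev_mult mult.assoc Q[OF s] sum_distrib_left)
      also have "\<dots> = (\<Sum>s'\<in>S. ev y (\<Sum>j\<le>N. h j * g' s j s') * s')"
        by (subst sum.swap) (simp add: ev_sum sum_distrib_right)
      also have "\<dots> = 0"
      proof (rule sum.neutral, rule ballI)
        fix s' assume "s' \<in> S"
        then have "(\<Sum>j\<le>N. h j * g' s j s') = 0" using h(2) s by (metis SigmaI fst_conv snd_conv)
        then show "ev y (\<Sum>j\<le>N. h j * g' s j s') * s' = 0" by simp
      qed
      finally show ?thesis .
    qed
    fix u assume "u \<in> ?H"
    then obtain f k where f: "f \<noteq> 0" "ev y f * u = (\<Sum>s\<in>S. ev y (k s) * s)"
      using S(4) frac_span_polyE by (metis subsetD)
    \<comment> \<open>The coefficients lie in k[y] and commute with the left scalars, so the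
      relation extends from \<open>S\<close> to its left k(y)-span.\<close>
    have "ev y f * (\<Sum>j\<le>N. ev y (h j * Q j) * u * y ^ j) = (\<Sum>j\<le>N. ev y (h j * Q j) * (ev y f * u) * y ^ j)"
      unfolding sum_distrib_left by (intro sum.cong refl) (metis ev_mult_commute mult.assoc)
    also have "\<dots> = (\<Sum>j\<le>N. \<Sum>s\<in>S. ev y (k s) * (ev y (h j * Q j) * (s * y ^ j)))"
      unfolding f(2) sum_distrib_left sum_distrib_right
      by (intro sum.cong refl) (metis ev_mult_commute mult.assoc)
    also have "\<dots> = (\<Sum>s\<in>S. ev y (k s) * (\<Sum>j\<le>N. ev y (h j * Q j) * (s * y ^ j)))"
      by (subst sum.swap) (simp add: sum_distrib_left)
    also have "\<dots> = 0" by (simp add: zero)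
    finally show "(\<Sum>j\<le>N. ev y (h j * Q j) * u * y ^ j) = 0"
      using nzd ev_nonzero[OF y(1) f(1)] by blast
  qed
  then obtain f where f: "relation f"
    "\<And>f'. relation f' \<Longrightarrow> card {j. j \<le> N \<and> f j \<noteq> 0} \<le> card {j. j \<le> N \<and> f' j \<noteq> 0}"
    using ex_has_least_nat[of relation _ "\<lambda>f. card {j. j \<le> N \<and> f j \<noteq> 0}"] by blast
  obtain j0 where j0: "j0 \<le> N" "f j0 \<noteq> 0" using f(1) relation_def by blast
  define f' where "f' j = iv (f j0) * f j" for j
  have f'H: "f' j \<in> ?H" for j
    unfolding f'_def using f(1) by (intro division_hullD) (auto simp: relation_def)
  have f'0: "f' j0 = 1" using j0 by (simp add: f'_def iv_left)
  have f'rel: "(\<Sum>j\<le>N. f' j * u * y ^ j) = 0" if "u \<in> ?H" for u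
  proof -
    have "(\<Sum>j\<le>N. f' j * u * y ^ j) = iv (f j0) * (\<Sum>j\<le>N. f j * u * y ^ j)"
      by (simp add: f'_def sum_distrib_left mult.assoc)
    then show ?thesis using f(1) that by (simp add: relation_def)
  qed
  have central: "f' j * w = w * f' j" if j: "j \<le> N" and w: "w \<in> ?H" for j w
  proof (rule ccontr)
    assume neq: "f' j * w \<noteq> w * f' j"
    \<comment> \<open>Substitute \<open>w * u\<close> for \<open>u\<close> and subtract
      \<open>w\<close> times the original relation. The coefficient 1 at \<open>j0\<close> cancels,
      so a nonzero result would be a shorter relation.\<close>
    define k where "k i = f' i * w - w * f' i" for i
    have "relation k"
      unfolding relation_def
    proof (intro conjI allI ballI)
      show "k i \<in> ?H" for i unfolding k_def using w f'H by (intro division_hullD)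
      show "\<exists>i\<le>N. k i \<noteq> 0" using j neq by (auto simp: k_def)
      fix u assume u: "u \<in> ?H"
      have "(\<Sum>i\<le>N. k i * u * y ^ i) = (\<Sum>i\<le>N. f' i * (w * u) * y ^ i) - w * (\<Sum>i\<le>N. f' i * u * y ^ i)"
        by (simp add: k_def left_diff_distrib sum_subtractf sum_distrib_left mult.assoc)
      also have "\<dots> = 0" using f'rel u w by (simp add: division_hullD)
      finally show "(\<Sum>i\<le>N. k i * u * y ^ i) = 0" .
    qed
    moreover have "{i. i \<le> N \<and> k i \<noteq> 0} \<subset> {i. i \<le> N \<and> f i \<noteq> 0}"
    proof
      show "{i. i \<le> N \<and> k i \<noteq> 0} \<subseteq> {i. i \<le> N \<and> f i \<noteq> 0}"
        by (auto simp: k_def f'_def)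
      have "k j0 = 0" by (simp add: k_def f'0)
      then show "{i. i \<le> N \<and> k i \<noteq> 0} \<noteq> {i. i \<le> N \<and> f i \<noteq> 0}" using j0 by blast
    qed
    then have "card {i. i \<le> N \<and> k i \<noteq> 0} < card {i. i \<le> N \<and> f i \<noteq> 0}"
      by (intro psubset_card_mono) auto
    ultimately show False using f(2)[of k] by simp
  qed
  show ?thesis
  proof (rule ccontr)
    \<comment> \<open>Then all coefficients are scalars, and \<open>u = 1\<close> makes
      \<open>y\<close> a root of a polynomial whose coefficient at \<open>j0\<close> is 1.\<close>
    assume con: "\<not> ?thesis"
    have "\<exists>a. f' j = scale a 1" if "j \<le> N" for j
      using con central[OF that] f'H[of j] unfolding transcendental_def by blast
    then obtain a where a: "\<And>j. j \<le> N \<Longrightarrow> f' j = scale (a j) 1" by metis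
    have "ev y (\<Sum>j\<le>N. monom (a j) j) = (\<Sum>j\<le>N. f' j * 1 * y ^ j)"
      by (simp add: ev_sum ev_monom a scale_eq_mult(1)[symmetric])
    also have "\<dots> = 0" using f'rel[of 1] by (simp add: division_hullD)
    finally have "(\<Sum>j\<le>N. monom (a j) j) = 0" using ev_nonzero[OF y(1)] by blast
    moreover have "coeff (\<Sum>j\<le>N. monom (a j) j) j0 = a j0" using j0 by (simp add: coeff_sum)
    ultimately have "a j0 = 0" by simp
    then show False using a[OF j0(1)] f'0 by simp
  qed
qed

end

subsection \<open>Lattices in skew polynomial rings\<close>

lemma degree_pderiv_le: "degree (pderiv p) \<le> degree p"
  by (intro degree_le) (simp add: coeff_pderiv coeff_eq_0)

locale skew_polynomials = division_algebra scale
  for scale :: "'k::alg_closed_field \<Rightarrow> 'a::ring_1 \<Rightarrow> 'a" +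
  fixes H :: "'a set" and x :: 'a
  assumes H: "division_subalgebra H"
    and commutator_mem: "q \<in> H \<Longrightarrow> x * q - q * x \<in> H"
begin

definition D :: "'a \<Rightarrow> 'a" where "D q = x * q - q * x"

lemma D_mem: "q \<in> H \<Longrightarrow> D q \<in> H" using commutator_mem by (simp add: D_def)

lemma D_mult: "D (a * b) = D a * b + a * D b"
  by (simp add: D_def algebra_simps)

lemma D_add: "D (a + b) = D a + D b"
  by (simp add: D_def algebra_simps)

lemma D_scale: "D (scale c a) = scale c (D a)"
  by (simp add: D_def scale_right_diff_distrib scale_mult_left[symmetric] scale_mult_right[symmetric])

lemma D_sum: "D (sum f I) = (\<Sum>i\<in>I. D (f i))"
  by (simp add: D_def sum_distrib_left sum_distrib_right sum_subtractf)

lemma D_one: "D 1 = 0" by (simp add: D_def)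

text \<open>Commutation of \<open>w\<close> with \<open>D w\<close> is what gathers the terms of the
  Leibniz rule into one derivative; for central \<open>w\<close> it is automatic.\<close>

lemma D_ev:
  assumes "w * D w = D w * w" shows "D (ev w f) = ev w (pderiv f) * D w"
proof (induction f)
  case (pCons a f)
  have "D w * ev w f = ev w f * D w" using ev_commute[OF assms] by simp
  then show ?case using pCons.IH
    by (simp add: D_add D_scale D_one D_mult pderiv_pCons ev_add algebra_simps)
qed (simp add: D_def)

text \<open>Elements of H[x; D] of degree below \<open>t\<close>. Existence of an expansion is
  asserted, not its uniqueness: an upper bound on dimensions calls for spanning sets.\<close>

definition skew :: "'a set \<Rightarrow> nat \<Rightarrow> 'a set" where
  "skew L t = {\<Sum>j<t. e j * x ^ j | e. \<forall>j<t. e j \<in> L}"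

lemma skewI: "(\<And>j. j < t \<Longrightarrow> e j \<in> L) \<Longrightarrow> (\<Sum>j<t. e j * x ^ j) \<in> skew L t"
  unfolding skew_def by blast

lemma skewE:
  assumes "u \<in> skew L t" obtains e where "u = (\<Sum>j<t. e j * x ^ j)" "\<forall>j<t. e j \<in> L"
  using assms unfolding skew_def by blast

lemma skew_mono:
  assumes "L \<subseteq> L'" "0 \<in> L'" "t \<le> t'" shows "skew L t \<subseteq> skew L' t'"
proof
  fix u assume "u \<in> skew L t"
  from skewE[OF this] obtain e where e: "u = (\<Sum>j<t. e j * x ^ j)" "\<forall>j<t. e j \<in> L" .
  have "u = (\<Sum>j<t. (if j < t then e j else 0) * x ^ j)" using e(1) by simp
  also have "\<dots> = (\<Sum>j<t'. (if j < t then e j else 0) * x ^ j)"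
    using assms(3) by (intro sum.mono_neutral_left) auto
  also have "\<dots> \<in> skew L' t'" using e(2) assms by (intro skewI) auto
  finally show "u \<in> skew L' t'" .
qed

lemma skew_subspace:
  assumes "subspace L" shows "subspace (skew L t)"
proof (rule subspaceI)
  show "0 \<in> skew L t" using skewI[of t "\<lambda>_. 0" L] subspace_0[OF assms] by simp
next
  fix u v assume u: "u \<in> skew L t" and v: "v \<in> skew L t"
  obtain e where "u = (\<Sum>j<t. e j * x ^ j)" "\<forall>j<t. e j \<in> L"
    using skewE[OF u] .
  moreover obtain f where "v = (\<Sum>j<t. f j * x ^ j)" "\<forall>j<t. f j \<in> L"
    using skewE[OF v] .
  ultimately show "u + v \<in> skew L t" using skewI[of t "\<lambda>j. e j + f j" L] subspace_add[OF assms]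
    by (simp add: distrib_right sum.distrib)
next
  fix c u assume "u \<in> skew L t"
  from skewE[OF this] obtain e where "u = (\<Sum>j<t. e j * x ^ j)" "\<forall>j<t. e j \<in> L" .
  then show "scale c u \<in> skew L t" using skewI[of t "\<lambda>j. scale c (e j)" L] subspace_scale[OF assms]
    by (simp add: scale_sum_right scale_mult_left)
qed

lemma skew_mult_left:
  assumes "u \<in> skew L t" "\<And>l. l \<in> L \<Longrightarrow> c * l \<in> L'" shows "c * u \<in> skew L' t"
proof -
  obtain e where "u = (\<Sum>j<t. e j * x ^ j)" "\<forall>j<t. e j \<in> L" using skewE[OF assms(1)] .
  then show ?thesis using skewI[of t "\<lambda>j. c * e j" L'] assms(2)
    by (simp add: sum_distrib_left mult.assoc)
qed

text \<open>The rule \<open>x * l = l * x + D l\<close> raises the degree by one and leaves a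
  remainder of the old degree with coefficients \<open>D l\<close>.\<close>

lemma skew_mult_x:
  assumes u: "u \<in> skew L t" and L': "subspace L'" "L \<subseteq> L'" "\<And>l. l \<in> L \<Longrightarrow> D l \<in> L'"
  shows "x * u \<in> skew L' (Suc t)"
proof -
  obtain e where e: "u = (\<Sum>j<t. e j * x ^ j)" "\<forall>j<t. e j \<in> L" using skewE[OF u] .
  have "x * u = (\<Sum>j<t. e j * x ^ Suc j) + (\<Sum>j<t. D (e j) * x ^ j)"
    unfolding e(1) sum_distrib_left sum.distrib[symmetric]
    by (intro sum.cong refl) (simp add: D_def algebra_simps)
  moreover have "(\<Sum>j<t. e j * x ^ Suc j) = (\<Sum>j<Suc t. (case j of 0 \<Rightarrow> 0 | Suc i \<Rightarrow> e i) * x ^ j)"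
    by (subst sum.lessThan_Suc_shift) simp
  moreover have "(\<Sum>j<Suc t. (case j of 0 \<Rightarrow> 0 | Suc i \<Rightarrow> e i) * x ^ j) \<in> skew L' (Suc t)"
    using e(2) L' subspace_0 by (intro skewI) (auto split: nat.splits)
  moreover have "(\<Sum>j<t. D (e j) * x ^ j) \<in> skew L' t" using e(2) L' by (intro skewI) auto
  then have "(\<Sum>j<t. D (e j) * x ^ j) \<in> skew L' (Suc t)"
    using skew_mono[of L' L' t "Suc t"] subspace_0[OF L'(1)] by auto
  ultimately show ?thesis using subspace_add[OF skew_subspace[OF L'(1)]] by auto
qed

end

text \<open>\<open>H\<close> has finite rank over $k(w)$ with generators \<open>S\<close>, and \<open>q(w)\<close> is a common denominator,
  with respect to these generators, for the structure constants of \<open>H\<close>, for the derivation \<open>D\<close>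
  and for the elements of \<open>E\<close>.\<close>

locale skew_lattice = skew_polynomials scale H x
  for scale :: "'k::alg_closed_field \<Rightarrow> 'a::ring_1 \<Rightarrow> 'a" and H x +
  fixes w :: 'a and S E :: "'a set" and q :: "'k poly" and d :: nat
  assumes w_mem: "w \<in> H" and w_central: "a \<in> H \<Longrightarrow> w * a = a * w" and w_transc: "transcendental w"
    and S: "finite S" "S \<subseteq> H" and E: "E \<subseteq> H"
    and q: "q \<noteq> 0" "degree q \<le> d"
    and denominator: "u \<in> (\<lambda>(s, t). s * t) ` (S \<times> S) \<union> D ` S \<union> (*) (D w) ` S \<union> insert 1 E \<Longrightarrow>
      \<exists>f. (\<forall>s\<in>S. degree (f s) \<le> d) \<and> ev w q * u = (\<Sum>s\<in>S. ev w (f s) * s)"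
begin

definition P :: "nat \<Rightarrow> 'a set" where
  "P a = {\<Sum>s\<in>S. ev w (f s) * s | f. \<forall>s\<in>S. degree (f s) \<le> a}"

abbreviation Q :: 'a where "Q \<equiv> ev w q"

text \<open>Pole order along \<open>Q\<close> and degree of numerators are tied to a single index,
  so that applying \<open>D\<close> or multiplying by an element of \<open>E\<close> just raises
  this index by 2.\<close>

definition L :: "nat \<Rightarrow> 'a set" where
  "L a = {u \<in> H. Q ^ a * u \<in> P (d * a)}"

lemma PI: "(\<And>s. s \<in> S \<Longrightarrow> degree (f s) \<le> a) \<Longrightarrow> (\<Sum>s\<in>S. ev w (f s) * s) \<in> P a"
  unfolding P_def by blast

lemma PE:
  assumes "u \<in> P a" obtains f where "u = (\<Sum>s\<in>S. ev w (f s) * s)" "\<forall>s\<in>S. degree (f s) \<le> a"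
  using assms unfolding P_def by blast

lemma L_E:
  assumes "u \<in> L a"
  obtains f where "Q ^ a * u = (\<Sum>s\<in>S. ev w (f s) * s)" "\<forall>s\<in>S. degree (f s) \<le> d * a"
proof -
  have "Q ^ a * u \<in> P (d * a)" using assms by (simp add: L_def)
  from PE[OF this] show ?thesis using that by blast
qed

lemma denominator_P:
  "u \<in> (\<lambda>(s, t). s * t) ` (S \<times> S) \<union> D ` S \<union> (*) (D w) ` S \<union> insert 1 E \<Longrightarrow> Q * u \<in> P d"
  using denominator[of u] PI by fastforce

lemma P_subspace: "subspace (P a)"
proof (rule subspaceI)
  show "0 \<in> P a" using PI[of "\<lambda>_. 0" a] by simp
next
  fix u v assume u: "u \<in> P a" and v: "v \<in> P a"
  obtain f where "u = (\<Sum>s\<in>S. ev w (f s) * s)" "\<forall>s\<in>S. degree (f s) \<le> a"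
    using PE[OF u] .
  moreover obtain g where "v = (\<Sum>s\<in>S. ev w (g s) * s)" "\<forall>s\<in>S. degree (g s) \<le> a"
    using PE[OF v] .
  ultimately show "u + v \<in> P a" using PI[of "\<lambda>s. f s + g s" a]
    by (simp add: distrib_right sum.distrib ev_add degree_add_le)
next
  fix c u assume "u \<in> P a"
  from PE[OF this] obtain f where "u = (\<Sum>s\<in>S. ev w (f s) * s)" "\<forall>s\<in>S. degree (f s) \<le> a" .
  then show "scale c u \<in> P a" using PI[of "\<lambda>s. smult c (f s)" a]
    by (simp add: scale_sum_right scale_mult_left ev_smult le_trans[OF degree_smult_le])
qed

lemma P_ev:
  assumes "u \<in> P a" "degree g + a \<le> b" shows "ev w g * u \<in> P b"
proof -
  obtain f where f: "u = (\<Sum>s\<in>S. ev w (f s) * s)" "\<forall>s\<in>S. degree (f s) \<le> a"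
    using PE[OF assms(1)] .
  have "degree (g * f s) \<le> b" if "s \<in> S" for s
    using degree_mult_le[of g "f s"] bspec[OF f(2) that] assms(2) by linarith
  then show ?thesis using f(1) PI[of "\<lambda>s. g * f s" b]
    by (simp add: sum_distrib_left ev_mult mult.assoc)
qed

lemma P_sum_ev:
  assumes "\<And>s. s \<in> S \<Longrightarrow> u s \<in> P a" "\<And>s. s \<in> S \<Longrightarrow> degree (g s) + a \<le> b"
  shows "(\<Sum>s\<in>S. ev w (g s) * u s) \<in> P b"
  using assms by (intro subspace_sum[OF P_subspace] P_ev)

lemma ev_w_central: "a \<in> H \<Longrightarrow> ev w f * a = a * ev w f"
  using ev_commute w_central by blast

lemma Q_nonzero: "Q \<noteq> 0" using ev_nonzero[OF w_transc q(1)] .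

lemma ev_power: "ev w (f ^ n) = ev w f ^ n"
  by (induction n) (auto simp: ev_mult)

lemma Q_power_central: "a \<in> H \<Longrightarrow> Q ^ n * a = a * Q ^ n"
  using ev_w_central[of a "q ^ n"] by (simp add: ev_power)

lemma L_subspace: "subspace (L a)"
  using P_subspace H
  by (intro subspaceI) (auto simp: L_def division_subalgebraD subspace_0 subspace_add distrib_left
      scale_mult_right[symmetric] subspace_scale)

lemma L_mono: "a \<le> b \<Longrightarrow> L a \<subseteq> L b"
proof (induction rule: dec_induct)
  case (step n)
  have "L n \<subseteq> L (Suc n)"
  proof
    fix u assume u: "u \<in> L n"
    then have "Q * (Q ^ n * u) \<in> P (d * Suc n)" using q(2) by (intro P_ev) (auto simp: L_def)
    then show "u \<in> L (Suc n)" using u by (auto simp: L_def mult.assoc)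
  qed
  then show ?case using step by blast
qed simp

lemma E_L: "insert 1 E \<subseteq> L 1"
proof
  fix u assume u: "u \<in> insert 1 E"
  then have "Q * u \<in> P d" by (intro denominator_P) blast
  moreover have "u \<in> H" using u E division_subalgebraD(2)[OF H] by auto
  ultimately show "u \<in> L 1" by (simp add: L_def)
qed

text \<open>One factor \<open>Q\<close> clears \<open>e\<close>, \<open>Q ^ a\<close> clears
  \<open>u\<close>, and one more \<open>Q\<close> clears the products of generators; each factor
  allows \<open>d\<close> more in the degrees. Centrality of \<open>w\<close> moves the coefficients
  past the generators.\<close>

lemma L_mult:
  assumes "e \<in> L 1" "u \<in> L a" shows "e * u \<in> L (a + 2)"
proof -
  have eH: "e \<in> H" "u \<in> H" using assms by (auto simp: L_def)
  obtain f where f: "Q * e = (\<Sum>s\<in>S. ev w (f s) * s)" "\<forall>s\<in>S. degree (f s) \<le> d"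
    using L_E[OF assms(1)] by auto
  obtain g where g: "Q ^ a * u = (\<Sum>s\<in>S. ev w (g s) * s)" "\<forall>s\<in>S. degree (g s) \<le> d * a"
    using L_E[OF assms(2)] .
  have "Q ^ (a + 2) * (e * u) = Q * ((Q * e) * (Q ^ a * u))"
    using Q_power_central[OF eH(1), of a] by (simp add: power_add power2_eq_square mult.assoc)
      (metis mult.assoc power_commutes)
  also have "\<dots> = (\<Sum>s\<in>S. ev w (f s) * (\<Sum>t\<in>S. ev w (g t) * (Q * (s * t))))"
  proof -
    have "Q * ((ev w (f s) * s) * (ev w (g t) * t)) = ev w (f s) * (ev w (g t) * (Q * (s * t)))"
      if "s \<in> S" for s t
    proof -
      have "s * ev w (g t) = ev w (g t) * s" using ev_w_central that S(2) by auto
      then have "Q * ((ev w (f s) * s) * (ev w (g t) * t)) = Q * ev w (f s) * ev w (g t) * (s * t)"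
        by (metis mult.assoc)
      also have "\<dots> = ev w (f s) * (ev w (g t) * (Q * (s * t)))"
        by (metis ev_mult_commute mult.assoc)
      finally show ?thesis .
    qed
    then show ?thesis unfolding f(1) g(1) sum_product unfolding sum_distrib_left
      by (intro sum.cong refl)
  qed
  also have "\<dots> \<in> P (d * (a + 2))"
  proof (rule P_sum_ev[where a = "d * a + d"])
    fix s assume s: "s \<in> S"
    show "(\<Sum>t\<in>S. ev w (g t) * (Q * (s * t))) \<in> P (d * a + d)"
      using g(2) s by (intro P_sum_ev[where a = d] denominator_P) auto
    show "degree (f s) + (d * a + d) \<le> d * (a + 2)" using f(2) s by (simp add: algebra_simps)
  qed
  finally show ?thesis using eH H by (simp add: L_def division_subalgebraD)
qed

text \<open>Differentiate \<open>w * a = a * w\<close>: the terms with \<open>D a\<close> cancel,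
  because \<open>D a\<close> lies in \<open>H\<close> and commutes with \<open>w\<close>.\<close>

lemma Dw: "D w \<in> H" "w * D w = D w * w" "a \<in> H \<Longrightarrow> D w * a = a * D w"
proof -
  show z: "D w \<in> H" using D_mem w_mem .
  then show "w * D w = D w * w" by (rule w_central)
  assume a: "a \<in> H"
  have "D (w * a) = D (a * w)" using w_central[OF a] by simp
  then show "D w * a = a * D w" using w_central[OF D_mem[OF a]] by (simp add: D_mult)
qed

text \<open>Quotient rule: \<open>Q ^ a * D u = D (Q ^ a * u) - D (Q ^ a) * u\<close>. The
  logarithmic derivative of \<open>Q ^ a\<close> costs a single factor \<open>Q\<close> whatever
  \<open>a\<close> is, and a second one clears the denominators of \<open>D s\<close> and
  \<open>D w * s\<close>.\<close>

lemma L_D: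
  assumes u: "u \<in> L a" shows "D u \<in> L (a + 2)"
proof -
  have uH: "u \<in> H" using u by (auto simp: L_def)
  obtain g where g: "Q ^ a * u = (\<Sum>s\<in>S. ev w (g s) * s)" "\<forall>s\<in>S. degree (g s) \<le> d * a"
    using L_E[OF u] .
  \<comment> \<open>Multiplying the derivative of \<open>q ^ a\<close> by \<open>q\<close> restores
    the exponent, so that \<open>r * q ^ a\<close> is correct for \<open>a = 0\<close> as
    well.\<close>
  define r where "r = smult (of_nat a) (pderiv q)"
  have r: "degree r \<le> d" "q * pderiv (q ^ a) = r * q ^ a"
  proof -
    show "degree r \<le> d" unfolding r_def
      using q(2) degree_smult_le[of "of_nat a" "pderiv q"] degree_pderiv_le[of q] by linarith
    show "q * pderiv (q ^ a) = r * q ^ a"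
      by (cases a) (simp_all add: r_def pderiv_power_Suc ac_simps del: power_Suc, simp add: ac_simps)
  qed
  have 1: "Q * Q * (D (Q ^ a) * u) = ev w r * (\<Sum>s\<in>S. ev w (g s) * (Q * (D w * s)))"
  proof -
    have "D (Q ^ a) = ev w (pderiv (q ^ a)) * D w"
      using D_ev[OF Dw(2), of "q ^ a"] by (simp add: ev_power)
    then have "Q * Q * (D (Q ^ a) * u) = Q * (ev w (q * pderiv (q ^ a)) * (D w * u))"
      by (simp add: ev_mult mult.assoc)
    also have "\<dots> = Q * (ev w r * (Q ^ a * (D w * u)))"
      by (simp add: r(2) ev_mult ev_power mult.assoc)
    also have "\<dots> = ev w r * (Q * (D w * (Q ^ a * u)))"
      using Q_power_central[OF Dw(1), of a] by (metis ev_mult_commute mult.assoc)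
    also have "Q * (D w * (Q ^ a * u)) = (\<Sum>s\<in>S. ev w (g s) * (Q * (D w * s)))"
      unfolding g(1) sum_distrib_left
    proof (intro sum.cong refl)
      fix s assume "s \<in> S"
      have "D w * ev w (g s) = ev w (g s) * D w" using ev_w_central Dw(1) by auto
      then show "Q * (D w * (ev w (g s) * s)) = ev w (g s) * (Q * (D w * s))"
        by (metis ev_mult_commute mult.assoc)
    qed
    finally show ?thesis .
  qed
  have 2: "Q * Q * D (Q ^ a * u) =
     Q * (\<Sum>s\<in>S. ev w (pderiv (g s)) * (Q * (D w * s))) + Q * (\<Sum>s\<in>S. ev w (g s) * (Q * D s))"
    unfolding g(1) D_sum D_mult D_ev[OF Dw(2)] sum_distrib_left sum.distrib[symmetric]
    by (intro sum.cong refl) (metis (no_types, lifting) distrib_left ev_mult_commute mult.assoc)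
  have "Q ^ (a + 2) * D u = Q * Q * D (Q ^ a * u) - Q * Q * (D (Q ^ a) * u)"
    by (simp add: D_mult distrib_left power_add power2_eq_square mult.assoc power_commutes)
  also have "\<dots> \<in> P (d * (a + 2))"
  proof (intro subspace_diff[OF P_subspace])
    have z: "Q * (D w * s) \<in> P d" if "s \<in> S" for s
      using that by (intro denominator_P) auto
    have z': "Q * D s \<in> P d" if "s \<in> S" for s
      using that by (intro denominator_P) auto
    have "degree (pderiv (g s)) + d \<le> d * a + d" if "s \<in> S" for s
      using bspec[OF g(2) that] degree_pderiv_le[of "g s"] by linarith
    then have "(\<Sum>s\<in>S. ev w (pderiv (g s)) * (Q * (D w * s))) \<in> P (d * a + d)"
      using z by (intro P_sum_ev[where a = d])
    moreover have "(\<Sum>s\<in>S. ev w (g s) * (Q * D s)) \<in> P (d * a + d)"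
      using z' g(2) by (intro P_sum_ev[where a = d]) auto
    ultimately show "Q * Q * D (Q ^ a * u) \<in> P (d * (a + 2))"
      unfolding 2 using q(2) by (intro subspace_add[OF P_subspace] P_ev[where a = "d * a + d"]) auto
    have "(\<Sum>s\<in>S. ev w (g s) * (Q * (D w * s))) \<in> P (d * a + d)"
      using z g(2) by (intro P_sum_ev[where a = d]) auto
    then show "Q * Q * (D (Q ^ a) * u) \<in> P (d * (a + 2))"
      unfolding 1 using r(1) by (intro P_ev[where a = "d * a + d"]) auto
  qed
  finally show ?thesis using uH by (simp add: L_def D_mem)
qed

text \<open>Each factor \<open>x\<close> raises the index by 2 through \<open>L_D\<close>, and the
  coefficient by 2 through \<open>L_mult\<close>; for \<open>j < \<mu>\<close> the total is
  \<open>2 * j + 2 \<le> 2 * \<mu>\<close>.\<close>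

lemma skew_L_mult:
  assumes v: "v \<in> skew (insert 1 E) \<mu>" and u: "u \<in> skew (L a) t"
  shows "v * u \<in> skew (L (a + 2 * \<mu>)) (t + \<mu>)"
proof -
  obtain e where v: "v = (\<Sum>j<\<mu>. e j * x ^ j)" "\<forall>j<\<mu>. e j \<in> insert 1 E"
    using v by (rule skewE)
  then have e: "\<forall>j<\<mu>. e j \<in> L 1" using E_L by blast
  have pow: "x ^ j * u \<in> skew (L (a + 2 * j)) (t + j)" for j
  proof (induction j)
    case (Suc j)
    have "x * (x ^ j * u) \<in> skew (L (a + 2 * j + 2)) (Suc (t + j))"
      by (rule skew_mult_x[OF Suc L_subspace L_mono L_D]) simp
    then show ?case by (simp add: mult.assoc)
  qed (simp add: u)
  have "e j * x ^ j * u \<in> skew (L (a + 2 * \<mu>)) (t + \<mu>)" if j: "j < \<mu>" for j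
  proof -
    have "e j * (x ^ j * u) \<in> skew (L (a + 2 * j + 2)) (t + j)"
      using skew_mult_left[OF pow[of j]] L_mult[OF e[rule_format, OF j]] by blast
    moreover have "a + 2 * j + 2 \<le> a + 2 * \<mu>" using j by simp
    ultimately show ?thesis
      using skew_mono[OF L_mono subspace_0[OF L_subspace], of "a + 2 * j + 2" "a + 2 * \<mu>" "t + j" "t + \<mu>"] j
      by (auto simp: mult.assoc)
  qed
  then show ?thesis unfolding v(1) sum_distrib_right
    by (intro subspace_sum[OF skew_subspace[OF L_subspace]]) auto
qed

lemma subspace_power_skew_L:
  assumes "V \<subseteq> skew (insert 1 E) \<mu>"
  shows "subspace_power (span V) n \<subseteq> skew (L (2 * \<mu> * n + 1)) (\<mu> * n + 1)"
proof (induction n)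
  case 0
  \<comment> \<open>The unit may itself have a denominator with respect to \<open>S\<close>, but
    \<open>q\<close> was chosen to clear it: hence the start at \<open>L 1\<close>. The 1 in the
    degree bound accounts for the constant term.\<close>
  have "(\<Sum>j<1. 1 * x ^ j) \<in> skew (L 1) 1" using E_L by (intro skewI) auto
  then have "span {1} \<subseteq> skew (L 1) 1" by (intro span_minimal skew_subspace L_subspace) simp
  then show ?case by simp
next
  case (Suc n)
  let ?M = "skew (L (2 * \<mu> * Suc n + 1)) (\<mu> * Suc n + 1)"
  have sM: "subspace ?M" by (rule skew_subspace[OF L_subspace])
  have "a * b \<in> ?M" if a: "a \<in> span V" and b: "b \<in> subspace_power (span V) n" for a b
    using a
  proof (induction rule: span_induct_alt)
    case base
    show ?case using subspace_0[OF sM] by simp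
  next
    case (step c v y)
    have "v * b \<in> skew (L (2 * \<mu> * n + 1 + 2 * \<mu>)) (\<mu> * n + 1 + \<mu>)"
      using step(1) b Suc assms by (intro skew_L_mult) auto
    then have "v * b \<in> ?M" by (simp add: algebra_simps)
    then have "scale c (v * b) + y * b \<in> ?M"
      using step subspace_add[OF sM] subspace_scale[OF sM] by blast
    then show ?case by (simp add: distrib_right scale_mult_left)
  qed
  then have "{a * b | a b. a \<in> span V \<and> b \<in> subspace_power (span V) n} \<subseteq> ?M" by blast
  then show ?case unfolding subspace_power.simps by (rule span_minimal[OF _ sM])
qed

text \<open>The spanning elements are \<open>Q^-a w^i s x^j\<close>. With \<open>a\<close> and
  \<open>t\<close> linear in \<open>n\<close>, and \<open>card S\<close> constant, their number is
  quadratic in \<open>n\<close>.\<close>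

lemma skew_L_spanning_set:
  "\<exists>T. finite T \<and> card T \<le> (d * a + 1) * card S * t \<and> skew (L a) t \<subseteq> span T"
proof -
  define \<phi> where "\<phi> = (\<lambda>((i, s), j). iv Q ^ a * (w ^ i * s) * x ^ j)"
  let ?I = "({..d * a} \<times> S) \<times> {..<t}"
  have "card (\<phi> ` ?I) \<le> card ?I" by (intro card_image_le) (simp add: S)
  then have card: "card (\<phi> ` ?I) \<le> (d * a + 1) * card S * t" by (simp add: card_cartesian_product)
  have "e * x ^ j \<in> span (\<phi> ` ?I)" if e: "e \<in> L a" and j: "j < t" for e j
  proof -
    obtain f where f: "Q ^ a * e = (\<Sum>s\<in>S. ev w (f s) * s)" "\<forall>s\<in>S. degree (f s) \<le> d * a"
      using L_E[OF e] .
    have "e * x ^ j = iv Q ^ a * (Q ^ a * e) * x ^ j"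
      using power_iv(3)[OF Q_nonzero] by (simp add: mult.assoc[symmetric])
    also have "\<dots> = (\<Sum>s\<in>S. \<Sum>i\<le>d * a. scale (coeff (f s) i) (\<phi> ((i, s), j)))"
      unfolding f(1) sum_distrib_left sum_distrib_right
      by (intro sum.cong refl)
        (simp add: f(2) ev_altdef[of _ "d * a"] \<phi>_def sum_distrib_left sum_distrib_right
          scale_mult_left[symmetric] scale_mult_right[symmetric])
    also have "\<dots> \<in> span (\<phi> ` ?I)" using j by (intro span_sum span_scale span_base) auto
    finally show ?thesis .
  qed
  then have "skew (L a) t \<subseteq> span (\<phi> ` ?I)"
    by (auto elim!: skewE intro!: span_sum)
  then show ?thesis using card S by (intro exI[of _ "\<phi> ` ?I"]) auto
qed

end

section \<open>Common denominators over k[w]\<close>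

context division_algebra
begin

lemma common_denominator:
  assumes S: "finite S" and X: "finite X" "X \<subseteq> frac_span w S"
  shows "\<exists>q d. q \<noteq> 0 \<and> degree q \<le> d \<and>
    (\<forall>u\<in>X. \<exists>f. (\<forall>s\<in>S. degree (f s) \<le> d) \<and> ev w q * u = (\<Sum>s\<in>S. ev w (f s) * s))"
proof -
  have "\<exists>f g. f \<noteq> 0 \<and> ev w f * u = (\<Sum>s\<in>S. ev w (g s) * s)" if "u \<in> X" for u
    using X(2) that by (metis frac_span_polyE subsetD)
  then obtain f g where f: "\<And>u. u \<in> X \<Longrightarrow> f u \<noteq> 0"
    "\<And>u. u \<in> X \<Longrightarrow> ev w (f u) * u = (\<Sum>s\<in>S. ev w (g u s) * s)" by metis
  define q where "q = (\<Prod>u\<in>X. f u)"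
  define g' where "g' u s = (\<Prod>t\<in>X - {u}. f t) * g u s" for u s
  define d where "d = degree q + (\<Sum>u\<in>X. \<Sum>s\<in>S. degree (g' u s))"
  have "ev w q * u = (\<Sum>s\<in>S. ev w (g' u s) * s)" if u: "u \<in> X" for u
  proof -
    have "q = (\<Prod>t\<in>X - {u}. f t) * f u"
      using u X(1) by (simp add: q_def prod.remove[of X u] mult.commute)
    then show ?thesis by (simp add: ev_mult mult.assoc g'_def sum_distrib_left f(2)[OF u])
  qed
  moreover have "degree (g' u s) \<le> d" if "u \<in> X" "s \<in> S" for u s
  proof -
    have "degree (g' u s) \<le> (\<Sum>s\<in>S. degree (g' u s))" using S that by (intro member_le_sum) auto
    also have "\<dots> \<le> (\<Sum>u\<in>X. \<Sum>s\<in>S. degree (g' u s))" using X that by (intro member_le_sum) auto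
    finally show ?thesis by (simp add: d_def)
  qed
  moreover have "q \<noteq> 0" using X f by (simp add: q_def)
  ultimately show ?thesis by (intro exI[of _ q] exI[of _ d]) (auto simp: d_def)
qed

end

section \<open>The quadratic upper bound inside a filtered division algebra\<close>

context subquadratic_filtration
begin

lemma subalgebra_Union_F: "subalgebra (\<Union>n. F n)"
  unfolding subalgebra_def
proof (intro conjI ballI)
  show "1 \<in> (\<Union>n. F n)" using F_one by blast
  show "subspace (\<Union>n. F n)"
  proof (rule subspaceI)
    show "0 \<in> (\<Union>n. F n)" using subspace_0[OF F_subspace] by blast
    fix a b assume "a \<in> (\<Union>n. F n)" "b \<in> (\<Union>n. F n)"
    then obtain m n where "a \<in> F m" "b \<in> F n" by blast
    then have "a \<in> F (max m n)" "b \<in> F (max m n)"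
      using F_mono[of m "max m n"] F_mono[of n "max m n"] by auto
    then show "a + b \<in> (\<Union>n. F n)" using subspace_add[OF F_subspace] by blast
  next
    fix c a assume "a \<in> (\<Union>n. F n)"
    then show "scale c a \<in> (\<Union>n. F n)" using subspace_scale[OF F_subspace] by blast
  qed
  fix a b assume "a \<in> (\<Union>n. F n)" "b \<in> (\<Union>n. F n)"
  then show "a * b \<in> (\<Union>n. F n)" using F_mult by blast
qed

text \<open>As \<open>w\<close> lies in the k(y)-span of filtered elements, some \<open>f(y)\<close>
  clears its denominators, and centrality allows this denominator on either side. In this form
  \<open>w\<close> can take the place of \<open>y\<close> in \<open>finite_rank\<close>.\<close>

lemma central_fraction:
  assumes y: "transcendental y" "y \<in> F p" and n: "p \<le> n"
    and w: "w \<in> division_hull (F n)" "\<And>q. q \<in> division_hull (F n) \<Longrightarrow> w * q = q * w"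
  shows "\<exists>\<beta> c r. \<beta> \<noteq> 0 \<and> \<beta> * w = c \<and> w * \<beta> = c \<and> \<beta> \<in> F r \<and> c \<in> F r"
proof -
  let ?U = "\<Union>n. F n"
  have sU: "subspace ?U" using subalgebra_Union_F by (simp add: subalgebra_def)
  have mU: "a * b \<in> ?U" if "a \<in> ?U" "b \<in> ?U" for a b
    using subalgebra_Union_F that unfolding subalgebra_def by blast
  have "1 \<in> F p" using F_one F_mono[of 0 p] by auto
  then have "\<exists>S r. finite S \<and> 1 \<in> S \<and> S \<subseteq> F r \<and> S \<subseteq> division_hull (F n) \<and>
      division_hull (F n) \<subseteq> frac_span y S"
    using y(2) by (intro finite_rank[of 1 y y p]) auto
  then obtain S r where S: "finite S" "S \<subseteq> F r" "division_hull (F n) \<subseteq> frac_span y S"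
    by blast
  obtain f g where f: "f \<noteq> 0" "ev y f * w = (\<Sum>s\<in>S. ev y (g s) * s)"
    using S(3) w(1) frac_span_polyE by (metis subsetD)
  have evU: "ev y k \<in> ?U" for k using ev_mem[OF subalgebra_Union_F] y(2) by blast
  have "ev y f * w \<in> ?U"
    unfolding f(2) using S(2) by (intro subspace_sum[OF sU] mU evU) blast
  then obtain i j where "ev y f \<in> F i" "ev y f * w \<in> F j" using evU[of f] by blast
  then have F: "ev y f \<in> F (max i j)" "ev y f * w \<in> F (max i j)"
    using F_mono[of i "max i j"] F_mono[of j "max i j"] by auto
  have "y \<in> division_hull (F n)" using F_mono[OF n] y(2) hull_subset[of "F n" division_subalgebra] by blast
  then have "w * ev y f = ev y f * w" by (intro w(2) division_hullD)
  then show ?thesis using ev_nonzero[OF y(1) f(1)] F by blast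
qed

text \<open>With \<open>x = b * x'\<close>, the hypothesis \<open>comm\<close> says that
  \<open>b\<close> times the commutator of \<open>x'\<close> with \<open>c * b\<close> stays in the
  filtration up to a shift by \<open>h\<close>. The one on \<open>V\<close> makes its elements
  polynomials in \<open>x\<close> up to a left denominator.\<close>

theorem quadratic_upper_bound:
  fixes x b y :: 'a
  assumes b: "b \<in> F p" "b \<noteq> 0" and y: "transcendental y" "y \<in> F p"
    and comm: "\<And>n c. c \<in> F n \<Longrightarrow> x * c * b - b * c * x \<in> F (n + h)"
    and V: "finite V"
      "\<And>v. v \<in> V \<Longrightarrow> \<exists>r \<beta> m e. \<beta> \<in> F r \<and> \<beta> \<noteq> 0 \<and> (\<forall>j<m. e j \<in> F r) \<and> \<beta> * v = (\<Sum>j<m. e j * x ^ j)"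
  shows "\<exists>C. \<forall>n\<ge>1. \<exists>T. finite T \<and> card T \<le> C * n\<^sup>2 \<and> subspace_power (span V) n \<subseteq> span T"
proof -
  have "\<forall>v\<in>V. \<exists>r \<beta> m e. \<beta> \<in> F r \<and> \<beta> \<noteq> 0 \<and> (\<forall>j<m. e j \<in> F r) \<and>
      \<beta> * v = (\<Sum>j<m. e j * x ^ j)"
    using V(2) by blast
  then obtain r \<beta> m e where "\<forall>v\<in>V. \<beta> v \<in> F (r v) \<and> \<beta> v \<noteq> 0 \<and>
      (\<forall>j<m v. e v j \<in> F (r v)) \<and> \<beta> v * v = (\<Sum>j<m v. e v j * x ^ j)"
    unfolding bchoice_iff by (elim exE) rule
  then have e: "\<And>v. v \<in> V \<Longrightarrow> \<beta> v \<in> F (r v)" "\<And>v. v \<in> V \<Longrightarrow> \<beta> v \<noteq> 0"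
    "\<And>v j. v \<in> V \<Longrightarrow> j < m v \<Longrightarrow> e v j \<in> F (r v)"
    "\<And>v. v \<in> V \<Longrightarrow> \<beta> v * v = (\<Sum>j<m v. e v j * x ^ j)"
    by simp_all
  \<comment> \<open>From this level on, \<open>F n\<close> contains \<open>b\<close>,
    \<open>y\<close> and all coefficients and denominators belonging to \<open>V\<close>.\<close>
  define n0 where "n0 = p + (\<Sum>v\<in>V. r v)"
  have rn0: "r v \<le> n0" if "v \<in> V" for v
    using member_le_sum[of v V r] V(1) that by (simp add: n0_def)
  obtain n where n: "n \<ge> n0" "F (n + h) \<subseteq> division_hull (F n)"
    using division_hull_stabilizes[OF y, of n0 h] by (auto simp: n0_def)
  have pn: "p \<le> n" using n(1) by (simp add: n0_def)
  define H where "H = division_hull (F n)"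
  have H: "division_subalgebra H" unfolding H_def by (rule division_subalgebra_hull)
  note HD = division_subalgebraD[OF H]
  have FnH: "F n \<subseteq> H" unfolding H_def by (rule hull_subset)
  have bH: "b \<in> H" using b(1) F_mono[OF pn] FnH by blast
  define x' where "x' = iv b * x"
  have x: "x = b * x'" using b(2) by (simp add: x'_def iv_cancel)
  define \<Delta> where "\<Delta> q = x' * q - q * x'" for q
  have Dmult: "\<Delta> (a * c) = \<Delta> a * c + a * \<Delta> c" for a c by (simp add: \<Delta>_def algebra_simps)
  \<comment> \<open>Only products \<open>c * b\<close> are controlled directly; \<open>c = 1\<close>
    then yields \<open>\<Delta> b\<close>, and the Leibniz rule yields
    \<open>\<Delta> c\<close>.\<close>
  have D_right_b: "\<Delta> (c * b) \<in> H" if "c \<in> F n" for c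
  proof -
    have "x * c * b - b * c * x = b * \<Delta> (c * b)"
      by (simp add: \<Delta>_def x algebra_simps)
    then have "b * \<Delta> (c * b) \<in> H" using comm[OF that] n(2) by (auto simp: H_def)
    then have "iv b * (b * \<Delta> (c * b)) \<in> H" by (rule HD(5)[OF HD(8)[OF bH]])
    then show ?thesis using b(2) by (simp add: iv_cancel)
  qed
  have "1 \<in> F n" using F_one F_mono[of 0 n] by auto
  then have Db: "\<Delta> b \<in> H" using D_right_b[of 1] by simp
  have "F n \<subseteq> {q \<in> H. \<Delta> q \<in> H}"
  proof
    fix c assume c: "c \<in> F n"
    have "\<Delta> c = (\<Delta> (c * b) - c * \<Delta> b) * iv b"
      using b(2) by (simp add: Dmult iv_cancel_right)
    moreover have "c \<in> H" using c FnH by blast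
    ultimately show "c \<in> {q \<in> H. \<Delta> q \<in> H}"
      using D_right_b[OF c] Db bH by (simp add: HD)
  qed
  \<comment> \<open>The rule for the derivative of an inverse makes stability under
    \<open>\<Delta>\<close> pass from \<open>F n\<close> to the whole division ring that it
    generates.\<close>
  moreover have "division_subalgebra {q \<in> H. \<Delta> q \<in> H}"
    unfolding division_subalgebra_def subalgebra_def
  proof (intro conjI ballI)
    show "subspace {q \<in> H. \<Delta> q \<in> H}"
    proof (rule subspaceI)
      fix a c assume "a \<in> {q \<in> H. \<Delta> q \<in> H}" "c \<in> {q \<in> H. \<Delta> q \<in> H}"
      moreover have "\<Delta> (a + c) = \<Delta> a + \<Delta> c" by (simp add: \<Delta>_def algebra_simps)
      ultimately show "a + c \<in> {q \<in> H. \<Delta> q \<in> H}" by (simp add: HD)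
    next
      fix k a assume "a \<in> {q \<in> H. \<Delta> q \<in> H}"
      moreover have "\<Delta> (scale k a) = scale k (\<Delta> a)"
        by (simp add: \<Delta>_def scale_right_diff_distrib scale_mult_left[symmetric] scale_mult_right[symmetric])
      ultimately show "scale k a \<in> {q \<in> H. \<Delta> q \<in> H}" by (simp add: HD)
    qed (simp add: \<Delta>_def HD)
    show "1 \<in> {q \<in> H. \<Delta> q \<in> H}" by (simp add: \<Delta>_def HD)
    fix a assume a: "a \<in> {q \<in> H. \<Delta> q \<in> H}"
    then show "a * c \<in> {q \<in> H. \<Delta> q \<in> H}" if "c \<in> {q \<in> H. \<Delta> q \<in> H}" for c
      using that by (simp add: Dmult HD)
    have "\<Delta> (iv a) = - (iv a * \<Delta> a * iv a)"
    proof (cases "a = 0")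
      case False
      have "0 = \<Delta> (iv a * a)" using False by (simp add: iv_left \<Delta>_def)
      then have "\<Delta> (iv a) * a = - (iv a * \<Delta> a)" by (simp add: Dmult eq_neg_iff_add_eq_0)
      then have "\<Delta> (iv a) * a * iv a = - (iv a * \<Delta> a * iv a)" by simp
      then show ?thesis using False by (simp add: iv_cancel_right)
    qed (simp add: \<Delta>_def)
    then show "iv a \<in> {q \<in> H. \<Delta> q \<in> H}" using a by (simp add: HD)
  qed
  ultimately have "H \<subseteq> {q \<in> H. \<Delta> q \<in> H}" unfolding H_def by (intro hull_minimal)
  then interpret skew_polynomials scale H x'
    by unfold_locales (auto simp: H \<Delta>_def)
  have Hskew: "skew H t \<subseteq> skew H t'" if "t \<le> t'" for t t'
    using skew_mono[OF _ HD(3) that] by blast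
  \<comment> \<open>Writing \<open>x ^ Suc j\<close> as \<open>b * (x' * x ^ j)\<close> expands it
    in powers of \<open>x'\<close> with coefficients in \<open>H\<close>, without any increase of
    degree.\<close>
  have power_skew: "x ^ j \<in> skew H (Suc j)" for j
  proof (induction j)
    case 0
    show ?case using skewI[of "Suc 0" "\<lambda>_. 1" H] HD(2) by simp
  next
    case (Suc j)
    have "x' * x ^ j \<in> skew H (Suc (Suc j))"
      by (rule skew_mult_x[OF Suc HD(1) order_refl D_mem])
    then have "b * (x' * x ^ j) \<in> skew H (Suc (Suc j))"
      by (rule skew_mult_left) (rule HD(5)[OF bH])
    then show ?case by (simp add: x mult.assoc)
  qed
  define \<mu> where "\<mu> = (\<Sum>v\<in>V. m v)"
  have Vskew: "v \<in> skew H \<mu>" if v: "v \<in> V" for v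
  proof -
    have Fr: "F (r v) \<subseteq> H" using rn0[OF v] n(1) F_mono[of "r v" n] FnH by auto
    have m\<mu>: "m v \<le> \<mu>" using member_le_sum[of v V m] V(1) v by (simp add: \<mu>_def)
    have "e v j * x ^ j \<in> skew H \<mu>" if j: "j < m v" for j
    proof -
      have "e v j \<in> H" using e(3)[OF v j] Fr by blast
      moreover have "x ^ j \<in> skew H \<mu>" using power_skew Hskew[of "Suc j" \<mu>] j m\<mu> by auto
      ultimately show ?thesis by (intro skew_mult_left[of _ H] HD(5))
    qed
    then have "\<beta> v * v \<in> skew H \<mu>"
      unfolding e(4)[OF v] by (intro subspace_sum[OF skew_subspace[OF HD(1)]]) auto
    then have "iv (\<beta> v) * (\<beta> v * v) \<in> skew H \<mu>"
      by (rule skew_mult_left) (rule HD(5)[OF HD(8)[OF subsetD[OF Fr e(1)[OF v]]]])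
    then show ?thesis using e(2)[OF v] by (simp add: iv_cancel)
  qed
  have "\<exists>f. v = (\<Sum>j<\<mu>. f j * x' ^ j) \<and> (\<forall>j<\<mu>. f j \<in> H)" if "v \<in> V" for v
    using Vskew[OF that] unfolding skew_def by blast
  then obtain f where f: "\<And>v. v \<in> V \<Longrightarrow> v = (\<Sum>j<\<mu>. f v j * x' ^ j)"
    "\<And>v j. v \<in> V \<Longrightarrow> j < \<mu> \<Longrightarrow> f v j \<in> H" by metis
  define E where "E = (\<lambda>(v, j). f v j) ` (V \<times> {..<\<mu>})"
  have E: "finite E" "E \<subseteq> H" using V(1) f(2) by (auto simp: E_def)
  have VE: "V \<subseteq> skew (insert 1 E) \<mu>"
  proof
    fix v assume v: "v \<in> V"
    have "(\<Sum>j<\<mu>. f v j * x' ^ j) \<in> skew (insert 1 E) \<mu>"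
      using v by (intro skewI) (auto simp: E_def)
    then show "v \<in> skew (insert 1 E) \<mu>" using f(1)[OF v] by simp
  qed
  \<comment> \<open>From here on \<open>w\<close> replaces \<open>y\<close>: the chain rule holds
    for \<open>w\<close>, and the finite rank of \<open>H\<close> is established once more over
    k(w).\<close>
  obtain w where w: "w \<in> H" "transcendental w" "\<And>q. q \<in> H \<Longrightarrow> w * q = q * w"
    using center_nontrivial[OF y pn] by (auto simp: H_def)
  obtain \<beta>' c r' where w': "\<beta>' \<noteq> 0" "\<beta>' * w = c" "w * \<beta>' = c" "\<beta>' \<in> F r'" "c \<in> F r'"
    using central_fraction[OF y pn, of w] w by (auto simp: H_def)
  obtain S where S: "finite S" "S \<subseteq> H" "H \<subseteq> frac_span w S"
    using finite_rank[OF w', of n] by (auto simp: H_def)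
  let ?X = "(\<lambda>(s, t). s * t) ` (S \<times> S) \<union> D ` S \<union> (*) (D w) ` S \<union> insert 1 E"
  have "?X \<subseteq> H"
    using S(2) E(2) HD(2) HD(5) D_mem w(1) by (auto simp: subset_iff)
  then have "?X \<subseteq> frac_span w S" using S(3) by blast
  then obtain q d where q: "q \<noteq> 0" "degree q \<le> d"
    "\<forall>u\<in>?X. \<exists>f. (\<forall>s\<in>S. degree (f s) \<le> d) \<and> ev w q * u = (\<Sum>s\<in>S. ev w (f s) * s)"
    using common_denominator[OF S(1), of ?X w] S(1) E(1) by auto
  interpret skew_lattice scale H x' w S E q d
    by unfold_locales (fact | use w S E q(1,2) in \<open>simp; fail\<close> | rule q(3)[rule_format], assumption)+
  \<comment> \<open>Obtained from the count of spanning elements by replacing each added 1 by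
    \<open>n\<close>, which \<open>n \<ge> 1\<close> permits.\<close>
  define C where "C = (d * (2 * \<mu> + 1) + 1) * card S * (\<mu> + 1)"
  show ?thesis
  proof (intro exI[of _ C] allI impI)
    fix n :: nat assume n: "1 \<le> n"
    obtain T where T: "finite T" "card T \<le> (d * (2 * \<mu> * n + 1) + 1) * card S * (\<mu> * n + 1)"
      "skew (L (2 * \<mu> * n + 1)) (\<mu> * n + 1) \<subseteq> span T"
      using skew_L_spanning_set by blast
    have "d * (2 * \<mu> * n + 1) + 1 \<le> d * (2 * \<mu> * n + n) + n"
      using n by (intro add_mono mult_left_mono) auto
    also have "\<dots> = (d * (2 * \<mu> + 1) + 1) * n" by (simp add: algebra_simps)
    finally have 1: "d * (2 * \<mu> * n + 1) + 1 \<le> (d * (2 * \<mu> + 1) + 1) * n" .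
    have 2: "\<mu> * n + 1 \<le> (\<mu> + 1) * n" using n by (simp add: algebra_simps)
    have "card T \<le> (d * (2 * \<mu> + 1) + 1) * n * card S * ((\<mu> + 1) * n)"
      using T(2) mult_mono[OF mult_mono[OF 1 order_refl[of "card S"]] 2] by linarith
    also have "\<dots> = C * n\<^sup>2" by (simp add: C_def power2_eq_square algebra_simps)
    finally show "\<exists>T. finite T \<and> card T \<le> C * n\<^sup>2 \<and> subspace_power (span V) n \<subseteq> span T"
      using T subspace_power_skew_L[OF VE, of n] by blast
  qed
qed

end

subsection \<open>Domains with a locally nilpotent derivation\<close>

context k_algebra
begin

lemma dim_subspace_power_pos:
  assumes "generating_subspace V" shows "dim (subspace_power V n) \<ge> 1"
  using assms
  by (intro dim_pos subspace_subspace_power finite_dim_subspace_power one_in_subspace_power)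
    (auto simp: generating_subspace_def)

lemma growth_exponent_lessD:
  assumes V: "generating_subspace V" and t: "growth_exponent V < ereal t"
  shows "eventually (\<lambda>n. real (dim (subspace_power V n)) \<le> real n powr t) sequentially"
proof -
  have "eventually (\<lambda>n. ereal (ln (real (dim (subspace_power V n))) / ln (real n)) < ereal t) sequentially"
    using Limsup_lessD t unfolding growth_exponent_def by blast
  then show ?thesis using eventually_ge_at_top[of 2]
  proof eventually_elim
    case (elim n)
    have d: "real (dim (subspace_power V n)) > 0" using dim_subspace_power_pos[OF V, of n] by simp
    have "ln (real n) > 0" using elim by simp
    then have "ln (real (dim (subspace_power V n))) \<le> t * ln (real n)"
      using elim by (simp add: pos_divide_less_eq less_imp_le)
    then have "exp (ln (real (dim (subspace_power V n)))) \<le> exp (t * ln (real n))" by simp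
    then show ?case using d elim by (simp add: powr_def)
  qed
qed

text \<open>This feeds the Ore condition: the dimension is eventually at most \<open>n\<close>
  cubed, which an exponential overtakes. For \<open>p = 0\<close> the exponent gives no information,
  but \<open>V^0\<close> is a line.\<close>

lemma growth_below_exponential:
  assumes V: "generating_subspace V" and t: "growth_exponent V < 3"
  shows "\<exists>m. dim (subspace_power V (p * m)) < 2 ^ m"
proof (cases "p = 0")
  case True
  have "dim (span {1::'a}) \<le> card {1::'a}" by (intro dim_le_card) auto
  then show ?thesis using True by (intro exI[of _ 1]) simp
next
  case False
  have "growth_exponent V < ereal 3" using t by simp
  then obtain N where N: "\<And>n. n \<ge> N \<Longrightarrow> real (dim (subspace_power V n)) \<le> real n powr 3"
    using growth_exponent_lessD[OF V] unfolding eventually_sequentially by blast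
  have "real p > 0" using False by simp
  then have "eventually (\<lambda>m. (real p * real m) powr 3 < 2 ^ m) sequentially" by real_asymp
  then obtain M where M: "\<And>m. m \<ge> M \<Longrightarrow> (real p * real m) powr 3 < 2 ^ m"
    unfolding eventually_sequentially by blast
  have "max M N \<le> p * max M N" using mult_le_mono1[of 1 p "max M N"] False by linarith
  then have "N \<le> p * max M N" by linarith
  then have "real (dim (subspace_power V (p * max M N))) \<le> real (p * max M N) powr 3" by (rule N)
  also have "\<dots> < 2 ^ max M N" using M[of "max M N"] by simp
  finally have "real (dim (subspace_power V (p * max M N))) < real (2 ^ max M N)" by simp
  then show ?thesis unfolding of_nat_less_iff by blast
qed

text \<open>A real \<tau> strictly between the growth exponent and 3 leaves a positive power of
  \<open>n\<close> to absorb the dilation \<open>C\<close>.\<close>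

lemma growth_below_cubic:
  assumes V: "generating_subspace V" and t: "growth_exponent V < 3"
  shows "\<exists>n. dim (subspace_power V (C * n)) < (n + 1) ^ 3"
proof (cases "C = 0")
  case True
  have "dim (span {1::'a}) \<le> card {1::'a}" by (intro dim_le_card) auto
  then show ?thesis using True by (intro exI[of _ 1]) (simp add: eval_nat_numeral)
next
  case False
  obtain \<tau> where \<tau>: "growth_exponent V < ereal \<tau>" "ereal \<tau> < 3"
    using ereal_dense2[OF t] by blast
  then obtain N where N: "\<And>n. n \<ge> N \<Longrightarrow> real (dim (subspace_power V n)) \<le> real n powr \<tau>"
    using growth_exponent_lessD[OF V] unfolding eventually_sequentially by blast
  have "\<tau> < 3" using \<tau>(2) by simp
  have "(\<lambda>n. real n powr (\<tau> - 3)) \<longlonglongrightarrow> 0"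
    using \<open>\<tau> < 3\<close> by (intro tendsto_neg_powr filterlim_real_sequentially) simp
  then have "(\<lambda>n. real C powr \<tau> * real n powr (\<tau> - 3)) \<longlonglongrightarrow> real C powr \<tau> * 0"
    by (intro tendsto_intros)
  then have "eventually (\<lambda>n. real C powr \<tau> * real n powr (\<tau> - 3) < 1) sequentially"
    by (rule order_tendstoD) simp
  then obtain M where M: "\<And>n. n \<ge> M \<Longrightarrow> real C powr \<tau> * real n powr (\<tau> - 3) < 1"
    unfolding eventually_sequentially by blast
  define n where "n = max 1 (max M N)"
  have n: "n \<ge> 1" "n \<ge> M" "n \<ge> N" by (auto simp: n_def)
  have "n \<le> C * n" using False by simp
  then have "C * n \<ge> N" using n(3) by linarith
  then have "real (dim (subspace_power V (C * n))) \<le> real (C * n) powr \<tau>" by (rule N)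
  also have "\<dots> = (real C powr \<tau> * real n powr (\<tau> - 3)) * real n powr 3"
  proof -
    have "real n powr \<tau> = real n powr (\<tau> - 3) * real n powr 3"
      by (simp only: powr_add[symmetric]) simp
    then show ?thesis by (simp add: powr_mult mult.assoc)
  qed
  also have "\<dots> \<le> 1 * real n powr 3" using M[OF n(2)] by (intro mult_right_mono) auto
  also have "\<dots> = real (n ^ 3)" using n(1) by (simp add: powr_numeral)
  also have "\<dots> < real ((n + 1) ^ 3)" unfolding of_nat_less_iff by (intro power_strict_mono) auto
  finally show ?thesis unfolding of_nat_less_iff by blast
qed

lemma linear_growth_exponent:
  assumes V: "generating_subspace V" and C: "\<And>n. n \<ge> 1 \<Longrightarrow> dim (subspace_power V n) \<le> C * n"
  shows "growth_exponent V < 2"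
proof -
  \<comment> \<open>An exponent strictly between 1 and 2 absorbs the constant
    \<open>C\<close>.\<close>
  have "eventually (\<lambda>n. (real C * real n) \<le> real n powr (3/2)) sequentially" by real_asymp
  then have "eventually (\<lambda>n. ereal (ln (real (dim (subspace_power V n))) / ln (real n)) \<le> ereal (3/2)) sequentially"
    using eventually_ge_at_top[of 2]
  proof eventually_elim
    case (elim n)
    have "real (dim (subspace_power V n)) \<le> real n powr (3/2)"
      using C[of n] elim by (simp flip: of_nat_mult)
    then have "ln (real (dim (subspace_power V n))) \<le> ln (real n powr (3/2))"
      using dim_subspace_power_pos[OF V, of n] elim by (intro ln_le_cancel_iff[THEN iffD2]) auto
    also have "\<dots> = 3/2 * ln (real n)" using elim by (simp add: ln_powr)
    finally show ?case using elim by (simp add: pos_divide_le_eq)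
  qed
  then have "growth_exponent V \<le> ereal (3/2)" unfolding growth_exponent_def by (rule Limsup_bounded)
  also have "\<dots> < 2" by simp
  finally show ?thesis .
qed

end

text \<open>The element \<open>x\<close> is a local slice: it acts as a variable over the kernel,
  with derivative \<open>b\<close> in place of 1.\<close>

locale locally_nilpotent_derivation = k_algebra scale
  for scale :: "'k::{alg_closed_field, field_char_0} \<Rightarrow> 'a::ring_1_no_zero_divisors \<Rightarrow> 'a" +
  fixes \<delta> :: "'a \<Rightarrow> 'a" and V :: "'a set" and x :: 'a
  assumes derivation: "derivation \<delta>" and loc_nil: "locally_nilpotent \<delta>"
    and V: "generating_subspace V" and growth: "growth_exponent V < 3"
    and x: "\<delta> x \<noteq> 0" "\<delta> (\<delta> x) = 0"
begin

abbreviation b :: 'a where "b \<equiv> \<delta> x"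

definition B :: "'a set" where "B = {a. \<delta> a = 0}"

lemma \<delta>_mult: "\<delta> (a * c) = a * \<delta> c + \<delta> a * c"
  using derivation unfolding derivation_def by blast

lemma \<delta>_linear: "\<delta> (a + c) = \<delta> a + \<delta> c" "\<delta> (scale k a) = scale k (\<delta> a)" "\<delta> 0 = 0"
  "\<delta> (a - c) = \<delta> a - \<delta> c"
proof -
  interpret Vector_Spaces.linear scale scale \<delta> using derivation unfolding derivation_def by blast
  show "\<delta> (a + c) = \<delta> a + \<delta> c" "\<delta> (scale k a) = scale k (\<delta> a)" "\<delta> 0 = 0" "\<delta> (a - c) = \<delta> a - \<delta> c"
    by (rule add scale zero diff)+
qed

lemma \<delta>_one: "\<delta> 1 = 0"
  using \<delta>_mult[of 1 1] by simp

lemma subalgebra_B: "subalgebra B"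
  unfolding subalgebra_def B_def
  by (auto intro!: subspaceI simp: \<delta>_linear \<delta>_mult \<delta>_one)

lemma subspace_B: "subspace B" and B_mult: "a \<in> B \<Longrightarrow> c \<in> B \<Longrightarrow> a * c \<in> B" and one_B: "1 \<in> B"
  using subalgebra_B by (auto simp: subalgebra_def)

lemma b_B: "b \<in> B" using x by (simp add: B_def)

lemma B_power: "a \<in> B \<Longrightarrow> a ^ n \<in> B"
  by (induction n) (auto simp: one_B B_mult)

lemma iter_linear: "(\<delta> ^^ n) (a + c) = (\<delta> ^^ n) a + (\<delta> ^^ n) c" "(\<delta> ^^ n) 0 = 0"
  "(\<delta> ^^ n) (a - c) = (\<delta> ^^ n) a - (\<delta> ^^ n) c"
  by (induction n) (auto simp: \<delta>_linear)

lemma iter_sum: "(\<delta> ^^ n) (sum f I) = (\<Sum>i\<in>I. (\<delta> ^^ n) (f i))"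
  by (induction I rule: infinite_finite_induct) (auto simp: iter_linear)

lemma iter_B_mult: "c \<in> B \<Longrightarrow> (\<delta> ^^ n) (c * a) = c * (\<delta> ^^ n) a"
  by (induction n) (auto simp: \<delta>_mult B_def)

text \<open>The higher Leibniz rule stops after two terms because
  \<open>\<delta> (\<delta> x) = 0\<close>.\<close>

lemma iter_x_mult: "(\<delta> ^^ Suc n) (x * a) = x * (\<delta> ^^ Suc n) a + of_nat (Suc n) * (b * (\<delta> ^^ n) a)"
proof (induction n)
  case (Suc n)
  have "\<delta> (of_nat m * c) = of_nat m * \<delta> c" for m c
    by (induction m) (auto simp: \<delta>_linear distrib_right)
  then have "(\<delta> ^^ Suc (Suc n)) (x * a) = x * (\<delta> ^^ Suc (Suc n)) a + b * (\<delta> ^^ Suc n) a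
      + of_nat (Suc n) * (b * (\<delta> ^^ Suc n) a)"
    using Suc by (simp add: \<delta>_linear \<delta>_mult x del: of_nat_Suc)
  then show ?case by (simp add: algebra_simps)
qed (simp add: \<delta>_mult)

text \<open>Although \<open>x\<close> and \<open>b\<close> need not commute, no mixed words survive:
  in \<open>iter_x_mult\<close> the term with \<open>x\<close> in front contains an iterate that is
  0 by induction.\<close>

lemma iter_x_power: "(\<delta> ^^ n) (x ^ n) = of_nat (fact n) * b ^ n \<and> (\<delta> ^^ Suc n) (x ^ n) = 0"
proof (induction n)
  case (Suc n)
  then have 0: "(\<delta> ^^ Suc n) (x ^ n) = 0" and 1: "(\<delta> ^^ Suc (Suc n)) (x ^ n) = 0"
    by (auto simp: \<delta>_linear)
  have "(\<delta> ^^ Suc n) (x ^ Suc n) = of_nat (Suc n) * (b * (of_nat (fact n) * b ^ n))"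
    unfolding power_Suc[of x] iter_x_mult 0 using Suc by simp
  also have "\<dots> = of_nat (Suc n) * (of_nat (fact n) * (b * b ^ n))"
    by (metis mult.assoc mult_of_nat_commute)
  also have "\<dots> = of_nat (fact (Suc n)) * b ^ Suc n"
    by (simp only: power_Suc fact_Suc of_nat_mult mult.assoc of_nat_id)
  finally have "(\<delta> ^^ Suc n) (x ^ Suc n) = of_nat (fact (Suc n)) * b ^ Suc n" .
  moreover have "(\<delta> ^^ Suc (Suc n)) (x ^ Suc n) = 0"
    unfolding power_Suc[of x] iter_x_mult 0 1 by simp
  ultimately show ?case by blast
qed (simp add: \<delta>_one)

lemma iter_x_power_0: "m > n \<Longrightarrow> (\<delta> ^^ m) (x ^ n) = 0"
proof (induction m rule: nat_induct)
  case (Suc m)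
  then show ?case using iter_x_power[of n] by (cases "m = n") (auto simp: \<delta>_linear)
qed simp

lemma of_nat_eq_scale: "of_nat n = scale (of_nat n) (1::'a)"
  by (induction n) (auto simp: scale_left_distrib)

lemma of_nat_fact_nonzero: "of_nat (fact n) \<noteq> (0::'a)"
  by (subst of_nat_eq_scale) (simp add: scale_eq_0_iff)

text \<open>Applying \<open>\<delta> ^^ n\<close> to a relation of degree \<open>n\<close> leaves
  only the leading term, \<open>c n\<close> times \<open>n!\<close> times \<open>b ^ n\<close>, and
  \<open>n!\<close> is nonzero in characteristic 0.\<close>

lemma B_coefficients_zero:
  assumes "\<And>j. j < n \<Longrightarrow> c j \<in> B" "(\<Sum>j<n. c j * x ^ j) = 0" "j < n"
  shows "c j = 0"
  using assms
proof (induction n)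
  case (Suc n)
  have "(\<Sum>j<n. (\<delta> ^^ n) (c j * x ^ j)) = 0"
    using Suc.prems(1) by (intro sum.neutral) (auto simp: iter_B_mult iter_x_power_0)
  then have "(\<delta> ^^ n) (\<Sum>j<Suc n. c j * x ^ j) = (\<delta> ^^ n) (c n * x ^ n)"
    by (simp add: iter_linear iter_sum)
  moreover have "(\<delta> ^^ n) (\<Sum>j<Suc n. c j * x ^ j) = 0"
    unfolding Suc.prems(2) by (rule iter_linear(2))
  moreover have "(\<delta> ^^ n) (c n * x ^ n) = c n * (of_nat (fact n) * b ^ n)"
    using iter_B_mult[OF Suc.prems(1)[of n]] iter_x_power[of n] by simp
  ultimately have "c n * (of_nat (fact n) * b ^ n) = 0" by simp
  moreover have "of_nat (fact n) * b ^ n \<noteq> 0"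
    using x(1) of_nat_fact_nonzero[of n] by (intro no_zero_divisors power_not_zero)
  ultimately have "c n = 0" by (metis no_zero_divisors)
  then show ?case using Suc by (cases "j = n") auto
qed simp

lemma finite_dim_power: "finite_dim (subspace_power V n)" and V_one: "1 \<in> V"
  using V finite_dim_subspace_power by (auto simp: generating_subspace_def)

lemma power_mem: "a \<in> subspace_power V p \<Longrightarrow> a ^ n \<in> subspace_power V (p * n)"
  by (induction n) (auto simp: span_base intro: subspace_power_mult)

text \<open>Directness of the sum of the \<open>B x^j\<close> makes all \<open>s * x ^ j\<close>
  independent. Read one way this limits the growth of \<open>B\<close>, read the other way it gives
  the quadratic lower bound.\<close>

lemma card_times_le_dim:
  assumes S: "finite S" "independent S" "S \<subseteq> B" "S \<subseteq> subspace_power V m" and p: "x \<in> subspace_power V p"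
  shows "card S * (n + 1) \<le> dim (subspace_power V (m + p * n))"
proof -
  define t where "t = (\<lambda>(s, j). s * x ^ j)"
  let ?I = "S \<times> {..<n + 1}"
  have ind: "\<forall>i\<in>?I. g i = 0" if "(\<Sum>i\<in>?I. scale (g i) (t i)) = 0" for g
  proof -
    have "(\<Sum>i\<in>?I. scale (g i) (t i)) = (\<Sum>s\<in>S. \<Sum>j<n + 1. scale (g (s, j)) (t (s, j)))"
      unfolding sum.cartesian_product by (intro sum.cong) auto
    also have "\<dots> = (\<Sum>j<n + 1. (\<Sum>s\<in>S. scale (g (s, j)) s) * x ^ j)"
      by (subst sum.swap) (simp add: t_def sum_scale_mult)
    finally have "(\<Sum>j<n + 1. (\<Sum>s\<in>S. scale (g (s, j)) s) * x ^ j) = 0" using that by simp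
    moreover have "(\<Sum>s\<in>S. scale (g (s, j)) s) \<in> B" for j
      using S(3) by (intro subspace_sum[OF subspace_B] subspace_scale[OF subspace_B]) auto
    ultimately have "(\<Sum>s\<in>S. scale (g (s, j)) s) = 0" if "j < n + 1" for j
      using B_coefficients_zero[of "n + 1" "\<lambda>j. \<Sum>s\<in>S. scale (g (s, j)) s"] that by blast
    then show ?thesis using independent_sum_zeroD[OF S(2,1)] by fastforce
  qed
  have "t ` ?I \<subseteq> subspace_power V (m + p * n)"
  proof (clarsimp simp: t_def)
    fix s j assume s: "s \<in> S" and j: "j < Suc n"
    have "s * x ^ j \<in> subspace_power V (m + p * j)"
      using S(4) s by (intro subspace_power_mult power_mem p) auto
    moreover have "m + p * j \<le> m + p * n" using j by simp
    ultimately show "s * x ^ j \<in> subspace_power V (m + p * n)"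
      using subspace_power_mono[OF V_one] by blast
  qed
  moreover have "inj_on t ?I" "independent (t ` ?I)"
    by (rule independent_family, simp add: S(1), use ind in blast)+
  ultimately have "card ?I \<le> dim (subspace_power V (m + p * n))"
    using card_le_dim[OF finite_dim_power] by (metis card_image)
  then show ?thesis by (simp add: card_cartesian_product)
qed

lemma ore:
  assumes "subalgebra A" "a \<in> A" "c \<in> A" "c \<noteq> 0"
  shows "\<exists>r\<in>A. \<exists>s\<in>A. r \<noteq> 0 \<and> r * a = s * c"
  using assms by (intro ore_condition[OF _ V growth_below_exponential[OF V growth]]) auto

text \<open>Induction on the order of nilpotency: the Ore condition in \<open>B\<close> provides a
  left multiple of the last iterate of \<open>v\<close> that is a multiple of \<open>b ^ n\<close>;
  subtracting the corresponding multiple of \<open>x ^ n\<close>, divided by \<open>n!\<close>,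
  lowers the order.\<close>

lemma left_multiple_in_Bx:
  assumes "(\<delta> ^^ n) v = 0"
  shows "\<exists>\<beta>\<in>B. \<exists>c. \<beta> \<noteq> 0 \<and> (\<forall>j<n. c j \<in> B) \<and> \<beta> * v = (\<Sum>j<n. c j * x ^ j)"
  using assms
proof (induction n arbitrary: v)
  case 0
  then show ?case by (intro bexI[of _ 1]) (auto simp: one_B)
next
  case (Suc n)
  have "(\<delta> ^^ n) v \<in> B" using Suc.prems by (simp add: B_def)
  from ore[OF subalgebra_B this B_power[OF b_B] power_not_zero[OF x(1)]]
  obtain \<beta> e where \<beta>: "\<beta> \<in> B" "e \<in> B" "\<beta> \<noteq> 0" "\<beta> * (\<delta> ^^ n) v = e * b ^ n"
    by blast
  define e' where "e' = scale (inverse (of_nat (fact n))) e"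
  have e': "e' \<in> B" using \<beta>(2) subspace_scale[OF subspace_B] by (simp add: e'_def)
  have "e' * (of_nat (fact n) * b ^ n) = e * b ^ n"
  proof -
    have "e' * (of_nat (fact n) * b ^ n) = scale (inverse (of_nat (fact n))) (e * scale (of_nat (fact n)) 1) * b ^ n"
      unfolding e'_def of_nat_eq_scale[of "fact n"] by (simp only: scale_mult_left mult.assoc)
    also have "\<dots> = e * b ^ n"
      by (simp add: scale_mult_right[symmetric])
    finally show ?thesis .
  qed
  then have "(\<delta> ^^ n) (\<beta> * v - e' * x ^ n) = 0"
    unfolding iter_linear iter_B_mult[OF \<beta>(1)] iter_B_mult[OF e'] conjunct1[OF iter_x_power] \<beta>(4)
    by simp
  from Suc.IH[OF this] obtain \<gamma> c where \<gamma>: "\<gamma> \<in> B" "\<gamma> \<noteq> 0" "\<forall>j<n. c j \<in> B"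
    "\<gamma> * (\<beta> * v - e' * x ^ n) = (\<Sum>j<n. c j * x ^ j)"
    by (elim bexE exE conjE)
  have "\<gamma> * \<beta> * v = (\<Sum>j<Suc n. (if j = n then \<gamma> * e' else c j) * x ^ j)"
    using \<gamma>(4) by (simp add: right_diff_distrib mult.assoc diff_eq_eq)
  moreover have "\<gamma> * \<beta> \<in> B" "\<gamma> * \<beta> \<noteq> 0" using \<gamma>(1,2) \<beta>(1,3) by (auto simp: B_mult)
  moreover have "\<forall>j<Suc n. (if j = n then \<gamma> * e' else c j) \<in> B"
    using \<gamma>(1,3) e' by (auto simp: B_mult)
  ultimately show ?case
    by (intro bexI[of _ "\<gamma> * \<beta>"] exI[of _ "\<lambda>j. if j = n then \<gamma> * e' else c j"] conjI)
qed

text \<open>If \<open>B = k\<close>, then \<open>left_multiple_in_Bx\<close> makes every element a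
  polynomial in \<open>x\<close> over k, and the growth is at most linear.\<close>

lemma B_not_scalars:
  assumes "growth_exponent V \<ge> 2"
  shows "\<exists>y\<in>B. \<forall>c. y \<noteq> scale c 1"
proof (rule ccontr)
  assume "\<not> ?thesis"
  then have scalar: "\<exists>c. a = scale c 1" if "a \<in> B" for a using that by blast
  have span_x: "\<exists>n. v \<in> span ((\<lambda>j. x ^ j) ` {..<n})" for v
  proof -
    obtain n where "(\<delta> ^^ n) v = 0" using loc_nil by (auto simp: locally_nilpotent_def)
    from left_multiple_in_Bx[OF this]
    obtain \<beta> c where \<beta>: "\<beta> \<in> B" "\<beta> \<noteq> 0" "\<forall>j<n. c j \<in> B"
      "\<beta> * v = (\<Sum>j<n. c j * x ^ j)" by (elim bexE exE conjE)
    obtain k where k: "\<beta> = scale k 1" using scalar \<beta>(1) by blast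
    have "c j * x ^ j \<in> span ((\<lambda>j. x ^ j) ` {..<n})" if j: "j < n" for j
    proof -
      obtain l where "c j = scale l 1" using scalar \<beta>(3) j by blast
      then have "c j * x ^ j = scale l (x ^ j)" by (simp add: scale_eq_mult(1)[symmetric])
      moreover have "scale l (x ^ j) \<in> span ((\<lambda>j. x ^ j) ` {..<n})"
        using j by (intro span_scale span_base imageI) simp
      ultimately show ?thesis by simp
    qed
    then have "\<beta> * v \<in> span ((\<lambda>j. x ^ j) ` {..<n})" unfolding \<beta>(4) by (intro span_sum) auto
    then have "scale (inverse k) (scale k v) \<in> span ((\<lambda>j. x ^ j) ` {..<n})"
      by (intro span_scale[of "scale k v"]) (simp add: k scale_eq_mult(1)[symmetric])
    moreover have "k \<noteq> 0" using k \<beta>(2) by auto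
    ultimately show ?thesis by auto
  qed
  then obtain N where N: "\<And>v. v \<in> span ((\<lambda>j. x ^ j) ` {..<N v})" by metis
  obtain G where G: "finite G" "span G = V" using V by (auto simp: generating_subspace_def finite_dim_def)
  define \<mu> where "\<mu> = (\<Sum>v\<in>G. N v)"
  let ?X = "\<lambda>n. span ((\<lambda>j. x ^ j) ` {..<n})"
  have mono: "?X m \<subseteq> ?X n" if "m \<le> n" for m n using that by (intro span_mono) auto
  have "G \<subseteq> ?X \<mu>"
  proof
    fix v assume v: "v \<in> G"
    then have "N v \<le> \<mu>" using G(1) member_le_sum[of v G N] by (simp add: \<mu>_def)
    then show "v \<in> ?X \<mu>" using N[of v] mono by blast
  qed
  then have VX: "V \<subseteq> ?X (\<mu> + 1)" using G(2) mono[of \<mu> "\<mu> + 1"] span_minimal[of G "?X \<mu>"] by auto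
  \<comment> \<open>The space \<open>?X (m + 1)\<close> consists of polynomials of degree at most
    \<open>m\<close>; degrees add, hence the shifts by 1.\<close>
  have X_mult: "a * c \<in> ?X (m + n + 1)" if a: "a \<in> ?X (m + 1)" and c: "c \<in> ?X (n + 1)" for a c m n
    using a
  proof (induction rule: span_induct_alt)
    case base
    show ?case by (simp add: span_zero)
  next
    case (step k u z)
    then obtain i where i: "i < m + 1" "u = x ^ i" by blast
    have "u * c \<in> ?X (m + n + 1)" using c
    proof (induction rule: span_induct_alt)
      case base
      show ?case by (simp add: span_zero)
    next
      case (step k' u' z')
      then obtain j where j: "j < n + 1" "u' = x ^ j" by blast
      have "u * u' = x ^ (i + j)" using i j by (simp add: power_add)
      then have "u * u' \<in> ?X (m + n + 1)" using i j by (intro span_base) auto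
      then show ?case using step
        by (simp add: distrib_left scale_mult_right[symmetric] span_add span_scale)
    qed
    then show ?case using step by (simp add: distrib_right scale_mult_left[symmetric] span_add span_scale)
  qed
  have "subspace_power V n \<subseteq> ?X (\<mu> * n + 1)" for n
  proof (induction n)
    case 0
    show ?case unfolding subspace_power.simps by (rule span_mono) (auto intro: image_eqI[of _ _ 0])
  next
    case (Suc n)
    have "a * c \<in> ?X (\<mu> * Suc n + 1)" if "a \<in> V" "c \<in> subspace_power V n" for a c
      using X_mult[of a \<mu> c "\<mu> * n"] that VX Suc by auto
    then have "{a * c | a c. a \<in> V \<and> c \<in> subspace_power V n} \<subseteq> ?X (\<mu> * Suc n + 1)" by blast
    then show ?case unfolding subspace_power.simps by (rule span_minimal[OF _ subspace_span])
  qed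
  then have "dim (subspace_power V n) \<le> card ((\<lambda>j. x ^ j) ` {..<\<mu> * n + 1})" for n
    by (intro dim_le_card) auto
  then have "dim (subspace_power V n) \<le> \<mu> * n + 1" for n
    using card_image_le[of "{..<\<mu> * n + 1}" "\<lambda>j. x ^ j"] by (metis card_lessThan finite_lessThan order_trans)
  then have "dim (subspace_power V n) \<le> (\<mu> + 1) * n" if "n \<ge> 1" for n
    by (rule order_trans) (use that in simp)
  then have "growth_exponent V < 2" by (rule linear_growth_exponent[OF V])
  then show False using assms by simp
qed

lemma obtain_power:
  obtains p where "a \<in> subspace_power V p"
  using subspace_power_exhausts[OF V] by blast

text \<open>Since \<open>y\<close> is transcendental over k and the powers of \<open>x\<close> are
  independent over \<open>B\<close>, the products \<open>y ^ i * x ^ j\<close> with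
  \<open>i, j \<le> n\<close> are \<open>(n + 1)^2\<close> independent elements.\<close>

lemma quadratic_lower_bound:
  assumes y: "y \<in> B" "\<And>c. y \<noteq> scale c 1"
  shows "\<exists>C>0. \<forall>n\<ge>1. C * real n ^ 2 < real (dim (subspace_power V n))"
proof -
  obtain p p' where p: "y \<in> subspace_power V p" "x \<in> subspace_power V p'"
    using obtain_power by metis
  define P where "P = p + p' + 1"
  have bound: "(n + 1)\<^sup>2 \<le> dim (subspace_power V (P * n))" for n
  proof -
    let ?S = "(\<lambda>i. y ^ i) ` {..n}"
    have ind: "\<forall>i\<in>{..n}. g i = 0" if "(\<Sum>i\<in>{..n}. scale (g i) (y ^ i)) = 0" for g
    proof -
      define f where "f = (\<Sum>i\<le>n. monom (g i) i)"
      have "ev y f = 0" using that by (simp add: f_def ev_sum ev_monom)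
      then have "f = 0"
        using ev_eq_0_imp_scalar[of y f] alg_closed_imp_poly_has_root y(2) by force
      moreover have "coeff f i = g i" if "i \<le> n" for i using that by (simp add: f_def coeff_sum)
      ultimately show ?thesis by simp
    qed
    have inj: "inj_on (\<lambda>i. y ^ i) {..n}" and indep: "independent ?S"
      by (rule independent_family, simp, use ind in blast)+
    have SV: "?S \<subseteq> subspace_power V (p * n)"
    proof clarsimp
      fix i assume "i \<le> n"
      then show "y ^ i \<in> subspace_power V (p * n)"
        using power_mem[OF p(1), of i] subspace_power_mono[OF V_one, of "p * i" "p * n"] by auto
    qed
    have "card ?S * (n + 1) \<le> dim (subspace_power V (p * n + p' * n))"
      using B_power[OF y(1)] by (intro card_times_le_dim indep SV p(2)) auto
    also have "\<dots> \<le> dim (subspace_power V (P * n))"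
      by (intro dim_mono_finite_dim subspace_power_mono V_one finite_dim_power) (simp add: P_def algebra_simps)
    finally show ?thesis using inj by (simp add: card_image power2_eq_square)
  qed
  show ?thesis
  proof (intro exI[of _ "1 / real P ^ 2"] conjI allI impI)
    show "1 / real P ^ 2 > 0" by (simp add: P_def)
    fix n :: nat
    \<comment> \<open>Rounding \<open>n\<close> down to a multiple of \<open>P\<close> is paid for
      by the 1 in \<open>(n div P + 1)^2\<close>, which also makes the inequality strict.\<close>
    have "n < P * (n div P + 1)"
      using dividend_less_times_div[of P n] by (simp add: P_def)
    then have "real n < real P * real (n div P + 1)"
      unfolding of_nat_mult[symmetric] of_nat_less_iff .
    then have "real n ^ 2 < (real P * real (n div P + 1)) ^ 2" by (intro power_strict_mono) auto
    also have "\<dots> = real P ^ 2 * real ((n div P + 1)\<^sup>2)" by (simp add: power_mult_distrib)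
    also have "\<dots> \<le> real P ^ 2 * real (dim (subspace_power V (P * (n div P))))"
      using bound[of "n div P"] by (intro mult_left_mono) (simp_all only: of_nat_le_iff zero_le_power2)
    also have "\<dots> \<le> real P ^ 2 * real (dim (subspace_power V n))"
      using dim_mono_finite_dim[OF subspace_power_mono[OF V_one] finite_dim_power, of "P * (n div P)" n]
      by (intro mult_left_mono) auto
    finally show "1 / real P ^ 2 * real n ^ 2 < real (dim (subspace_power V n))"
      by (simp add: P_def field_simps)
  qed
qed

end

section \<open>Transfer between the domain and its division ring of fractions\<close>

context locally_nilpotent_derivation
begin

definition fscale :: "'k \<Rightarrow> 'a fractions \<Rightarrow> 'a fractions" where
  "fscale c q = frac_of (scale c 1) * q"

lemma frac_of_scale: "frac_of (scale c a) = fscale c (frac_of a)"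
  unfolding fscale_def frac_of_mult[symmetric] scale_eq_mult(1)[symmetric] ..

lemma division_algebra_fractions: "division_algebra fscale"
proof unfold_locales
  fix c d :: 'k and p q :: "'a fractions"
  have central: "frac_of (scale c 1) * q = q * frac_of (scale c 1)" for q
    by (rule frac_of_central) (simp add: scale_eq_mult[symmetric])
  show "fscale c (p + q) = fscale c p + fscale c q"
    by (simp add: fscale_def distrib_left)
  show "fscale (c + d) q = fscale c q + fscale d q"
    by (simp add: fscale_def scale_left_distrib frac_of_add distrib_right)
  show "fscale c (fscale d q) = fscale (c * d) q"
    by (simp add: fscale_def mult.assoc[symmetric] frac_of_mult[symmetric] scale_eq_mult(1)[symmetric])
  show "fscale 1 q = q" by (simp add: fscale_def)
  show "fscale c (p * q) = fscale c p * q" by (simp add: fscale_def mult.assoc)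
  show "fscale c (p * q) = p * fscale c q" unfolding fscale_def by (metis central mult.assoc)
next
  fix q :: "'a fractions" assume "q \<noteq> 0"
  moreover have "subalgebra UNIV" by (simp add: subalgebra_def)
  ultimately show "\<exists>p. q * p = 1 \<and> p * q = 1"
    using ore[of UNIV] by (intro fractions_invertible) blast+
qed

lemma linear_frac_of: "Vector_Spaces.linear scale fscale frac_of"
proof -
  interpret Q: division_algebra fscale by (rule division_algebra_fractions)
  show ?thesis by unfold_locales (simp_all add: frac_of_add frac_of_scale)
qed

definition F :: "nat \<Rightarrow> 'a fractions set" where
  "F n = frac_of ` (B \<inter> subspace_power V n)"

lemma independent_frac_of:
  assumes "independent S" shows "\<not> module.dependent fscale (frac_of ` S)"
proof -
  interpret Q: division_algebra fscale by (rule division_algebra_fractions)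
  interpret vector_space_pair scale fscale ..
  show ?thesis
    using assms linear_frac_of
    by (intro linear_independent_injective_image) (auto simp: inj_on_def frac_of_eq_iff)
qed

lemma independent_of_frac_of:
  assumes "\<not> module.dependent fscale (frac_of ` S)" "finite S" shows "independent S"
proof -
  interpret Q: division_algebra fscale by (rule division_algebra_fractions)
  have inj: "inj_on frac_of S" by (auto simp: inj_on_def frac_of_eq_iff)
  show ?thesis
  proof
    assume "dependent S"
    then obtain u v where u: "v \<in> S" "u v \<noteq> 0" "(\<Sum>v\<in>S. scale (u v) v) = 0"
      using assms(2) by (auto simp: dependent_finite)
    have "(\<Sum>v\<in>S. fscale (u v) (frac_of v)) = frac_of (\<Sum>v\<in>S. scale (u v) v)"
      by (simp add: frac_of_sum frac_of_scale)
    then have "(\<Sum>q\<in>frac_of ` S. fscale (u (the_inv_into S frac_of q)) q) = 0"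
      using u(3) by (simp add: sum.reindex[OF inj] the_inv_into_f_f[OF inj])
    moreover have "u (the_inv_into S frac_of (frac_of v)) \<noteq> 0"
      using u by (simp add: the_inv_into_f_f[OF inj])
    ultimately show False
      using assms u(1) Q.independent_sum_zeroD[of "frac_of ` S" "\<lambda>q. u (the_inv_into S frac_of q)" "frac_of v"]
      by simp
  qed
qed

lemma finite_dim_subspace:
  assumes "subspace U" "U \<subseteq> W" "finite_dim W" shows "finite_dim U"
proof -
  obtain G where G: "finite G" "span G = W" using assms(3) by (auto simp: finite_dim_def)
  obtain S where S: "S \<subseteq> U" "independent S" "U \<subseteq> span S" "card S = dim U"
    using basis_exists by blast
  then have "S \<subseteq> span G" using G(2) assms(2) by blast
  then have "finite S" using independent_span_bound[OF G(1) S(2)] by blast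
  moreover have "span S = U" using S(3) span_minimal[OF S(1) assms(1)] by blast
  ultimately show ?thesis unfolding finite_dim_def by blast
qed

text \<open>An independent \<open>T\<close> in \<open>B\<close> and \<open>V^(C n)\<close> gives
  \<open>card T * (n + 1)\<close> independent elements of \<open>V^((C + p) n)\<close>, whose
  dimension is below \<open>(n + 1)^3\<close> for some \<open>n\<close>; cancel
  \<open>n + 1\<close>.\<close>

lemma subquadratic: "subquadratic_filtration fscale F"
proof -
  interpret Q: division_algebra fscale by (rule division_algebra_fractions)
  interpret vector_space_pair scale fscale ..
  have sub: "subspace (B \<inter> subspace_power V n)" for n
    by (intro subspace_inter subspace_B subspace_subspace_power)
  show ?thesis
  proof unfold_locales
    show "Q.subspace (F n)" for n
      unfolding F_def using linear_frac_of sub by (rule linear_subspace_image)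
    show "1 \<in> F 0"
      unfolding F_def by (rule image_eqI[of _ _ 1]) (auto simp: one_B span_base)
    show "F m \<subseteq> F n" if "m \<le> n" for m n
      unfolding F_def using subspace_power_mono[OF V_one that] by blast
    show "p * q \<in> F (m + n)" if "p \<in> F m" "q \<in> F n" for p q m n
    proof -
      obtain a c where a: "a \<in> B \<inter> subspace_power V m" "p = frac_of a"
        and c: "c \<in> B \<inter> subspace_power V n" "q = frac_of c"
        using \<open>p \<in> F m\<close> \<open>q \<in> F n\<close> unfolding F_def by blast
      have "a * c \<in> B \<inter> subspace_power V (m + n)"
        using a(1) c(1) by (simp add: B_mult subspace_power_mult)
      then show ?thesis unfolding F_def a(2) c(2) frac_of_mult[symmetric] by (rule imageI)
    qed
    show "Q.finite_dim (F n)" for n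
    proof -
      obtain G where G: "finite G" "span G = B \<inter> subspace_power V n"
        using finite_dim_subspace[OF sub Int_lower2 finite_dim_power] unfolding finite_dim_def by blast
      have "Q.span (frac_of ` G) = F n"
        using linear_span_image[OF linear_frac_of, of G] G(2) by (simp add: F_def)
      then show ?thesis using G(1) by (auto simp: Q.finite_dim_def)
    qed
    show "\<exists>n. \<forall>S. finite S \<longrightarrow> Q.independent S \<longrightarrow> S \<subseteq> F (C * n) \<longrightarrow> card S < (n + 1)\<^sup>2" for C
    proof -
      obtain p where p: "x \<in> subspace_power V p" using subspace_power_exhausts[OF V] by blast
      obtain n where n: "dim (subspace_power V ((C + p) * n)) < (n + 1) ^ 3"
        using growth_below_cubic[OF V growth] by blast
      have "card S < (n + 1)\<^sup>2" if S: "finite S" "Q.independent S" "S \<subseteq> F (C * n)" for S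
      proof -
        obtain T where T: "T \<subseteq> B \<inter> subspace_power V (C * n)" "S = frac_of ` T"
          using S(3) unfolding F_def by (auto simp: subset_image_iff)
        have inj: "inj_on frac_of T" by (auto simp: inj_on_def frac_of_eq_iff)
        have "finite T" using S(1) T(2) finite_imageD inj by blast
        moreover have "independent T" using independent_of_frac_of[of T] S(2) T(2) \<open>finite T\<close> by simp
        ultimately have "card T * (n + 1) \<le> dim (subspace_power V (C * n + p * n))"
          using T(1) by (intro card_times_le_dim p) auto
        also have "\<dots> < (n + 1)\<^sup>2 * (n + 1)"
          using n by (simp add: distrib_right power3_eq_cube power2_eq_square)
        finally have "card T < (n + 1)\<^sup>2" by (simp only: mult_less_cancel2)
        then show ?thesis using T(2) inj by (simp add: card_image)
      qed
      then show ?thesis by blast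
    qed
  qed
qed

text \<open>The bound for filtered division algebras is pulled back along \<open>frac_of\<close>:
  the image of a basis of \<open>V^n\<close> is independent and lies in the span of quadratically
  many elements.\<close>

lemma quadratic_upper_bound:
  assumes y: "y \<in> B" "\<And>c. y \<noteq> scale c 1"
  shows "\<exists>C. \<forall>n\<ge>1. dim (subspace_power V n) \<le> C * n\<^sup>2"
proof -
  interpret Q: subquadratic_filtration fscale F by (rule subquadratic)
  interpret vector_space_pair scale fscale ..
  obtain G where G: "finite G" "span G = V" using V by (auto simp: generating_subspace_def finite_dim_def)
  obtain p1 p2 h where p: "b \<in> subspace_power V p1" "y \<in> subspace_power V p2" "x \<in> subspace_power V h"
    using subspace_power_exhausts[OF V] by metis
  define p where "p = max p1 p2"
  have pV: "b \<in> subspace_power V p" "y \<in> subspace_power V p"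
    using p subspace_power_mono[OF V_one, of p1 p] subspace_power_mono[OF V_one, of p2 p]
    by (auto simp: p_def)
  have "\<exists>C. \<forall>n\<ge>1. \<exists>T. finite T \<and> card T \<le> C * n\<^sup>2 \<and>
      Q.subspace_power (Q.span (frac_of ` G)) n \<subseteq> Q.span T"
  proof (rule Q.quadratic_upper_bound)
    show "frac_of b \<in> F p" using b_B pV by (simp add: F_def)
    show "frac_of b \<noteq> 0" using x(1) frac_of_eq_iff[of b 0] by simp
    show "frac_of y \<in> F p" using y(1) pV by (simp add: F_def)
    show "Q.transcendental (frac_of y)"
      unfolding Q.transcendental_def
    proof
      fix c
      show "frac_of y \<noteq> fscale c 1"
        using y(2)[of c] frac_of_scale[of c 1] frac_of_eq_iff[of y "scale c 1"] by simp
    qed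
    show "finite (frac_of ` G)" using G by simp
    show "frac_of x * c * frac_of b - frac_of b * c * frac_of x \<in> F (n + (h + p))" if c: "c \<in> F n" for c n
    proof -
      obtain a where a: "a \<in> B" "a \<in> subspace_power V n" "c = frac_of a" using c by (auto simp: F_def)
      \<comment> \<open>Both products have derivative \<open>b * a * b\<close>.\<close>
      have "x * a * b - b * a * x \<in> B"
        using a(1) x(2) by (simp add: B_def \<delta>_linear \<delta>_mult)
      moreover have "x * a * b \<in> subspace_power V (h + n + p)" "b * a * x \<in> subspace_power V (p + n + h)"
        using p(3) pV a(2) by (auto intro!: subspace_power_mult)
      then have "x * a * b - b * a * x \<in> subspace_power V (n + (h + p))"
        by (intro subspace_diff subspace_subspace_power) (simp_all add: ac_simps)
      ultimately show ?thesis unfolding F_def a(3) by (auto simp flip: frac_of_mult frac_of_diff)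
    qed
    fix v assume "v \<in> frac_of ` G"
    then obtain u where u: "v = frac_of u" by blast
    obtain m where "(\<delta> ^^ m) u = 0" using loc_nil by (auto simp: locally_nilpotent_def)
    from left_multiple_in_Bx[OF this]
    obtain \<beta> c where \<beta>: "\<beta> \<in> B" "\<beta> \<noteq> 0" "\<forall>j<m. c j \<in> B" "\<beta> * u = (\<Sum>j<m. c j * x ^ j)"
      by (elim bexE exE conjE)
    obtain f where f: "\<And>a. a \<in> subspace_power V (f a)" using subspace_power_exhausts[OF V] by metis
    define r where "r = f \<beta> + (\<Sum>j<m. f (c j))"
    have c: "c j \<in> subspace_power V r" if "j < m" for j
    proof -
      have "f (c j) \<le> r" using member_le_sum[of j "{..<m}" "\<lambda>j. f (c j)"] that by (simp add: r_def)
      then show ?thesis using f[of "c j"] subspace_power_mono[OF V_one] by blast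
    qed
    have "\<beta> \<in> subspace_power V r"
      using f[of \<beta>] subspace_power_mono[OF V_one, of "f \<beta>" r] by (auto simp: r_def)
    then have "frac_of \<beta> \<in> F r" using \<beta>(1) by (simp add: F_def)
    moreover have "frac_of \<beta> \<noteq> 0" using \<beta>(2) frac_of_eq_iff[of \<beta> 0] by simp
    moreover have "\<forall>j<m. frac_of (c j) \<in> F r" using c \<beta>(3) by (simp add: F_def)
    moreover have "frac_of \<beta> * v = (\<Sum>j<m. frac_of (c j) * frac_of x ^ j)"
      unfolding u frac_of_mult[symmetric] \<beta>(4) by (simp add: frac_of_sum frac_of_mult frac_of_power)
    ultimately show "\<exists>r \<beta> m e. \<beta> \<in> F r \<and> \<beta> \<noteq> 0 \<and> (\<forall>j<m. e j \<in> F r) \<and> \<beta> * v = (\<Sum>j<m. e j * frac_of x ^ j)"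
      by (intro exI[of _ r] exI[of _ "frac_of \<beta>"] exI[of _ m] exI[of _ "\<lambda>j. frac_of (c j)"] conjI)
  qed
  then obtain C where C: "\<forall>n\<ge>1. \<exists>T. finite T \<and> card T \<le> C * n\<^sup>2 \<and>
      Q.subspace_power (Q.span (frac_of ` G)) n \<subseteq> Q.span T" by blast
  have spanG: "Q.span (frac_of ` G) = frac_of ` V"
    using linear_span_image[OF linear_frac_of, of G] G(2) by simp
  have power: "frac_of ` subspace_power V n \<subseteq> Q.subspace_power (frac_of ` V) n" for n
  proof (induction n)
    case 0
    show ?case using linear_span_image[OF linear_frac_of, of "{1}"] by simp
  next
    case (Suc n)
    have "frac_of ` subspace_power V (Suc n)
        = Q.span (frac_of ` {a * c | a c. a \<in> V \<and> c \<in> subspace_power V n})"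
      using linear_span_image[OF linear_frac_of, of "{a * c | a c. a \<in> V \<and> c \<in> subspace_power V n}"] by simp
    also have "\<dots> \<subseteq> Q.subspace_power (frac_of ` V) (Suc n)"
      unfolding Q.subspace_power.simps
    proof (rule Q.span_mono, rule image_subsetI)
      fix z assume "z \<in> {a * c | a c. a \<in> V \<and> c \<in> subspace_power V n}"
      then obtain a c where z: "z = a * c" "a \<in> V" "c \<in> subspace_power V n" by blast
      then have "frac_of a \<in> frac_of ` V" "frac_of c \<in> Q.subspace_power (frac_of ` V) n"
        using Suc by blast+
      then show "frac_of z \<in> {p * q | p q. p \<in> frac_of ` V \<and> q \<in> Q.subspace_power (frac_of ` V) n}"
        unfolding z(1) frac_of_mult by blast
    qed
    finally show ?case .
  qed
  have "dim (subspace_power V n) \<le> C * n\<^sup>2" if "n \<ge> 1" for n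
  proof -
    from C[rule_format, OF that] obtain T where T: "finite T" "card T \<le> C * n\<^sup>2"
      "Q.subspace_power (Q.span (frac_of ` G)) n \<subseteq> Q.span T" by (elim exE conjE)
    obtain S where S: "S \<subseteq> subspace_power V n" "independent S"
      "subspace_power V n \<subseteq> span S" "card S = dim (subspace_power V n)"
      by (rule basis_exists[of "subspace_power V n"])
    have "frac_of ` S \<subseteq> Q.span T"
      using image_mono[OF S(1), of frac_of] power[of n] T(3) unfolding spanG by (meson order_trans)
    then have "card (frac_of ` S) \<le> card T"
      using Q.independent_span_bound[OF T(1) independent_frac_of[OF S(2)]] by simp
    moreover have "inj_on frac_of S" by (auto simp: inj_on_def frac_of_eq_iff)
    ultimately show ?thesis using S(4) T(2) by (simp add: card_image)
  qed
  then show ?thesis by blast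
qed

end

text \<open>At a point where \<delta> does not vanish, the first vanishing iterate has index at
  least 2; the iterate two steps before it is a local slice.\<close>

lemma (in k_algebra) locally_nilpotent_slice:
  assumes d: "derivation \<delta>" and n: "locally_nilpotent \<delta>" and nz: "\<delta> \<noteq> (\<lambda>_. 0)"
  shows "\<exists>x. \<delta> x \<noteq> 0 \<and> \<delta> (\<delta> x) = 0"
proof -
  obtain a where a: "\<delta> a \<noteq> 0" using nz by fastforce
  have \<delta>0: "\<delta> 0 = 0"
  proof -
    interpret Vector_Spaces.linear scale scale \<delta> using d unfolding derivation_def by blast
    show ?thesis by (rule zero)
  qed
  define m where "m = (LEAST m. (\<delta> ^^ m) a = 0)"
  have m: "(\<delta> ^^ m) a = 0" unfolding m_def using n by (auto simp: locally_nilpotent_def intro: LeastI_ex)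
  have "m \<noteq> 0"
  proof
    assume "m = 0"
    then have "a = 0" using m by simp
    then show False using a \<delta>0 by simp
  qed
  moreover have "m \<noteq> 1" using m a by auto
  ultimately obtain k where k: "m = Suc (Suc k)" by (metis One_nat_def not0_implies_Suc)
  have "(\<delta> ^^ Suc k) a \<noteq> 0" using not_less_Least[of "Suc k" "\<lambda>m. (\<delta> ^^ m) a = 0"] k m_def by simp
  then show ?thesis using m k by (intro exI[of _ "(\<delta> ^^ k) a"]) simp
qed

theorem mainTheorem3:
  fixes scale :: "'k::{alg_closed_field, field_char_0} \<Rightarrow> 'a::ring_1_no_zero_divisors \<Rightarrow> 'a"
    and \<delta> :: "'a \<Rightarrow> 'a"
  assumes "k_algebra scale"
    and "k_algebra.finitely_generated scale"
    and "2 \<le> k_algebra.GKdim scale"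
    and "k_algebra.GKdim scale < 3"
    and "k_algebra.derivation scale \<delta>"
    and "k_algebra.locally_nilpotent \<delta>"
    and "\<delta> \<noteq> (\<lambda>_. 0)"
  shows "k_algebra.quadratic_growth scale"
proof -
  interpret k_algebra scale by fact
  obtain V where V: "generating_subspace V" using assms(2) finitely_generated_iff by blast
  have gk: "2 \<le> growth_exponent V" "growth_exponent V < 3" using assms(3,4) GKdim_eq[OF V] by auto
  obtain x where x: "\<delta> x \<noteq> 0" "\<delta> (\<delta> x) = 0"
    using locally_nilpotent_slice assms(5-7) by blast
  interpret locally_nilpotent_derivation scale \<delta> V x
    by unfold_locales (use assms(5,6) V gk x in blast)+
  obtain y where y: "y \<in> B" "\<And>c. y \<noteq> scale c 1" using B_not_scalars gk(1) by blast
  obtain C1 where C1: "C1 > 0" "\<And>n. n \<ge> 1 \<Longrightarrow> C1 * real n ^ 2 < real (dim (subspace_power V n))"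
    using quadratic_lower_bound[OF y] by blast
  obtain C where C: "\<And>n. n \<ge> 1 \<Longrightarrow> dim (subspace_power V n) \<le> C * n\<^sup>2"
    using quadratic_upper_bound[OF y] by blast
  \<comment> \<open>The summand 1 turns the bound into a strict one, because \<open>n ^ 2\<close> is
    positive.\<close>
  have "real (dim (subspace_power V n)) < (real C + 1) * real n ^ 2" if n: "n \<ge> 1" for n
  proof -
    have "real (dim (subspace_power V n)) \<le> real (C * n\<^sup>2)" using C[OF n] by (simp only: of_nat_le_iff)
    also have "\<dots> < (real C + 1) * real n ^ 2" using n by (simp add: algebra_simps)
    finally show ?thesis .
  qed
  then show ?thesis
    unfolding quadratic_growth_def using V C1
    by (intro exI[of _ V] conjI exI[of _ C1] exI[of _ "real C + 1"]) auto
qed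

end
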